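(* Let $n\ge1$, $t>0$, $\lambda\in\mathbb{R}\setminus\{0\}$, and let $F\in\mathcal B_t^\lambda(\mathbb{C}^{2n})$. For $s>0$ and $\mathbf a,\mathbf b\in\mathbb{R}^n$ put $$F_s(\mathbf a,\mathbf b)=\int_{\mathbb{C}^{2n}}F(\mathbf z+\mathbf a,\mathbf w+\mathbf b)\,e^{\frac{i\lambda}{2}(\mathbf a\cdot\mathbf w-\mathbf b\cdot\mathbf z)}\,\overline{p_{t+s}^\lambda(\mathbf z,\mathbf w)}\,W_t^\lambda(\mathbf z,\mathbf w)\,d\mathbf z\,d\mathbf w$$ (the integral converges absolutely). Then $F_s\in L^2(\mathbb{R}^{2n})$ for all $s>0$ and $(H_t^\lambda)^{-1}(F)=\lim_{s\to0^+}F_s$, the limit taken in $L^2(\mathbb{R}^{2n})$.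
   Context: For $\mathbf a,\mathbf b\in\mathbb{C}^n$ write $\mathbf a\cdot\mathbf b=\sum_j a_jb_j$. For $r>0$ let $p_r^\lambda(\mathbf z,\mathbf w)=(4\pi)^{-n}\left(\frac{\lambda}{\sinh(r\lambda)}\right)^n\exp\!\big(-\tfrac{\lambda}{4}\coth(r\lambda)(\mathbf z\cdot\mathbf z+\mathbf w\cdot\mathbf w)\big)$, $(\mathbf z,\mathbf w)\in\mathbb{C}^{2n}$. The $\lambda$-twisted heat kernel transform is $H_t^\lambda(f)(\mathbf z,\mathbf w)=\int_{\mathbb{R}^{2n}} f(\mathbf x',\mathbf u')p_t^\lambda(\mathbf z-\mathbf x',\mathbf w-\mathbf u')e^{-\frac{i\lambda}{2}(\mathbf x'\cdot\mathbf w-\mathbf u'\cdot\mathbf z)}d\mathbf x'd\mathbf u'$ for $f\in L^2(\mathbb{R}^{2n})$. $W_t^\lambda(\mathbf x+i\mathbf y,\mathbf u+i\mathbf v)=4^n e^{\lambda(\mathbf u\cdot\mathbf y-\mathbf v\cdot\mathbf x)}p_{2t}^\lambda(2\mathbf y,2\mathbf v)$, and $\mathcal B_t^\lambda(\mathbb{C}^{2n})$ is the Hilbert space of entire $F$ with $\int|F|^2W_t^\lambda<\infty$; $H_t^\lambda:L^2(\mathbb{R}^{2n})\to\mathcal B_t^\lambda(\mathbb{C}^{2n})$ is a bijection (isometric isomorphism), so $(H_t^\lambda)^{-1}$ is defined. *)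

theory Defs
  imports "HOL-Analysis.Analysis"
begin

text \<open>Points of C^n are vectors complex^'n, points of R^n are real^'n; n = CARD('n).
  C^{2n} is (complex^'n) \<times> (complex^'n), R^{2n} is (real^'n) \<times> (real^'n), both with Lebesgue measure lborel.\<close>

definition cdot :: "complex^'n \<Rightarrow> complex^'n \<Rightarrow> complex" where
  "cdot a b = (\<Sum>j\<in>UNIV. a$j * b$j)"

definition rdot :: "real^'n \<Rightarrow> real^'n \<Rightarrow> real" where
  "rdot a b = (\<Sum>j\<in>UNIV. a$j * b$j)"

definition cvec :: "real^'n \<Rightarrow> complex^'n" where
  "cvec x = (\<chi> j. complex_of_real (x$j))"

definition Revec :: "complex^'n \<Rightarrow> real^'n" where
  "Revec z = (\<chi> j. Re (z$j))"

definition Imvec :: "complex^'n \<Rightarrow> real^'n" where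
  "Imvec z = (\<chi> j. Im (z$j))"

definition coth :: "real \<Rightarrow> real" where
  "coth x = cosh x / sinh x"

definition ptw :: "real \<Rightarrow> real \<Rightarrow> complex^'n \<Rightarrow> complex^'n \<Rightarrow> complex" where
  "ptw lam r z w =
     complex_of_real ((4*pi) powi (- int CARD('n)) * (lam / sinh (r*lam)) ^ CARD('n))
     * exp (- complex_of_real (lam/4 * coth (r*lam)) * (cdot z z + cdot w w))"

definition Htw :: "real \<Rightarrow> real \<Rightarrow> ((real^'n) \<times> (real^'n) \<Rightarrow> complex)
                    \<Rightarrow> (complex^'n) \<times> (complex^'n) \<Rightarrow> complex" where
  "Htw lam t f = (\<lambda>(z,w). integral\<^sup>L lborel (\<lambda>(x',u').
      f (x',u') * ptw lam t (z - cvec x') (w - cvec u')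
      * exp (- (\<i> * complex_of_real (lam/2)) * (cdot (cvec x') w - cdot (cvec u') z))))"

definition Wtw :: "real \<Rightarrow> real \<Rightarrow> (complex^'n) \<times> (complex^'n) \<Rightarrow> real" where
  "Wtw lam t = (\<lambda>(z,w). 4 ^ CARD('n)
      * exp (lam * (rdot (Revec w) (Imvec z) - rdot (Imvec w) (Revec z)))
      * Re (ptw lam (2*t) (cvec (2 *\<^sub>R Imvec z)) (cvec (2 *\<^sub>R Imvec w))))"

definition cscale :: "complex \<Rightarrow> (complex^'n) \<times> (complex^'n) \<Rightarrow> (complex^'n) \<times> (complex^'n)" where
  "cscale c p = ((\<chi> j. c * fst p $ j), (\<chi> j. c * snd p $ j))"

text \<open>Entire functions on C^{2n}: complex (Frechet) differentiable everywhere, i.e.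
  real differentiable with complex-linear derivative.\<close>
definition entire2n :: "((complex^'n) \<times> (complex^'n) \<Rightarrow> complex) \<Rightarrow> bool" where
  "entire2n F \<longleftrightarrow> (\<forall>p. \<exists>L. (F has_derivative L) (at p) \<and> (\<forall>v. L (cscale \<i> v) = \<i> * L v))"

definition Btw :: "real \<Rightarrow> real \<Rightarrow> ((complex^'n) \<times> (complex^'n) \<Rightarrow> complex) set" where
  "Btw lam t = {F. entire2n F \<and>
      (\<integral>\<^sup>+ p. ennreal ((cmod (F p))\<^sup>2 * Wtw lam t p) \<partial>lborel) < \<infinity>}"

definition L2 :: "((real^'n) \<times> (real^'n) \<Rightarrow> complex) \<Rightarrow> bool" where
  "L2 f \<longleftrightarrow> f \<in> borel_measurable lborel \<and>
     (\<integral>\<^sup>+ x. ennreal ((cmod (f x))\<^sup>2) \<partial>lborel) < \<infinity>"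

definition L2dist2 :: "((real^'n) \<times> (real^'n) \<Rightarrow> complex) \<Rightarrow> ((real^'n) \<times> (real^'n) \<Rightarrow> complex) \<Rightarrow> ennreal" where
  "L2dist2 f g = (\<integral>\<^sup>+ x. ennreal ((cmod (f x - g x))\<^sup>2) \<partial>lborel)"

definition Fs_integrand :: "real \<Rightarrow> real \<Rightarrow> ((complex^'n) \<times> (complex^'n) \<Rightarrow> complex) \<Rightarrow> real
     \<Rightarrow> real^'n \<Rightarrow> real^'n \<Rightarrow> (complex^'n) \<times> (complex^'n) \<Rightarrow> complex" where
  "Fs_integrand lam t F s a b = (\<lambda>(z,w).
      F (z + cvec a, w + cvec b)
      * exp (\<i> * complex_of_real (lam/2) * (cdot (cvec a) w - cdot (cvec b) z))
      * cnj (ptw lam (t+s) z w) * complex_of_real (Wtw lam t (z,w)))"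

definition Fs :: "real \<Rightarrow> real \<Rightarrow> ((complex^'n) \<times> (complex^'n) \<Rightarrow> complex) \<Rightarrow> real
     \<Rightarrow> (real^'n) \<times> (real^'n) \<Rightarrow> complex" where
  "Fs lam t F s = (\<lambda>(a,b). integral\<^sup>L lborel (Fs_integrand lam t F s a b))"

end

theory Submission
  imports Defs "HOL-Probability.Probability" "HOL-Complex_Analysis.Complex_Analysis"
begin

text \<open>
  Write \<open>hk r p x\<close> for the kernel of the transform \<open>H\<^sub>r\<close>. The Gaussian integral over the real points shows
  that \<open>x \<mapsto> hk r p x\<close> and \<open>x \<mapsto> hk r p' x\<close> have inner product \<open>K p p'\<close>, the continuation of \<open>hk (2r) p\<close>
  to the conjugate of \<open>p'\<close>. For \<open>r = t\<close> this is the reproducing kernel of the space \<open>B\<close>, because around each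
  point it turns the weight \<open>W\<close> into a holomorphic factor times a Gaussian that is invariant under
  unimodular scalars. Hence every \<open>F\<close> in \<open>B\<close> should be \<open>H\<^sub>t\<close> applied to the adjoint integral
  \<open>x \<mapsto> \<integral> F(p) cnj (hk t p x) W(p) dp\<close>, and a shift of variables identifies \<open>F\<^sub>s\<close> with the same integral
  for \<open>t + s\<close>. These integrals are controlled in \<open>L\<^sup>2\<close> uniformly in small \<open>s\<close> by Schur's test, since
  \<open>|K p p'|\<close> times the square roots of the weights is at most a Gaussian in \<open>p - p'\<close>. So \<open>F\<close> may be cut
  off to large balls, where everything converges absolutely and dominatedly.
\<close>

section \<open>Gaussian integrals and invariance of Lebesgue measure\<close>

text \<open>The limit \<open>s \<rightarrow> 0\<close> is forced. At \<open>r = t\<close> the kernel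
  is the transform of a point mass at \<open>x\<close>, and its squared modulus times
  \<open>W\<close> fails to decay in some directions: the exponent is a quadratic form in
  \<open>p - x\<close> whose discriminant is (c C - lam^2)(C - c)/C, where C and c are the values of
  \<open>cf lam\<close> at \<open>t\<close> and \<open>r\<close>. It vanishes for
  \<open>r = t\<close> and is positive for \<open>r > t\<close>. So the adjoint integral at
  \<open>r = t\<close> is used only on cut-off functions, and the preimage of \<open>F\<close> is an
  L^2 limit of such integrals rather than an integral itself. The form behind Schur's test belongs
  to time \<open>2 * r\<close>; it stays definite at \<open>r = t\<close> because \<open>cf\<close>
  exceeds |lam|. The resulting bound is uniform for \<open>r\<close> in an interval starting at
  \<open>t\<close>, which is what allows a cut-off radius to be chosen before \<open>s\<close> is
  made small.\<close>

lemma gaussian_integral_real: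
  fixes A :: real and b :: complex
  assumes A: "A > 0"
  shows "has_bochner_integral lborel (\<lambda>x::real. exp (- of_real (A * x\<^sup>2) + of_real x * b))
           (complex_of_real (sqrt (pi / A)) * exp (b\<^sup>2 / of_real (4 * A)))"
proof -
  \<comment> \<open>The shift \<open>x0\<close> absorbs the real part of \<open>b\<close>, and the
    scale \<open>k\<close> turns the Gaussian into the standard normal density. Only the real
    frequency \<open>d\<close> remains, so the characteristic function of the normal law gives the
    value and no contour has to be moved.\<close>
  define k where "k = 1 / sqrt (2 * A)"
  define x0 where "x0 = Re b / (2 * A)"
  define d where "d = Im b * k"
  have k: "k > 0" "k\<^sup>2 = 1 / (2 * A)" using A by (auto simp: k_def power_divide)
  have normal: "has_bochner_integral lborel (\<lambda>x. std_normal_density x *\<^sub>R iexp (d * x))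
      (complex_of_real (exp (- d\<^sup>2 / 2)))"
  proof -
    have "char std_normal_distribution d = complex_of_real (exp (- d\<^sup>2 / 2))"
      by (simp add: char_std_normal_distribution)
    then have "integral\<^sup>L lborel (\<lambda>x. std_normal_density x *\<^sub>R iexp (d * x)) = complex_of_real (exp (- d\<^sup>2 / 2))"
      unfolding char_def
      using integral_density[of "iexp \<circ> (*) d" lborel std_normal_density]
      by (simp add: o_def)
    moreover have "integrable lborel (\<lambda>x. std_normal_density x *\<^sub>R iexp (d * x))"
      by (rule Bochner_Integration.integrable_bound[OF integrable_normal_density[of 1 0]]) (auto simp: norm_mult)
    ultimately show ?thesis by (simp add: has_bochner_integral_iff)
  qed
  define C where "C = complex_of_real (sqrt (2 * pi)) * exp (of_real (A * x0\<^sup>2) + \<i> * of_real (Im b * x0))"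
  have eq: "exp (- of_real (A * (x0 + k * x)\<^sup>2) + of_real (x0 + k * x) * b)
      = C * (std_normal_density x *\<^sub>R iexp (d * x))" for x
  proof -
    have bx: "b = of_real (2 * A * x0) + \<i> * of_real (Im b)"
      using A by (simp add: x0_def complex_eq_iff)
    have k2: "A * (k * k) = 1 / 2" using k A by (simp add: power2_eq_square)
    have "- (A * (x0 + k * x)\<^sup>2) + (x0 + k * x) * (2 * A * x0) = A * x0\<^sup>2 - (A * (k * k)) * x\<^sup>2"
      by (simp add: power2_eq_square algebra_simps)
    then have re: "- (A * (x0 + k * x)\<^sup>2) + (x0 + k * x) * (2 * A * x0) = A * x0\<^sup>2 - x\<^sup>2 / 2"
      unfolding k2 by simp
    have "- of_real (A * (x0 + k * x)\<^sup>2) + of_real (x0 + k * x) * b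
       = complex_of_real (- (A * (x0 + k * x)\<^sup>2) + (x0 + k * x) * (2 * A * x0)) + \<i> * of_real ((x0 + k * x) * Im b)"
      by (subst bx) (simp add: algebra_simps)
    also have "\<dots> = (of_real (A * x0\<^sup>2) + \<i> * of_real (Im b * x0)) + of_real (- x\<^sup>2 / 2) + \<i> * of_real (d * x)"
      unfolding re by (simp add: d_def algebra_simps)
    finally have 1: "- of_real (A * (x0 + k * x)\<^sup>2) + of_real (x0 + k * x) * b
       = (of_real (A * x0\<^sup>2) + \<i> * of_real (Im b * x0)) + of_real (- x\<^sup>2 / 2) + \<i> * of_real (d * x)" .
    have den: "exp (complex_of_real (- x\<^sup>2 / 2)) = of_real (sqrt (2 * pi)) * of_real (std_normal_density x)"
    proof -
      have "exp (- x\<^sup>2 / 2) = sqrt (2 * pi) * std_normal_density x" by (simp add: std_normal_density_def)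
      then show ?thesis by (simp only: exp_of_real of_real_mult)
    qed
    show ?thesis
      unfolding 1 exp_add den C_def by (simp add: scaleR_conv_of_real exp_add)
  qed
  have "has_bochner_integral lborel (\<lambda>x. exp (- of_real (A * (x0 + k * x)\<^sup>2) + of_real (x0 + k * x) * b))
     (C * complex_of_real (exp (- d\<^sup>2 / 2)))"
    unfolding eq by (rule has_bochner_integral_mult_right[OF normal])
  moreover have "C * complex_of_real (exp (- d\<^sup>2 / 2)) =
     (complex_of_real (sqrt (pi / A)) * exp (b\<^sup>2 / of_real (4 * A))) /\<^sub>R \<bar>k\<bar>"
  proof -
    have bx: "b\<^sup>2 / of_real (4 * A) = of_real (A * x0\<^sup>2) + \<i> * of_real (Im b * x0) + of_real (- d\<^sup>2 / 2)"
      using A k by (simp add: d_def power_mult_distrib x0_def complex_eq_iff Re_divide_of_real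
         Im_divide_of_real power2_eq_square field_simps)
    have "sqrt (pi / A) / k = sqrt (2 * pi)" using A by (simp add: k_def real_sqrt_divide real_sqrt_mult)
    then have "complex_of_real (sqrt (pi / A)) / of_real k = of_real (sqrt (2 * pi))"
      by (simp flip: of_real_divide)
    then show ?thesis unfolding bx exp_add C_def exp_of_real[symmetric] using k
      by (simp add: scaleR_conv_of_real field_simps)
  qed
  ultimately show ?thesis
    by (subst lborel_has_bochner_integral_real_affine_iff[of k _ _ x0]) (use k in auto)
qed

lemma has_bochner_integral_lborel_prod:
  fixes f :: "'a::euclidean_space \<Rightarrow> real \<Rightarrow> complex"
  assumes f: "\<And>b. b \<in> Basis \<Longrightarrow> has_bochner_integral lborel (f b) (I b)"
  shows "has_bochner_integral lborel (\<lambda>x. \<Prod>b\<in>Basis. f b (x \<bullet> b)) (\<Prod>b\<in>Basis. I b)"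
proof -
  interpret product_sigma_finite "\<lambda>_::'a. lborel :: real measure" by standard
  have fm[measurable]: "f b \<in> borel_measurable borel" if "b \<in> Basis" for b
    using borel_measurable_has_bochner_integral[OF f[OF that]] by simp
  have eq: "(\<Prod>b\<in>Basis. f b ((\<Sum>b'\<in>Basis. g b' *\<^sub>R b') \<bullet> b)) = (\<Prod>b\<in>Basis. f b (g b))" for g
    by (intro prod.cong refl) (simp add: inner_sum_left_Basis)
  have [measurable]: "(\<lambda>x. \<Prod>b\<in>Basis. f b (x \<bullet> b)) \<in> borel_measurable borel"
    by measurable
  have m2: "(\<lambda>f. \<Sum>b\<in>Basis. f b *\<^sub>R b) \<in> measurable (\<Pi>\<^sub>M b\<in>(Basis::'a set). lborel) borel"
    by measurable
  have "has_bochner_integral (\<Pi>\<^sub>M b\<in>(Basis::'a set). lborel) (\<lambda>g. \<Prod>b\<in>Basis. f b (g b)) (\<Prod>b\<in>Basis. I b)"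
    using f by (subst has_bochner_integral_iff) (auto simp: has_bochner_integral_iff product_integral_prod
        intro!: product_integrable_prod prod.cong)
  then show ?thesis
    by (subst lborel_eq) (simp add: has_bochner_integral_iff integrable_distr_eq[OF m2] integral_distr[OF m2] eq)
qed

text \<open>The complex linear term is split into real vectors \<open>p\<close> and
  \<open>q\<close>, so that the formula makes sense on every Euclidean space; the integrand factors
  over an orthonormal basis.\<close>

lemma gaussian_integral:
  fixes p q :: "'a::euclidean_space"
  assumes A: "A > 0"
  shows "has_bochner_integral lborel
      (\<lambda>x. exp (- of_real (A * (norm x)\<^sup>2) + of_real (x \<bullet> p) + \<i> * of_real (x \<bullet> q)))
      (complex_of_real (sqrt (pi / A)) ^ DIM('a)
        * exp ((of_real (p \<bullet> p - q \<bullet> q) + 2 * \<i> * of_real (p \<bullet> q)) / of_real (4 * A)))"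
proof -
  have "has_bochner_integral lborel
      (\<lambda>x::'a. \<Prod>b\<in>Basis. exp (- of_real (A * (x \<bullet> b)\<^sup>2) + of_real (x \<bullet> b) * (of_real (p \<bullet> b) + \<i> * of_real (q \<bullet> b))))
      (\<Prod>b\<in>(Basis::'a set). complex_of_real (sqrt (pi / A)) * exp ((of_real (p \<bullet> b) + \<i> * of_real (q \<bullet> b))\<^sup>2 / of_real (4 * A)))"
    by (rule has_bochner_integral_lborel_prod) (rule gaussian_integral_real[OF A])
  moreover have "(\<Prod>b\<in>Basis. exp (- of_real (A * (x \<bullet> b)\<^sup>2) + of_real (x \<bullet> b) * (of_real (p \<bullet> b) + \<i> * of_real (q \<bullet> b))))
      = exp (- complex_of_real (A * (norm x)\<^sup>2) + of_real (x \<bullet> p) + \<i> * of_real (x \<bullet> q))" for x :: 'a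
  proof -
    have "(\<Sum>b\<in>Basis. - complex_of_real (A * (x \<bullet> b)\<^sup>2) + of_real (x \<bullet> b) * (of_real (p \<bullet> b) + \<i> * of_real (q \<bullet> b)))
       = - complex_of_real (A * (\<Sum>b\<in>Basis. (x \<bullet> b) * (x \<bullet> b))) + of_real (\<Sum>b\<in>Basis. (x \<bullet> b) * (p \<bullet> b))
         + \<i> * of_real (\<Sum>b\<in>Basis. (x \<bullet> b) * (q \<bullet> b))"
      by (simp add: sum.distrib sum_subtractf sum_distrib_left sum_negf power2_eq_square algebra_simps)
    also have "\<dots> = - complex_of_real (A * (norm x)\<^sup>2) + of_real (x \<bullet> p) + \<i> * of_real (x \<bullet> q)"
      by (simp add: power2_norm_eq_inner flip: euclidean_inner)
    finally show ?thesis by (simp add: exp_sum[symmetric])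
  qed
  moreover have "(\<Prod>b\<in>(Basis::'a set). complex_of_real (sqrt (pi / A)) * exp ((of_real (p \<bullet> b) + \<i> * of_real (q \<bullet> b))\<^sup>2 / of_real (4 * A)))
      = complex_of_real (sqrt (pi / A)) ^ DIM('a)
        * exp ((of_real (p \<bullet> p - q \<bullet> q) + 2 * \<i> * of_real (p \<bullet> q)) / of_real (4 * A))"
  proof -
    have "(\<Sum>b\<in>Basis. (complex_of_real (p \<bullet> b) + \<i> * of_real (q \<bullet> b))\<^sup>2 / of_real (4 * A))
       = (of_real ((\<Sum>b\<in>Basis. (p \<bullet> b) * (p \<bullet> b)) - (\<Sum>b\<in>Basis. (q \<bullet> b) * (q \<bullet> b)))
           + 2 * \<i> * of_real (\<Sum>b\<in>Basis. (p \<bullet> b) * (q \<bullet> b))) / of_real (4 * A)"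
      unfolding of_real_diff of_real_sum sum_distrib_left sum_subtractf[symmetric] sum.distrib[symmetric] sum_divide_distrib
      by (intro sum.cong refl) (simp add: power2_eq_square algebra_simps)
    then show ?thesis
      by (simp add: prod.distrib exp_sum[symmetric] flip: euclidean_inner)
  qed
  ultimately show ?thesis by simp
qed

lemma gaussian_real_integral:
  fixes p :: "'a::euclidean_space"
  assumes A: "A > 0"
  shows "has_bochner_integral lborel (\<lambda>x. exp (- (A * (norm x)\<^sup>2) + x \<bullet> p))
      (sqrt (pi / A) ^ DIM('a) * exp ((p \<bullet> p) / (4 * A)))"
proof -
  have eq: "complex_of_real (exp (- (A * (norm x)\<^sup>2) + x \<bullet> p)) =
     exp (- of_real (A * (norm x)\<^sup>2) + of_real (x \<bullet> p) + \<i> * of_real (x \<bullet> 0))" for x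
    by (simp flip: exp_of_real)
  have eq2: "complex_of_real (sqrt (pi / A) ^ DIM('a) * exp ((p \<bullet> p) / (4 * A))) =
     complex_of_real (sqrt (pi / A)) ^ DIM('a)
        * exp ((of_real (p \<bullet> p - 0 \<bullet> (0::'a)) + 2 * \<i> * of_real (p \<bullet> 0)) / of_real (4 * A))"
    by (simp flip: exp_of_real)
  have "has_bochner_integral lborel (\<lambda>x. complex_of_real (exp (- (A * (norm x)\<^sup>2) + x \<bullet> p)))
     (complex_of_real (sqrt (pi / A) ^ DIM('a) * exp ((p \<bullet> p) / (4 * A))))"
    unfolding eq eq2 by (rule gaussian_integral[OF A])
  from has_bochner_integral_Re[OF this] show ?thesis by (simp only: Re_complex_of_real)
qed

lemma integrable_gaussian:
  assumes "A > 0"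
  shows "integrable lborel (\<lambda>x::'a::euclidean_space. exp (- (A * (norm x)\<^sup>2)))"
  using gaussian_real_integral[OF assms, of "0::'a"] by (simp add: has_bochner_integral_iff)

lemma gaussian_nn_integral_finite:
  assumes "A > 0"
  shows "(\<integral>\<^sup>+x. ennreal (exp (- (A * (norm x)\<^sup>2))) \<partial>(lborel :: 'a::euclidean_space measure)) < \<infinity>"
  using integrable_gaussian[OF assms, where 'a='a] by (simp add: integrable_iff_bounded)

section \<open>Invariance under translations, reflections and linear isometries\<close>

lemma nn_integral_lborel_translate:
  fixes f :: "'a::euclidean_space \<Rightarrow> ennreal"
  assumes [measurable]: "f \<in> borel_measurable borel"
  shows "(\<integral>\<^sup>+x. f (x + a) \<partial>lborel) = (\<integral>\<^sup>+x. f x \<partial>lborel)"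
proof -
  have "(\<integral>\<^sup>+x. f x \<partial>lborel) = (\<integral>\<^sup>+x. f x \<partial>distr lborel borel ((+) a))"
    by (simp add: lborel_distr_plus)
  also have "\<dots> = (\<integral>\<^sup>+x. f (x + a) \<partial>lborel)"
    by (subst nn_integral_distr) (auto simp: add.commute)
  finally show ?thesis by simp
qed

lemma nn_integral_lborel_reflect:
  fixes f :: "'a::euclidean_space \<Rightarrow> ennreal"
  assumes [measurable]: "f \<in> borel_measurable borel"
  shows "(\<integral>\<^sup>+x. f (a - x) \<partial>lborel) = (\<integral>\<^sup>+x. f x \<partial>lborel)"
proof -
  have "(\<integral>\<^sup>+x. f x \<partial>lborel) = (\<integral>\<^sup>+x. f x \<partial>density (distr lborel borel (\<lambda>x. a + (-1) *\<^sub>R x)) (\<lambda>_. ennreal (\<bar>-1\<bar>^DIM('a))))"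
    using lborel_affine[of "-1" a] by simp
  also have "\<dots> = (\<integral>\<^sup>+x. f (a - x) \<partial>lborel)"
    by (subst nn_integral_density) (auto simp: nn_integral_distr)
  finally show ?thesis by simp
qed

lemma integral_lborel_translate:
  fixes f :: "'a::euclidean_space \<Rightarrow> 'b::{banach,second_countable_topology}"
  assumes [measurable]: "f \<in> borel_measurable borel"
  shows "integral\<^sup>L lborel (\<lambda>x. f (x + a)) = integral\<^sup>L lborel f"
    and "integrable lborel (\<lambda>x. f (x + a)) \<longleftrightarrow> integrable lborel f"
proof -
  have "integral\<^sup>L lborel f = integral\<^sup>L (distr lborel borel ((+) a)) f"
    by (simp add: lborel_distr_plus)
  also have "\<dots> = integral\<^sup>L lborel (\<lambda>x. f (x + a))"
    by (subst integral_distr) (auto simp: add.commute)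
  finally show "integral\<^sup>L lborel (\<lambda>x. f (x + a)) = integral\<^sup>L lborel f" by simp
  have "integrable lborel f \<longleftrightarrow> integrable (distr lborel borel ((+) a)) f"
    by (simp add: lborel_distr_plus)
  also have "\<dots> \<longleftrightarrow> integrable lborel (\<lambda>x. f (x + a))"
    by (subst integrable_distr_eq) (auto simp: add.commute)
  finally show "integrable lborel (\<lambda>x. f (x + a)) \<longleftrightarrow> integrable lborel f" by simp
qed

text \<open>Uniqueness of Haar measure: pairing with the rotation invariant Gaussian identifies the
  normalising constant of the image measure.\<close>

lemma distr_lborel_isometry:
  fixes T :: "'a::euclidean_space \<Rightarrow> 'a"
  assumes lin: "linear T" and iso: "\<And>x. norm (T x) = norm x"
  shows "distr lborel borel T = lborel"
proof -
  have [measurable]: "T \<in> borel_measurable borel"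
    using lin by (intro borel_measurable_continuous_onI linear_continuous_on linear_conv_bounded_linear[THEN iffD1])
  have "inj T"
    using lin iso by (metis linear_injective_0 norm_eq_zero)
  then have "surj T" using lin linear_injective_imp_surjective by blast
  then obtain S where S: "\<And>y. T (S y) = y" by (metis surj_def)
  define \<phi> :: "'a \<Rightarrow> ennreal" where "\<phi> = (\<lambda>x. ennreal (exp (- (1 * (norm x)\<^sup>2))))"
  have [measurable]: "\<phi> \<in> borel_measurable borel" unfolding \<phi>_def by measurable
  have \<phi>T: "\<phi> (T x) = \<phi> x" for x by (simp add: \<phi>_def iso)
  define C where "C = (\<integral>\<^sup>+x. \<phi> x \<partial>lborel)"
  have Cfin: "C < \<infinity>"
    unfolding C_def \<phi>_def by (rule gaussian_nn_integral_finite) simp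
  have Cpos: "C \<noteq> 0"
  proof
    assume "C = 0"
    then have "AE x in (lborel::'a measure). \<phi> x = 0"
      unfolding C_def by (subst (asm) nn_integral_0_iff_AE) auto
    then have "AE x in (lborel::'a measure). False"
      by eventually_elim (auto simp: \<phi>_def)
    then show False
      by (simp add: AE_iff_measurable[OF _ refl])
  qed
  have key: "(\<integral>\<^sup>+x. f (T x) \<partial>lborel) = (\<integral>\<^sup>+x. f x \<partial>lborel)"
    if [measurable]: "f \<in> borel_measurable borel" for f :: "'a \<Rightarrow> ennreal"
  proof -
    \<comment> \<open>The same double integral is evaluated in both orders. In one order
      \<open>\<phi>\<close> integrates to \<open>C\<close> by translation; in the other
      \<open>f\<close> integrates by reflection and the factor
      \<open>\<phi> (T x) = \<phi> x\<close> leaves \<open>C\<close>.\<close>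
    have "(\<integral>\<^sup>+x. f (T x) \<partial>lborel) * C = (\<integral>\<^sup>+x. (\<integral>\<^sup>+y. f (T x) * \<phi> (y + T x) \<partial>lborel) \<partial>lborel)"
      by (simp add: nn_integral_cmult nn_integral_lborel_translate C_def nn_integral_multc)
    also have "\<dots> = (\<integral>\<^sup>+y. (\<integral>\<^sup>+x. f (T x) * \<phi> (y + T x) \<partial>lborel) \<partial>lborel)"
      by (rule lborel_pair.Fubini') measurable
    also have "\<dots> = (\<integral>\<^sup>+y. (\<integral>\<^sup>+x. f (T x - y) * \<phi> (T x) \<partial>lborel) \<partial>lborel)"
    proof (rule nn_integral_cong)
      fix y :: 'a
      \<comment> \<open>Surjectivity enters here: \<open>y = T (S y)\<close>, so a shift of the
        argument of \<open>f\<close> by \<open>y\<close> is a shift of \<open>x\<close> by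
        \<open>S y\<close>.\<close>
      have "(\<integral>\<^sup>+x. f (T x - y) * \<phi> (T x) \<partial>lborel) = (\<integral>\<^sup>+x. f (T (x + S y) - y) * \<phi> (T (x + S y)) \<partial>lborel)"
        by (rule nn_integral_lborel_translate[symmetric]) measurable
      then show "(\<integral>\<^sup>+x. f (T x) * \<phi> (y + T x) \<partial>lborel) = (\<integral>\<^sup>+x. f (T x - y) * \<phi> (T x) \<partial>lborel)"
        by (simp add: linear_add[OF lin] S add.commute)
    qed
    also have "\<dots> = (\<integral>\<^sup>+x. (\<integral>\<^sup>+y. f (T x - y) * \<phi> (T x) \<partial>lborel) \<partial>lborel)"
      by (rule lborel_pair.Fubini') measurable
    also have "\<dots> = (\<integral>\<^sup>+x. f x \<partial>lborel) * C"
      by (simp add: nn_integral_multc nn_integral_cmult nn_integral_lborel_reflect C_def \<phi>T)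
    finally show ?thesis
      using Cfin Cpos by (auto simp: mult.commute[of _ C] ennreal_mult_cancel_left)
  qed
  show ?thesis
  proof (rule measure_eqI)
    fix A assume "A \<in> sets (distr lborel borel T)"
    then have [measurable]: "A \<in> sets borel" by simp
    have "emeasure (distr lborel borel T) A = (\<integral>\<^sup>+x. indicator A x \<partial>distr lborel borel T)" by simp
    also have "\<dots> = (\<integral>\<^sup>+x. indicator A (T x) \<partial>lborel)" by (subst nn_integral_distr) auto
    also have "\<dots> = emeasure lborel A" by (subst key) auto
    finally show "emeasure (distr lborel borel T) A = emeasure lborel A" .
  qed simp
qed

text \<open>Cauchy's formula on the unit circle, where dz/z is 2 pi i times the angle element. It is
  phrased as a Bochner integral with an indicator so that it can be an inner integral in Fubini's
  theorem.\<close>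

lemma holomorphic_circle_mean:
  assumes "g holomorphic_on UNIV"
  shows "has_bochner_integral lborel (\<lambda>\<theta>::real. indicator {0..1} \<theta> *\<^sub>R g (exp (2 * of_real pi * \<i> * of_real \<theta>))) (g 0)"
proof -
  have cont: "continuous_on UNIV g" using assms by (rule holomorphic_on_imp_continuous_on)
  have "((\<lambda>u. g u / (u - 0)) has_contour_integral (2 * of_real pi * \<i> * g 0)) (circlepath 0 1)"
    by (rule Cauchy_integral_circlepath)
       (use assms in \<open>auto intro: continuous_on_subset[OF cont] holomorphic_on_subset\<close>)
  then have "((\<lambda>x. g (circlepath 0 1 x) / circlepath 0 1 x * vector_derivative (circlepath 0 1) (at x within {0..1}))
     has_integral 2 * of_real pi * \<i> * g 0) {0..1}"
    by (simp add: has_contour_integral_def)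
  then have "((\<lambda>x::real. 2 * of_real pi * \<i> * g (exp (2 * of_real pi * \<i> * of_real x))) has_integral 2 * of_real pi * \<i> * g 0) {0..1}"
    by (rule has_integral_eq[rotated]) (auto simp: vector_derivative_circlepath01, auto simp: circlepath)
  then have "((\<lambda>x::real. (1 / (2 * of_real pi * \<i>)) * (2 * of_real pi * \<i> * g (exp (2 * of_real pi * \<i> * of_real x))))
      has_integral (1 / (2 * of_real pi * \<i>)) * (2 * of_real pi * \<i> * g 0)) {0..1}"
    by (rule has_integral_mult_right)
  then have hi: "((\<lambda>x::real. g (exp (2 * of_real pi * \<i> * of_real x))) has_integral g 0) {0..1}"
    by simp
  have "set_integrable lborel {0..1} (\<lambda>x::real. g (exp (2 * of_real pi * \<i> * of_real x)))"
    by (rule borel_integrable_compact[unfolded set_integrable_def[symmetric]])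
       (auto intro!: continuous_intros continuous_on_compose2[OF cont])
  moreover from set_borel_integral_eq_integral(2)[OF this] hi
  have "(LINT x:{0..1}|lborel. g (exp (2 * of_real pi * \<i> * of_real x))) = g 0"
    by (simp add: integral_unique)
  ultimately show ?thesis
    by (simp add: has_bochner_integral_iff set_integrable_def set_lebesgue_integral_def)
qed

section \<open>Bilinear and symplectic forms\<close>

type_synonym 'n rpt = "(real^'n) \<times> (real^'n)"
type_synonym 'n cpt = "(complex^'n) \<times> (complex^'n)"

text \<open>Bilinear without conjugation, so that kernels built from it are holomorphic; conjugates
  are tracked separately by \<open>cconj\<close>.\<close>

definition bdot :: "'n::finite cpt \<Rightarrow> 'n cpt \<Rightarrow> complex" where
  "bdot p q = cdot (fst p) (fst q) + cdot (snd p) (snd q)"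

definition emb :: "'n::finite rpt \<Rightarrow> 'n cpt" where
  "emb x = (cvec (fst x), cvec (snd x))"

definition RE :: "'n::finite cpt \<Rightarrow> 'n rpt" where
  "RE p = (Revec (fst p), Revec (snd p))"

definition IM :: "'n::finite cpt \<Rightarrow> 'n rpt" where
  "IM p = (Imvec (fst p), Imvec (snd p))"

definition cconj :: "'n::finite cpt \<Rightarrow> 'n cpt" where
  "cconj p = ((\<chi> j. cnj (fst p $ j)), (\<chi> j. cnj (snd p $ j)))"

text \<open>With it the twist of the transform, a.w - b.z, is
  \<open>bdot (emb (a, b)) (sympl (z, w))\<close>. The type is polymorphic because the map acts on
  real and on complex pairs.\<close>

definition sympl :: "'a::ab_group_add \<times> 'a \<Rightarrow> 'a \<times> 'a" where
  "sympl p = (snd p, - fst p)"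

lemma bdot_commute: "bdot p q = bdot q p"
  by (simp add: bdot_def cdot_def mult.commute)

lemma bdot_add_left: "bdot (p + p') q = bdot p q + bdot p' q"
  and bdot_diff_left: "bdot (p - p') q = bdot p q - bdot p' q"
  and bdot_cscale_left: "bdot (cscale c p) q = c * bdot p q"
  by (simp_all add: bdot_def cdot_def cscale_def algebra_simps sum.distrib sum_subtractf sum_distrib_left)

lemma bdot_add_right: "bdot q (p + p') = bdot q p + bdot q p'"
  and bdot_diff_right: "bdot q (p - p') = bdot q p - bdot q p'"
  and bdot_cscale_right: "bdot q (cscale c p) = c * bdot q p"
  using bdot_add_left[of p p' q] bdot_diff_left[of p p' q] bdot_cscale_left[of c p q]
  by (simp_all add: bdot_commute)

lemmas bdot_bilinear = bdot_add_left bdot_diff_left bdot_cscale_left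
  bdot_add_right bdot_diff_right bdot_cscale_right

lemma sympl_add: "sympl (p + q) = sympl p + sympl q"
  and sympl_diff: "sympl (p - q) = sympl p - sympl q"
  by (simp_all add: sympl_def)

lemma bdot_sympl: "bdot (sympl p) q = - bdot p (sympl q)"
  by (simp add: bdot_def sympl_def cdot_def sum_negf)

lemma bdot_sympl_sympl: "bdot (sympl p) (sympl q) = bdot p q"
  by (simp add: bdot_def sympl_def cdot_def sum_negf)

lemma bdot_sympl_self: "bdot p (sympl p) = 0"
  using bdot_sympl[of p p] by (simp add: bdot_commute)

lemma bdot_sympl_swap: "bdot p (sympl q) = - bdot q (sympl p)"
  using bdot_sympl[of p q] by (simp add: bdot_commute)

lemma inner_sympl_self: "p \<bullet> sympl p = 0" for p :: "'a::real_inner \<times> 'a"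
  by (cases p) (simp add: sympl_def inner_commute)

lemma inner_sympl_swap: "p \<bullet> sympl q = - (q \<bullet> sympl p)" for p q :: "'a::real_inner \<times> 'a"
  by (cases p; cases q) (simp add: sympl_def inner_commute)

lemma norm_sympl: "norm (sympl p) = norm p" for p :: "'a::real_normed_vector \<times> 'a"
  by (cases p) (simp add: sympl_def norm_Pair add.commute)

lemma cconj_simps [simp]: "cconj (emb x) = emb x" "cconj (sympl p) = sympl (cconj p)" "cconj (cconj p) = p"
    "cconj (p - q) = cconj p - cconj q"
  by (simp_all add: cconj_def emb_def sympl_def vec_eq_iff cvec_def prod_eq_iff)

lemma cnj_bdot: "cnj (bdot p q) = bdot (cconj p) (cconj q)"
  by (simp add: bdot_def cdot_def cconj_def)

lemma RE_IM_simps [simp]: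
  "RE (emb x) = x" "IM (emb x) = 0" "RE (cconj p) = RE p" "IM (cconj p) = - IM p"
  "RE (sympl p) = sympl (RE p)" "IM (sympl p) = sympl (IM p)"
  "RE (p + q) = RE p + RE q" "IM (p + q) = IM p + IM q"
  "RE (p - q) = RE p - RE q" "IM (p - q) = IM p - IM q"
  "RE 0 = 0" "IM 0 = 0"
  by (simp_all add: RE_def IM_def emb_def cconj_def sympl_def Revec_def Imvec_def cvec_def
      vec_eq_iff prod_eq_iff)

lemma Re_bdot: "Re (bdot p q) = RE p \<bullet> RE q - IM p \<bullet> IM q"
  and Im_bdot: "Im (bdot p q) = RE p \<bullet> IM q + IM p \<bullet> RE q"
  by (simp_all add: bdot_def cdot_def RE_def IM_def Revec_def Imvec_def inner_vec_def
      inner_prod_def sum_subtractf sum.distrib algebra_simps)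

lemma norm_cpt: "(norm p)\<^sup>2 = (norm (RE p))\<^sup>2 + (norm (IM p))\<^sup>2" for p :: "'n::finite cpt"
  unfolding power2_norm_eq_inner
  by (simp add: RE_def IM_def Revec_def Imvec_def inner_prod_def inner_vec_def inner_complex_def sum.distrib)

lemma bdot_emb: "bdot (emb x) (emb x) = of_real ((norm x)\<^sup>2)"
  by (simp add: complex_eq_iff Re_bdot Im_bdot power2_norm_eq_inner)

lemma continuous_on_cvec [continuous_intros]:
  "continuous_on S f \<Longrightarrow> continuous_on S (\<lambda>x. cvec (f x))"
  unfolding cvec_def by (intro continuous_intros)

lemma continuous_on_emb [continuous_intros]:
  "continuous_on S f \<Longrightarrow> continuous_on S (\<lambda>x. emb (f x))"
  unfolding emb_def by (intro continuous_intros)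

lemma continuous_on_sympl [continuous_intros]:
  "continuous_on S f \<Longrightarrow> continuous_on S (\<lambda>x. sympl (f x :: 'a::real_normed_vector \<times> 'a))"
  unfolding sympl_def by (intro continuous_intros)

lemma continuous_on_RE [continuous_intros]:
  "continuous_on S f \<Longrightarrow> continuous_on S (\<lambda>x. RE (f x))"
  unfolding RE_def Revec_def by (intro continuous_intros)

lemma continuous_on_IM [continuous_intros]:
  "continuous_on S f \<Longrightarrow> continuous_on S (\<lambda>x. IM (f x))"
  unfolding IM_def Imvec_def by (intro continuous_intros)

lemma continuous_on_cconj [continuous_intros]:
  "continuous_on S f \<Longrightarrow> continuous_on S (\<lambda>x. cconj (f x))"
  unfolding cconj_def by (intro continuous_intros)

lemma continuous_on_bdot [continuous_intros]:
  "continuous_on S f \<Longrightarrow> continuous_on S g \<Longrightarrow> continuous_on S (\<lambda>x. bdot (f x) (g x))"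
  unfolding bdot_def cdot_def by (intro continuous_intros)

text \<open>The real dimension \<open>2n\<close> is even, which removes the square root from the
  normalising factor.\<close>

lemma gaussian_integral_rpt:
  fixes b :: "'n::finite cpt"
  assumes A: "A > 0"
  shows "has_bochner_integral lborel (\<lambda>x. exp (- of_real (A * (norm x)\<^sup>2) + bdot (emb x) b))
      (complex_of_real (pi / A) ^ CARD('n) * exp (bdot b b / of_real (4 * A)))"
proof -
  have "of_real (x \<bullet> RE b) + \<i> * of_real (x \<bullet> IM b) = bdot (emb x) b" for x
    by (simp add: complex_eq_iff Re_bdot Im_bdot)
  moreover have "of_real (RE b \<bullet> RE b - IM b \<bullet> IM b) + 2 * \<i> * of_real (RE b \<bullet> IM b) = bdot b b"
    by (simp add: complex_eq_iff Re_bdot Im_bdot inner_commute)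
  moreover have "complex_of_real (sqrt (pi / A)) ^ DIM('n rpt) = complex_of_real (pi / A) ^ CARD('n)"
  proof -
    have "sqrt (pi / A) ^ DIM('n rpt) = (sqrt (pi / A) ^ 2) ^ CARD('n)"
      by (simp add: mult_2 flip: power_mult)
    then show ?thesis using A by (metis of_real_power real_sqrt_pow2 divide_nonneg_pos pi_ge_zero)
  qed
  ultimately show ?thesis
    using gaussian_integral[OF A, of "RE b" "IM b"] by (simp only: add.assoc)
qed

section \<open>The kernel of the heat transform\<close>

definition cf :: "real \<Rightarrow> real \<Rightarrow> real" where
  "cf lam r = lam * coth (r * lam)"

definition sf :: "real \<Rightarrow> real \<Rightarrow> real" where
  "sf lam r = lam / sinh (r * lam)"

text \<open>The dimension occurs only in the type, hence the \<open>itself\<close> argument.\<close>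

definition nf :: "'n::finite itself \<Rightarrow> real \<Rightarrow> real \<Rightarrow> real" where
  "nf _ lam r = (sf lam r / (4 * pi)) ^ CARD('n)"

lemma sf_pos: "r > 0 \<Longrightarrow> lam \<noteq> 0 \<Longrightarrow> sf lam r > 0"
  unfolding sf_def by (cases "lam > 0") (auto simp: zero_less_divide_iff mult_pos_neg)

lemma nf_pos: "r > 0 \<Longrightarrow> lam \<noteq> 0 \<Longrightarrow> nf TYPE('n::finite) lam r > 0"
  unfolding nf_def by (simp add: sf_pos)

lemma cf_eq: "cf lam r = cosh (r * lam) * sf lam r"
  by (simp add: cf_def sf_def coth_def)

text \<open>This is coth^2 = 1 + 1/sinh^2 scaled by \<open>lam\<close>. Through it,
  \<open>cf\<close> inherits from \<open>sf\<close> the lower bound |lam| and its monotonicity in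
  time.\<close>

lemma cf_square: "r > 0 \<Longrightarrow> lam \<noteq> 0 \<Longrightarrow> (cf lam r)\<^sup>2 = (sf lam r)\<^sup>2 + lam\<^sup>2"
proof -
  assume "r > 0" "lam \<noteq> 0"
  then have s: "sinh (r * lam) \<noteq> 0" by simp
  have "(cf lam r)\<^sup>2 = (1 + (sinh (r * lam))\<^sup>2) * (sf lam r)\<^sup>2"
    unfolding cf_eq power_mult_distrib by (simp add: cosh_square_eq)
  then show ?thesis using s by (simp add: sf_def field_simps power2_eq_square)
qed

lemma cf_gt: assumes "r > 0" "lam \<noteq> 0" shows "cf lam r > \<bar>lam\<bar>"
proof -
  have c: "cf lam r > 0" unfolding cf_eq using sf_pos[OF assms] by simp
  have "\<bar>lam\<bar>\<^sup>2 < (cf lam r)\<^sup>2" using cf_square[OF assms] sf_pos[OF assms] by simp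
  then show ?thesis using c by (simp add: power2_less_imp_less)
qed

lemma cf_pos: assumes "r > 0" "lam \<noteq> 0" shows "cf lam r > 0"
  using cf_gt[OF assms] by linarith

text \<open>\<open>sf\<close> is even in \<open>lam\<close>, which reduces both signs to the
  monotonicity of sinh.\<close>

lemma sf_strict_antimono: assumes "0 < r" "r < q" "lam \<noteq> 0" shows "sf lam q < sf lam r"
proof -
  have e: "sf lam r = \<bar>lam\<bar> / sinh (r * \<bar>lam\<bar>)" for r
    by (cases "lam > 0") (auto simp: sf_def)
  have "sinh (r * \<bar>lam\<bar>) < sinh (q * \<bar>lam\<bar>)" using assms by simp
  moreover have "0 < sinh (r * \<bar>lam\<bar>)" using assms by simp
  ultimately show ?thesis unfolding e using assms by (intro divide_strict_left_mono) auto
qed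

lemma cf_strict_antimono: assumes "0 < r" "r < q" "lam \<noteq> 0" shows "cf lam q < cf lam r"
proof -
  have "(sf lam q)\<^sup>2 < (sf lam r)\<^sup>2"
    using sf_strict_antimono[OF assms] sf_pos[of q lam] assms by (intro power_strict_mono) auto
  then have "(cf lam q)\<^sup>2 < (cf lam r)\<^sup>2" using cf_square[of q lam] cf_square[of r lam] assms by simp
  then show ?thesis using cf_pos[of r lam] assms by (simp add: power2_less_imp_less)
qed

lemma sf_antimono: assumes "0 < r" "r \<le> q" "lam \<noteq> 0" shows "sf lam q \<le> sf lam r"
  using sf_strict_antimono[of r q lam] assms by (cases "r = q") auto

lemma cf_antimono: assumes "0 < r" "r \<le> q" "lam \<noteq> 0" shows "cf lam q \<le> cf lam r"
  using cf_strict_antimono[of r q lam] assms by (cases "r = q") auto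

lemma nf_antimono: assumes "0 < r" "r \<le> q" "lam \<noteq> 0" shows "nf TYPE('n::finite) lam q \<le> nf TYPE('n) lam r"
  unfolding nf_def using sf_antimono[OF assms] sf_pos[of q lam] assms
  by (intro power_mono divide_right_mono) auto

lemma sf_double: assumes "r > 0" "lam \<noteq> 0" shows "sf lam (2 * r) = (sf lam r)\<^sup>2 / (2 * cf lam r)"
proof -
  have "sinh (r * lam) \<noteq> 0" "cosh (r * lam) \<noteq> 0" using assms by auto
  moreover have "sinh (2 * r * lam) = 2 * sinh (r * lam) * cosh (r * lam)"
    using sinh_double[of "r * lam"] by (simp add: mult.assoc)
  ultimately show ?thesis using assms by (simp add: cf_def coth_def sf_def field_simps power2_eq_square)
qed

text \<open>In this rational form \<open>cf lam (2 * r)\<close> comes out of the Gaussian integral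
  in \<open>hk_semigroup\<close>, and it makes the discriminant in \<open>hk_sq_weight_bound\<close>
  factor.\<close>

lemma cf_double: assumes "r > 0" "lam \<noteq> 0"
  shows "cf lam (2 * r) = ((cf lam r)\<^sup>2 + lam\<^sup>2) / (2 * cf lam r)"
proof -
  have "sinh (r * lam) \<noteq> 0" "cosh (r * lam) \<noteq> 0" using assms by auto
  moreover have "sinh (2 * r * lam) = 2 * sinh (r * lam) * cosh (r * lam)"
    using sinh_double[of "r * lam"] by (simp add: mult.assoc)
  moreover have "cosh (2 * r * lam) = (cosh (r * lam))\<^sup>2 + (sinh (r * lam))\<^sup>2"
    using cosh_double[of "r * lam"] by (simp add: mult.assoc)
  ultimately show ?thesis using assms by (simp add: cf_def coth_def field_simps power2_eq_square)
qed

lemma continuous_on_sf [continuous_intros]: "lam \<noteq> 0 \<Longrightarrow> continuous_on {0<..} (sf lam)"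
  unfolding sf_def by (intro continuous_intros) auto

lemma continuous_on_cf [continuous_intros]: "lam \<noteq> 0 \<Longrightarrow> continuous_on {0<..} (cf lam)"
  unfolding cf_eq by (intro continuous_intros) auto

lemma continuous_on_nf [continuous_intros]: "lam \<noteq> 0 \<Longrightarrow> continuous_on {0<..} (nf TYPE('n::finite) lam)"
  unfolding nf_def by (intro continuous_intros) auto

text \<open>The kernel of the heat transform, for \<open>q\<close> continued analytically off the real points.\<close>

definition hk :: "real \<Rightarrow> real \<Rightarrow> 'n::finite cpt \<Rightarrow> 'n cpt \<Rightarrow> complex" where
  "hk lam r p q = of_real (nf TYPE('n) lam r) *
     exp (- of_real (cf lam r / 4) * bdot (p - q) (p - q) - \<i> * of_real (lam / 2) * bdot q (sympl p))"

lemma nf_powi: "(4*pi) powi (- int CARD('n::finite)) * (lam / sinh (r*lam)) ^ CARD('n) = nf TYPE('n) lam r"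
  by (simp add: nf_def sf_def power_int_minus power_divide field_simps)

lemma ptw_eq:
  fixes p :: "'n::finite cpt"
  shows "ptw lam r (fst p) (snd p) =
    of_real (nf TYPE('n) lam r) * exp (- of_real (cf lam r / 4) * bdot p p)"
  unfolding ptw_def nf_powi bdot_def cf_def by (simp add: algebra_simps)

lemma hk_ptw: "hk lam r p q = ptw lam r (fst (p - q)) (snd (p - q)) * exp (- \<i> * of_real (lam / 2) * bdot q (sympl p))"
  unfolding hk_def ptw_eq mult.assoc[of "of_real _" "exp _"] exp_add[symmetric] by simp

lemma Htw_hk: "Htw lam t f p = integral\<^sup>L lborel (\<lambda>x. f x * hk lam t p (emb x))"
  by (cases p) (simp add: Htw_def hk_ptw bdot_def sympl_def emb_def case_prod_unfold cdot_def sum_negf mult.assoc)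

lemma cmod_hk:
  fixes p q :: "'n::finite cpt"
  assumes that: "r > 0" "lam \<noteq> 0"
  shows "cmod (hk lam r p q) = nf TYPE('n) lam r *
     exp (- (cf lam r / 4) * ((norm (RE p - RE q))\<^sup>2 - (norm (IM p - IM q))\<^sup>2)
       + lam / 2 * (RE q \<bullet> sympl (IM p) + IM q \<bullet> sympl (RE p)))"
  unfolding hk_def norm_mult norm_exp_eq_Re using nf_pos[OF that, where 'n='n]
  by (simp add: Re_bdot Im_bdot power2_norm_eq_inner)

lemma Wtw_eq:
  fixes p :: "'n::finite cpt"
  shows "Wtw lam t p = 4 ^ CARD('n) * nf TYPE('n) lam (2 * t) *
    exp (- lam * (RE p \<bullet> sympl (IM p)) - cf lam (2 * t) * (norm (IM p))\<^sup>2)"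
proof -
  have "bdot (emb (2 *\<^sub>R IM p)) (emb (2 *\<^sub>R IM p)) = of_real (4 * (norm (IM p))\<^sup>2)"
    unfolding bdot_emb by (simp add: power_mult_distrib)
  then have "Re (ptw lam (2*t) (cvec (2 *\<^sub>R Imvec (fst p))) (cvec (2 *\<^sub>R Imvec (snd p)))) =
      Re (of_real (nf TYPE('n) lam (2 * t)) * exp (of_real (- cf lam (2 * t) * (norm (IM p))\<^sup>2)))"
    using ptw_eq[of lam "2 * t" "emb (2 *\<^sub>R IM p)"] by (simp add: emb_def IM_def)
  also have "\<dots> = nf TYPE('n) lam (2 * t) * exp (- cf lam (2 * t) * (norm (IM p))\<^sup>2)"
    unfolding exp_of_real by (simp del: of_real_mult flip: of_real_mult)
  finally have 1: "Wtw lam t p = 4 ^ CARD('n) *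
      exp (lam * (rdot (Revec (snd p)) (Imvec (fst p)) - rdot (Imvec (snd p)) (Revec (fst p)))) *
      (nf TYPE('n) lam (2 * t) * exp (- cf lam (2 * t) * (norm (IM p))\<^sup>2))"
    unfolding Wtw_def by (simp add: case_prod_unfold)
  have 2: "rdot (Revec (snd p)) (Imvec (fst p)) - rdot (Imvec (snd p)) (Revec (fst p)) = - (RE p \<bullet> sympl (IM p))"
    by (simp add: RE_def IM_def sympl_def inner_vec_def inner_prod_def rdot_def sum_negf mult.commute)
  show ?thesis unfolding 1 2 by (simp add: exp_diff exp_minus field_simps)
qed

lemma Wtw_pos: "t > 0 \<Longrightarrow> lam \<noteq> 0 \<Longrightarrow> Wtw lam t p > 0"
  unfolding Wtw_eq by (simp add: nf_pos)

lemma continuous_on_Wtw [continuous_intros]: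
  "continuous_on S f \<Longrightarrow> continuous_on S (\<lambda>x. Wtw lam t (f x))"
  unfolding Wtw_eq by (intro continuous_intros)

lemma continuous_on_hk [continuous_intros]:
  "continuous_on S f \<Longrightarrow> continuous_on S g \<Longrightarrow> continuous_on S (\<lambda>x. hk lam r (f x) (g x))"
  unfolding hk_def by (intro continuous_intros)

lemma measurable_Wtw [measurable]: "Wtw lam t \<in> borel_measurable borel"
  by (intro borel_measurable_continuous_onI continuous_intros)

lemma measurable_hk [measurable]:
  "f \<in> borel_measurable M \<Longrightarrow> g \<in> borel_measurable M \<Longrightarrow> (\<lambda>x. hk lam r (f x) (g x)) \<in> borel_measurable M"
proof -
  have "(\<lambda>x. hk lam r (fst x) (snd x)) \<in> borel_measurable borel"
    by (intro borel_measurable_continuous_onI continuous_intros)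
  moreover assume [measurable]: "f \<in> borel_measurable M" "g \<in> borel_measurable M"
  ultimately have "(\<lambda>x. hk lam r (fst (f x, g x)) (snd (f x, g x))) \<in> borel_measurable M"
    using measurable_compose[of "\<lambda>x. (f x, g x)" M borel "\<lambda>x. hk lam r (fst x) (snd x)"]
    by (simp add: borel_prod[symmetric])
  then show ?thesis by simp
qed

lemma measurable_emb [measurable]: "emb \<in> borel_measurable borel"
  by (intro borel_measurable_continuous_onI continuous_intros)

lemma measurable_cconj [measurable]: "cconj \<in> borel_measurable borel"
  by (intro borel_measurable_continuous_onI continuous_intros)

text \<open>A shift by the real point \<open>x = (a, b)\<close> multiplies the weight by exp(-lam
  x.J Im p), with J standing for \<open>sympl\<close>. That is the factor which turns the conjugated
  twist of \<open>hk\<close>, antiholomorphic in \<open>p\<close>, into the holomorphic phase of the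
  integrand: conj B + 2i Im B = B.\<close>

lemma Fs_integrand_eq:
  "Fs_integrand lam t F s a b p = F (p + emb (a, b)) * cnj (hk lam (t + s) (p + emb (a, b)) (emb (a, b)))
     * of_real (Wtw lam t (p + emb (a, b)))"
proof -
  let ?x = "(a, b)"
  have sp: "bdot (emb ?x) (sympl (p + emb ?x)) = bdot (emb ?x) (sympl p)"
    by (simp add: sympl_add bdot_bilinear bdot_sympl_self)
  have e1: "exp (\<i> * complex_of_real (lam/2) * (cdot (cvec a) (snd p) - cdot (cvec b) (fst p))) =
     exp (\<i> * of_real (lam / 2) * bdot (emb ?x) (sympl p))"
    by (simp add: bdot_def emb_def sympl_def cdot_def sum_negf)
  have W: "Wtw lam t (p + emb ?x) = Wtw lam t p * exp (- lam * (?x \<bullet> sympl (IM p)))"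
    unfolding Wtw_eq by (simp add: inner_add_left algebra_simps flip: exp_add)
  have "cnj (exp (- \<i> * of_real (lam / 2) * bdot (emb ?x) (sympl p))) * of_real (exp (- lam * (?x \<bullet> sympl (IM p))))
     = exp (\<i> * of_real (lam / 2) * bdot (emb ?x) (sympl p))"
    unfolding exp_cnj exp_of_real[symmetric] exp_add[symmetric]
    by (rule arg_cong[where f=exp]) (simp add: complex_eq_iff Re_bdot Im_bdot)
  then show ?thesis
    unfolding hk_ptw sp W Fs_integrand_def case_prod_unfold e1 prod.collapse
    by (simp add: emb_def plus_prod_def mult.assoc[symmetric])
qed

section \<open>Semigroup law and Gaussian bounds for the kernel\<close>

lemma hk_semigroup:
  fixes p p' :: "'n::finite cpt"
  assumes r: "r > 0" "lam \<noteq> 0"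
  shows "has_bochner_integral lborel (\<lambda>x. hk lam r p (emb x) * cnj (hk lam r p' (emb x)))
     (hk lam (2 * r) p (cconj p'))"
proof -
  define c where "c = cf lam r"
  have c: "c > 0" using cf_pos[OF r] by (simp add: c_def)
  define N where "N = nf TYPE('n) lam r"
  \<comment> \<open>Conjugating the second kernel replaces \<open>p'\<close> by
    \<open>cconj p'\<close> and reverses the sign of its twist. Hence the product is a single
    Gaussian in \<open>x\<close> with linear coefficient \<open>b\<close>: the quadratic parts
    contribute the sum of the two points, the twists their difference.\<close>
  define b where "b = cscale (of_real (c / 2)) (p + cconj p') - cscale (\<i> * of_real (lam / 2)) (sympl (p - cconj p'))"
  define k where "k = - of_real (c / 4) * (bdot p p + bdot (cconj p') (cconj p'))"
  have eq: "hk lam r p (emb x) * cnj (hk lam r p' (emb x)) =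
     of_real (N\<^sup>2) * exp k * exp (- of_real (c / 2 * (norm x)\<^sup>2) + bdot (emb x) b)" for x
  proof -
    have "hk lam r p (emb x) * cnj (hk lam r p' (emb x)) = of_real (N\<^sup>2) *
       exp ((- of_real (c / 4) * bdot (p - emb x) (p - emb x) - \<i> * of_real (lam / 2) * bdot (emb x) (sympl p)) +
       (- of_real (c / 4) * bdot (cconj p' - emb x) (cconj p' - emb x) + \<i> * of_real (lam / 2) * bdot (emb x) (sympl (cconj p'))))"
      unfolding hk_def by (simp add: exp_add[of "_ - _"] exp_cnj cnj_bdot c_def N_def power2_eq_square)
    also have "(- of_real (c / 4) * bdot (p - emb x) (p - emb x) - \<i> * of_real (lam / 2) * bdot (emb x) (sympl p)) +
       (- of_real (c / 4) * bdot (cconj p' - emb x) (cconj p' - emb x) + \<i> * of_real (lam / 2) * bdot (emb x) (sympl (cconj p')))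
       = k + (- of_real (c / 2 * (norm x)\<^sup>2) + bdot (emb x) b)"
      unfolding k_def b_def using bdot_commute[of p "emb x"] bdot_commute[of "cconj p'" "emb x"]
      by (simp add: bdot_bilinear sympl_diff bdot_emb algebra_simps)
    finally show ?thesis by (simp add: exp_add mult.assoc)
  qed
  have "has_bochner_integral lborel (\<lambda>x. hk lam r p (emb x) * cnj (hk lam r p' (emb x)))
     (of_real (N\<^sup>2) * exp k * (complex_of_real (pi / (c / 2)) ^ CARD('n) * exp (bdot b b / of_real (4 * (c / 2)))))"
    unfolding eq by (intro has_bochner_integral_mult_right gaussian_integral_rpt) (use c in auto)
  moreover have "of_real (N\<^sup>2) * exp k * (complex_of_real (pi / (c / 2)) ^ CARD('n) * exp (bdot b b / of_real (4 * (c / 2))))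
     = hk lam (2 * r) p (cconj p')"
  proof -
    have N: "N\<^sup>2 * (pi / (c / 2)) ^ CARD('n) = nf TYPE('n) lam (2 * r)"
    proof -
      have "N\<^sup>2 * (pi / (c / 2)) ^ CARD('n) = ((sf lam r / (4 * pi))\<^sup>2 * (pi / (c / 2))) ^ CARD('n)"
        unfolding N_def nf_def power_mult_distrib power_mult[symmetric] by (simp add: mult.commute)
      also have "(sf lam r / (4 * pi))\<^sup>2 * (pi / (c / 2)) = sf lam (2 * r) / (4 * pi)"
        unfolding sf_double[OF r] c_def[symmetric] using c by (simp add: power2_eq_square)
      finally show ?thesis by (simp add: nf_def)
    qed
    define S where "S = p + cconj p'"
    define D where "D = p - cconj p'"
    \<comment> \<open>The diagonal terms vanish by skewness and the two mixed ones agree, so the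
      twist of the result appears here.\<close>
    have SD: "bdot S (sympl D) = 2 * bdot (cconj p') (sympl p)"
      unfolding S_def D_def using bdot_sympl_swap[of p "cconj p'"]
      by (simp add: bdot_bilinear sympl_diff bdot_sympl_self)
    have k: "k = - of_real (c / 8) * (bdot S S + bdot D D)"
      unfolding k_def S_def D_def using bdot_commute[of p "cconj p'"]
      by (simp add: bdot_bilinear algebra_simps)
    have bb: "bdot b b = of_real (c\<^sup>2 / 4) * bdot S S - of_real (lam\<^sup>2 / 4) * bdot D D
        - \<i> * of_real (lam * c / 2) * bdot S (sympl D)"
      unfolding b_def S_def[symmetric] D_def[symmetric] using bdot_commute[of "sympl D" S]
      by (simp add: bdot_bilinear bdot_sympl_sympl power2_eq_square algebra_simps)
    have cc: "complex_of_real c \<noteq> 0" using c by simp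
    \<comment> \<open>The terms in \<open>bdot S S\<close> cancel, c/8 against (c^2/4)/(2c). The
      terms in \<open>bdot D D\<close> add up to -(c^2 + lam^2)/(8c), which is minus a quarter of
      \<open>cf lam (2 * r)\<close>.\<close>
    have "k + bdot b b / of_real (4 * (c / 2)) =
      - of_real (cf lam (2 * r) / 4) * bdot D D - \<i> * of_real (lam / 2) * bdot (cconj p') (sympl p)"
      unfolding k bb SD cf_double[OF r] c_def[symmetric] using cc
      by (simp add: power2_eq_square divide_simps) (simp add: algebra_simps)
    then show ?thesis
      unfolding hk_def N[symmetric] D_def[symmetric] by (simp add: exp_add[symmetric] mult.assoc mult.left_commute)
  qed
  ultimately show ?thesis by simp
qed

text \<open>Completing squares: the twisted terms combine into \<open>a \<bullet> sympl b\<close> with \<open>a, b\<close> the real and imaginary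
  parts of \<open>p - p'\<close>, so the weighted kernel is dominated by a convolution kernel.\<close>

lemma hk_weighted_bound:
  fixes p p' :: "'n::finite cpt"
  assumes t: "t > 0" "lam \<noteq> 0" and q: "2 * t \<le> q"
  shows "cmod (hk lam q p (cconj p')) * sqrt (Wtw lam t p) * sqrt (Wtw lam t p')
     \<le> 4 ^ CARD('n) * (nf TYPE('n) lam (2 * t))\<^sup>2 * exp (- ((cf lam q - \<bar>lam\<bar>) / 4 * (norm (p - p'))\<^sup>2))"
proof -
  define X where "X = RE p" define Y where "Y = IM p" define X' where "X' = RE p'" define Y' where "Y' = IM p'"
  define c where "c = cf lam q" define d where "d = cf lam (2 * t)"
  define N where "N = nf TYPE('n) lam (2 * t)"
  define a where "a = X - X'" define b where "b = Y - Y'"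
  have q0: "q > 0" using t q by simp
  have cd: "c \<le> d" unfolding c_def d_def using t q by (intro cf_antimono) auto
  have c: "c > \<bar>lam\<bar>" unfolding c_def by (rule cf_gt[OF q0 t(2)])
  have N: "N > 0" unfolding N_def using t by (intro nf_pos) auto
  have sq: "sqrt (Wtw lam t p) = sqrt (4 ^ CARD('n) * N) * exp ((- lam * (RE p \<bullet> sympl (IM p)) - d * (norm (IM p))\<^sup>2) / 2)" for p :: "'n cpt"
    unfolding Wtw_eq N_def[symmetric] d_def[symmetric] real_sqrt_mult
    by (simp add: real_sqrt_unique flip: exp_of_nat_mult)
  have N4: "sqrt (4 ^ CARD('n) * N) * sqrt (4 ^ CARD('n) * N) = 4 ^ CARD('n) * N"
    using N by simp
  have E: "(- (c / 4) * ((norm (X - X'))\<^sup>2 - (norm (Y + Y'))\<^sup>2) + lam / 2 * (X' \<bullet> sympl Y - Y' \<bullet> sympl X))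
     + ((- lam * (X \<bullet> sympl Y) - d * (norm Y)\<^sup>2) / 2) + ((- lam * (X' \<bullet> sympl Y') - d * (norm Y')\<^sup>2) / 2)
     = - (c / 4) * (norm a)\<^sup>2 - d / 4 * (norm b)\<^sup>2 + (c - d) / 4 * (norm (Y + Y'))\<^sup>2 - lam / 2 * (a \<bullet> sympl b)"
  proof -
    have 1: "(norm b)\<^sup>2 = 2 * (norm Y)\<^sup>2 + 2 * (norm Y')\<^sup>2 - (norm (Y + Y'))\<^sup>2"
      unfolding b_def power2_norm_eq_inner by (simp add: inner_add_left inner_add_right inner_diff_left inner_diff_right)
    have 2: "a \<bullet> sympl b = X \<bullet> sympl Y - X \<bullet> sympl Y' - X' \<bullet> sympl Y + X' \<bullet> sympl Y'"
      by (simp add: a_def b_def inner_diff_left inner_diff_right sympl_diff)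
    show ?thesis unfolding 1 2 a_def[symmetric] inner_sympl_swap[of Y' X] by (simp add: field_simps)
  qed
  \<comment> \<open>The twist costs at most |lam|/4 of each square, by Cauchy-Schwarz and the
    arithmetic-geometric mean; this leaves the rate (c - |lam|)/4.\<close>
  have E2: "\<dots> \<le> - ((c - \<bar>lam\<bar>) / 4 * (norm (p - p'))\<^sup>2)"
  proof -
    have np: "(norm (p - p'))\<^sup>2 = (norm a)\<^sup>2 + (norm b)\<^sup>2"
      by (simp add: norm_cpt a_def b_def X_def X'_def Y_def Y'_def)
    have "\<bar>a \<bullet> sympl b\<bar> \<le> norm a * norm b" using Cauchy_Schwarz_ineq2[of a "sympl b"] by (simp add: norm_sympl)
    also have "\<dots> \<le> ((norm a)\<^sup>2 + (norm b)\<^sup>2) / 2" using sum_squares_bound[of "norm a" "norm b"] by simp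
    finally have "\<bar>lam * (a \<bullet> sympl b)\<bar> \<le> \<bar>lam\<bar> * (((norm a)\<^sup>2 + (norm b)\<^sup>2) / 2)"
      unfolding abs_mult by (intro mult_left_mono) auto
    then have 1: "- lam / 2 * (a \<bullet> sympl b) \<le> \<bar>lam\<bar> / 4 * ((norm a)\<^sup>2 + (norm b)\<^sup>2)" by simp
    have 2: "(c - d) / 4 * (norm (Y + Y'))\<^sup>2 \<le> 0" using cd by (simp add: mult_nonpos_nonneg)
    have 3: "c / 4 * (norm b)\<^sup>2 \<le> d / 4 * (norm b)\<^sup>2" using cd by (intro mult_right_mono) auto
    have 4: "(c - \<bar>lam\<bar>) / 4 * ((norm a)\<^sup>2 + (norm b)\<^sup>2) =
        c / 4 * (norm a)\<^sup>2 + c / 4 * (norm b)\<^sup>2 - \<bar>lam\<bar> / 4 * ((norm a)\<^sup>2 + (norm b)\<^sup>2)"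
      by (simp add: field_simps)
    show ?thesis unfolding np 4 using 1 2 3 by linarith
  qed
  have "cmod (hk lam q p (cconj p')) * sqrt (Wtw lam t p) * sqrt (Wtw lam t p') =
     nf TYPE('n) lam q * (4 ^ CARD('n) * N) * exp ((- (c / 4) * ((norm (X - X'))\<^sup>2 - (norm (Y + Y'))\<^sup>2) + lam / 2 * (X' \<bullet> sympl Y - Y' \<bullet> sympl X))
     + ((- lam * (X \<bullet> sympl Y) - d * (norm Y)\<^sup>2) / 2) + ((- lam * (X' \<bullet> sympl Y') - d * (norm Y')\<^sup>2) / 2))"
    unfolding cmod_hk[OF q0 t(2)] sq exp_add N4 RE_IM_simps X_def[symmetric] Y_def[symmetric] X'_def[symmetric]
      Y'_def[symmetric] c_def[symmetric] diff_minus_eq_add inner_minus_left add_uminus_conv_diff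
    by (subst N4[symmetric]) (simp only: mult_ac)
  also have "\<dots> \<le> N * (4 ^ CARD('n) * N) * exp (- ((c - \<bar>lam\<bar>) / 4 * (norm (p - p'))\<^sup>2))"
    unfolding E using E2 N nf_antimono[of "2 * t" q lam, where 'n='n] t q
    by (intro mult_mono) (auto simp: N_def)
  finally show ?thesis by (simp add: N_def c_def power2_eq_square mult_ac)
qed

text \<open>In the real and imaginary parts \<open>a\<close>, \<open>b\<close> of
  \<open>p - emb x\<close> the exponent is minus a quadratic form, and the factors depending on the
  position of \<open>x\<close> cancel against the weight. The discriminant of the form is (c C -
  lam^2)(C - c)/C; its positivity rests on c < C, that is on \<open>s > 0\<close>.\<close>

lemma hk_sq_weight_bound:
  fixes x :: "'n::finite rpt"
  assumes t: "t > 0" "lam \<noteq> 0" and s: "s > 0"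
  obtains \<delta> C where "\<delta> > 0" "\<And>p. (cmod (hk lam (t + s) p (emb x)))\<^sup>2 * Wtw lam t p \<le> C * exp (- (\<delta> * (norm (p - emb x))\<^sup>2))"
proof -
  define c where "c = cf lam (t + s)" define C where "C = cf lam t" define d where "d = cf lam (2 * t)"
  define \<alpha> where "\<alpha> = c / 2"
  define N where "N = nf TYPE('n) lam (t + s)" define M where "M = 4 ^ CARD('n) * nf TYPE('n) lam (2 * t)"
  have c: "c > \<bar>lam\<bar>" unfolding c_def using t s by (intro cf_gt) auto
  have cC: "c < C" unfolding c_def C_def using t s by (intro cf_strict_antimono) auto
  have d: "d = (C\<^sup>2 + lam\<^sup>2) / (2 * C)" unfolding d_def C_def by (rule cf_double[OF t])
  have lc: "lam\<^sup>2 < c * C"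
  proof -
    have "\<bar>lam\<bar> * \<bar>lam\<bar> < c * C" using c cC by (intro mult_strict_mono) auto
    then show ?thesis by (simp add: power2_eq_square abs_mult[symmetric])
  qed
  have C0: "C > 0" using c cC by linarith
  have d0: "d > 0" unfolding d_def using t by (intro cf_pos) auto
  have disc: "4 * \<alpha> * (d - \<alpha>) > lam\<^sup>2"
  proof -
    have "(4 * \<alpha> * (d - \<alpha>) - lam\<^sup>2) * C = (c * C - lam\<^sup>2) * (C - c)"
      unfolding \<alpha>_def d using C0 by (simp add: field_simps power2_eq_square)
    also have "\<dots> > 0" using lc cC by simp
    finally show ?thesis using C0 by (simp add: zero_less_mult_iff)
  qed
  \<comment> \<open>Lowering both diagonal coefficients by \<open>\<delta>\<close> must keep four
    times their product at least lam^2. This \<open>\<delta>\<close> achieves equality when the term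
    4 \<open>\<delta>\<close> squared is ignored, and that term has the favourable sign.\<close>
  define \<delta> where "\<delta> = (4 * \<alpha> * (d - \<alpha>) - lam\<^sup>2) / (4 * d)"
  have \<delta>: "\<delta> > 0" unfolding \<delta>_def using disc d0 by simp
  have \<alpha>0: "\<alpha> > 0" using c by (simp add: \<alpha>_def)
  have \<delta>\<alpha>: "\<alpha> - \<delta> > 0"
  proof -
    have "4 * d * (\<alpha> - \<delta>) = 4 * \<alpha> * \<alpha> + lam\<^sup>2" unfolding \<delta>_def using d0 by (simp add: field_simps)
    also have "\<dots> > 0" using \<alpha>0 by (simp add: add_pos_nonneg)
    finally show ?thesis using d0 by (simp add: zero_less_mult_iff)
  qed
  have disc2: "4 * (\<alpha> - \<delta>) * (d - \<alpha> - \<delta>) \<ge> lam\<^sup>2"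
  proof -
    have "4 * (\<alpha> - \<delta>) * (d - \<alpha> - \<delta>) = 4 * \<alpha> * (d - \<alpha>) - 4 * d * \<delta> + 4 * \<delta>\<^sup>2"
      by (simp add: algebra_simps power2_eq_square)
    also have "\<dots> = lam\<^sup>2 + 4 * \<delta>\<^sup>2" unfolding \<delta>_def using d0 by (simp add: field_simps)
    finally show ?thesis by simp
  qed
  have quad: "lam * (a \<bullet> sympl b) + \<alpha> * (norm a)\<^sup>2 + (d - \<alpha>) * (norm b)\<^sup>2 \<ge> \<delta> * ((norm a)\<^sup>2 + (norm b)\<^sup>2)" for a b :: "'n rpt"
  proof -
    define A where "A = \<alpha> - \<delta>" define B where "B = d - \<alpha> - \<delta>"
    have "\<bar>a \<bullet> sympl b\<bar> \<le> norm a * norm b" using Cauchy_Schwarz_ineq2[of a "sympl b"] by (simp add: norm_sympl)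
    then have 1: "\<bar>lam * (a \<bullet> sympl b)\<bar> \<le> \<bar>lam\<bar> * (norm a * norm b)"
      unfolding abs_mult by (intro mult_left_mono) auto
    \<comment> \<open>Completing the square, after multiplication by 4A.\<close>
    have "0 \<le> (2 * A * norm a - \<bar>lam\<bar> * norm b)\<^sup>2 + (4 * A * B - lam\<^sup>2) * (norm b)\<^sup>2"
      using disc2 by (simp add: A_def B_def)
    also have "\<dots> = 4 * A * (A * (norm a)\<^sup>2 - \<bar>lam\<bar> * (norm a * norm b) + B * (norm b)\<^sup>2)"
      by (simp add: power2_eq_square algebra_simps abs_mult_self_eq)
    finally have "0 \<le> A * (norm a)\<^sup>2 - \<bar>lam\<bar> * (norm a * norm b) + B * (norm b)\<^sup>2"
      using \<delta>\<alpha> by (simp add: A_def zero_le_mult_iff)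
    then show ?thesis using 1 by (simp add: A_def B_def algebra_simps)
  qed
  have N: "N > 0" and M: "M > 0" unfolding N_def M_def using t s by (auto intro!: nf_pos mult_pos_pos)
  have "(cmod (hk lam (t + s) p (emb x)))\<^sup>2 * Wtw lam t p \<le> (N\<^sup>2 * M) * exp (- (\<delta> * (norm (p - emb x))\<^sup>2))" for p
  proof -
    define a where "a = RE p - x" define b where "b = IM p"
    have ts: "t + s > 0" using t s by simp
    have np: "(norm (p - emb x))\<^sup>2 = (norm a)\<^sup>2 + (norm b)\<^sup>2" by (simp add: norm_cpt a_def b_def)
    have "(cmod (hk lam (t + s) p (emb x)))\<^sup>2 * Wtw lam t p =
       (N\<^sup>2 * M) * exp (2 * (- (c / 4) * ((norm a)\<^sup>2 - (norm b)\<^sup>2) + lam / 2 * (x \<bullet> sympl b))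
           + (- lam * (RE p \<bullet> sympl b) - d * (norm b)\<^sup>2))"
      unfolding cmod_hk[OF ts t(2)] Wtw_eq exp_add power_mult_distrib exp_double
      by (simp add: N_def M_def a_def b_def c_def d_def)
    also have "2 * (- (c / 4) * ((norm a)\<^sup>2 - (norm b)\<^sup>2) + lam / 2 * (x \<bullet> sympl b))
           + (- lam * (RE p \<bullet> sympl b) - d * (norm b)\<^sup>2)
       = - (lam * (a \<bullet> sympl b) + \<alpha> * (norm a)\<^sup>2 + (d - \<alpha>) * (norm b)\<^sup>2)"
      by (simp add: \<alpha>_def a_def inner_diff_left algebra_simps)
    also have "exp \<dots> \<le> exp (- (\<delta> * (norm (p - emb x))\<^sup>2))"
      unfolding np using quad[of a b] by (subst exp_le_cancel_iff) linarith
    finally show ?thesis using N M by (simp add: mult_left_mono)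
  qed
  with \<delta> show ?thesis using that by blast
qed

section \<open>The reproducing formula\<close>

lemma mult_le_sum_squares: "a * b \<le> a\<^sup>2 + b\<^sup>2" for a b :: real
  using sum_squares_bound[of a b] zero_le_power2[of a] zero_le_power2[of b] by linarith

lemma linear_cscale: "linear (cscale c)" and linear_cscale_left: "linear (\<lambda>c. cscale c p)"
  by (auto intro!: linearI simp: cscale_def vec_eq_iff prod_eq_iff algebra_simps)

lemma norm_cscale: "norm (cscale c p) = cmod c * norm p"
proof -
  have "(norm (cscale c p))\<^sup>2 = (cmod c * norm p)\<^sup>2"
    by (cases p) (simp add: cscale_def norm_Pair norm_vec_def L2_set_def norm_mult power_mult_distrib
        sum_nonneg sum_distrib_left algebra_simps)
  then show ?thesis by simp
qed

lemma continuous_on_cscale [continuous_intros]: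
  "continuous_on S f \<Longrightarrow> continuous_on S g \<Longrightarrow> continuous_on S (\<lambda>x. cscale (f x) (g x))"
  unfolding cscale_def by (intro continuous_intros)

lemma entire2n_continuous_on: "entire2n F \<Longrightarrow> continuous_on S F"
  unfolding entire2n_def
  by (meson continuous_at_imp_continuous_on has_derivative_continuous)

lemma entire2n_measurable: "entire2n F \<Longrightarrow> F \<in> borel_measurable borel"
  by (intro borel_measurable_continuous_onI entire2n_continuous_on)

text \<open>Complex lines are the right objects to restrict to: the orbits of the unimodular
  scalars, over which the mean value is taken, are circles in such lines.\<close>

lemma entire2n_holomorphic_on_line:
  assumes "entire2n F"
  shows "(\<lambda>\<tau>. F (p + cscale \<tau> v)) holomorphic_on UNIV"
  unfolding holomorphic_on_def field_differentiable_def
proof (intro ballI)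
  fix \<tau> :: complex
  obtain L where L: "(F has_derivative L) (at (p + cscale \<tau> v))" "\<And>v. L (cscale \<i> v) = \<i> * L v"
    using assms unfolding entire2n_def by blast
  have linL: "linear L" using L(1) has_derivative_linear by blast
  have "((\<lambda>\<tau>. cscale \<tau> v) has_derivative (\<lambda>h. cscale h v)) (at \<tau>)"
    by (intro bounded_linear_imp_has_derivative) (simp add: linear_cscale_left linear_conv_bounded_linear[symmetric])
  then have "((\<lambda>\<tau>. p + cscale \<tau> v) has_derivative (\<lambda>h. cscale h v)) (at \<tau>)"
    using has_derivative_add[OF has_derivative_const] by fastforce
  from has_derivative_compose[OF this L(1)]
  have "((\<lambda>\<tau>. F (p + cscale \<tau> v)) has_derivative (\<lambda>h. L (cscale h v))) (at \<tau>)" .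
  moreover have "L (cscale h v) = L v * h" for h
  proof -
    have "cscale h v = Re h *\<^sub>R v + Im h *\<^sub>R cscale \<i> v"
      by (simp add: cscale_def vec_eq_iff prod_eq_iff complex_eq_iff)
    then have "L (cscale h v) = Re h *\<^sub>R L v + Im h *\<^sub>R (\<i> * L v)"
      by (simp add: linear_add[OF linL] linear_cmul[OF linL] L(2))
    then show ?thesis by (simp add: complex_eq_iff algebra_simps)
  qed
  ultimately have "((\<lambda>\<tau>. F (p + cscale \<tau> v)) has_field_derivative L v) (at \<tau>)"
    by (simp add: has_field_derivative_def)
  then show "\<exists>D. ((\<lambda>\<tau>. F (p + cscale \<tau> v)) has_field_derivative D) (at \<tau> within UNIV)" by auto
qed

text \<open>Multiplication by a unimodular scalar preserves both Lebesgue measure and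
  \<open>\<omega>\<close>, so \<open>G v\<close> may be replaced by its average over the circle
  through \<open>v\<close>. By the one-variable mean value property that average is
  \<open>G 0\<close>.\<close>

lemma weighted_mean_value:
  fixes G :: "'n::finite cpt \<Rightarrow> complex" and \<omega> :: "'n cpt \<Rightarrow> real"
  assumes G: "continuous_on UNIV G" and hol: "\<And>v. (\<lambda>\<tau>. G (cscale \<tau> v)) holomorphic_on UNIV"
    and \<omega>: "continuous_on UNIV \<omega>" and inv: "\<And>c v. cmod c = 1 \<Longrightarrow> \<omega> (cscale c v) = \<omega> v"
    and int: "integrable lborel (\<lambda>v. G v * of_real (\<omega> v))"
  shows "integral\<^sup>L lborel (\<lambda>v. G v * of_real (\<omega> v)) = G 0 * of_real (integral\<^sup>L lborel \<omega>)"
proof -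
  define e where "e = (\<lambda>\<theta>::real. exp (2 * of_real pi * \<i> * of_real \<theta>))"
  have e: "cmod (e \<theta>) = 1" for \<theta> by (simp add: e_def)
  define \<Psi> where "\<Psi> = (\<lambda>\<theta> v. indicator {0..1} \<theta> *\<^sub>R (G (cscale (e \<theta>) v) * of_real (\<omega> v)))"
  have [measurable]: "G \<in> borel_measurable borel" "\<omega> \<in> borel_measurable borel"
    using G \<omega> by (auto intro: borel_measurable_continuous_onI)
  have cont_e: "continuous_on UNIV (\<lambda>x. cscale (e (fst x)) (snd x))"
    unfolding e_def by (intro continuous_intros)
  have "(\<lambda>x::real \<times> 'n cpt. G (cscale (e (fst x)) (snd x))) \<in> borel_measurable borel"
    by (intro borel_measurable_continuous_onI continuous_on_compose2[OF G cont_e]) auto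
  then have [measurable]: "(\<lambda>x::real \<times> 'n cpt. G (cscale (e (fst x)) (snd x))) \<in> borel_measurable (borel \<Otimes>\<^sub>M borel)"
    by (simp add: borel_prod)
  have \<Psi>m: "case_prod \<Psi> \<in> borel_measurable (lborel \<Otimes>\<^sub>M lborel)"
    unfolding \<Psi>_def case_prod_unfold by measurable
  have rot_m[measurable]: "cscale c \<in> borel_measurable borel" for c :: complex
    by (intro borel_measurable_continuous_onI continuous_intros)
  have rot: "distr lborel borel (cscale (e \<theta>)) = (lborel :: 'n cpt measure)" for \<theta>
    by (rule distr_lborel_isometry) (auto simp: linear_cscale norm_cscale e)
  define g where "g = (\<lambda>v. G v * of_real (\<omega> v))"
  have gm[measurable]: "g \<in> borel_measurable borel" unfolding g_def by measurable
  have \<Psi>g: "\<Psi> \<theta> v = indicator {0..1} \<theta> *\<^sub>R g (cscale (e \<theta>) v)" for \<theta> v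
    by (simp add: \<Psi>_def g_def inv[OF e])
  have rot_int: "integrable lborel (\<lambda>v. g (cscale (e \<theta>) v))" for \<theta>
  proof -
    have "integrable (distr lborel borel (cscale (e \<theta>))) g" unfolding rot using int by (simp add: g_def)
    then show ?thesis by (subst (asm) integrable_distr_eq) auto
  qed
  have rot_eq: "integral\<^sup>L lborel (\<lambda>v. h (cscale (e \<theta>) v)) = integral\<^sup>L lborel h"
    if [measurable]: "h \<in> borel_measurable borel" for \<theta> and h :: "'n cpt \<Rightarrow> 'b::{banach,second_countable_topology}"
  proof -
    have "integral\<^sup>L lborel h = integral\<^sup>L (distr lborel borel (cscale (e \<theta>))) h" by (simp add: rot)
    then show ?thesis by (subst (asm) integral_distr) auto
  qed
  \<comment> \<open>The integral of the norm over \<open>v\<close> does not depend on the angle, and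
    the angle runs through an interval of length one.\<close>
  have int\<Psi>: "integrable (lborel \<Otimes>\<^sub>M lborel) (case_prod \<Psi>)"
  proof (rule lborel_pair.Fubini_integrable[OF \<Psi>m])
    have "(\<lambda>\<theta>. \<integral>v. norm (case_prod \<Psi> (\<theta>, v)) \<partial>lborel) = (\<lambda>\<theta>. indicator {0..1} \<theta> *\<^sub>R (\<integral>v. norm (g v) \<partial>lborel))"
      using rot_eq[of "\<lambda>v. norm (g v)"] by (auto simp: \<Psi>g)
    then show "integrable lborel (\<lambda>\<theta>. \<integral>v. norm (case_prod \<Psi> (\<theta>, v)) \<partial>lborel)"
      by (simp only:) (intro integrable_scaleR_left integrable_real_indicator, auto)
    show "AE \<theta> in lborel. integrable lborel (\<lambda>v. case_prod \<Psi> (\<theta>, v))"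
      using rot_int by (simp add: \<Psi>g)
  qed
  have "integral\<^sup>L lborel g = (\<integral>\<theta>. (\<integral>v. \<Psi> \<theta> v \<partial>lborel) \<partial>lborel)"
    by (simp add: \<Psi>g rot_eq[OF gm])
  also have "\<dots> = (\<integral>v. (\<integral>\<theta>. \<Psi> \<theta> v \<partial>lborel) \<partial>lborel)"
    by (rule lborel_pair.Fubini_integral[OF int\<Psi>, symmetric])
  also have "\<dots> = (\<integral>v. G 0 * of_real (\<omega> v) \<partial>lborel)"
  proof (rule Bochner_Integration.integral_cong[OF refl])
    fix v
    have "has_bochner_integral lborel (\<lambda>\<theta>. \<Psi> \<theta> v) (G (cscale 0 v) * of_real (\<omega> v))"
      unfolding \<Psi>_def e_def mult_scaleR_left[symmetric]
      by (rule has_bochner_integral_mult_left[OF holomorphic_circle_mean[OF hol]])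
    moreover have "cscale 0 v = 0" by (simp add: cscale_def vec_eq_iff prod_eq_iff)
    ultimately show "(\<integral>\<theta>. \<Psi> \<theta> v \<partial>lborel) = G 0 * of_real (\<omega> v)"
      by (simp add: has_bochner_integral_integral_eq)
  qed
  also have "\<dots> = G 0 * of_real (integral\<^sup>L lborel \<omega>)" by simp
  finally show ?thesis by (simp add: g_def)
qed

text \<open>For fixed second component \<open>w\<close> the twist is linear in the first, so two
  Gaussian integrations suffice. The first of them lowers the rate in \<open>w\<close> from c/2 to
  (c^2 - lam^2)/(2c).\<close>

lemma weight_norm:
  assumes c: "c > \<bar>lam\<bar>"
  shows "integral\<^sup>L lborel (\<lambda>v::'n::finite cpt. exp (- (c / 2) * (norm v)\<^sup>2 - lam * (RE v \<bullet> sympl (IM v))))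
     = (4 * pi\<^sup>2 / (c\<^sup>2 - lam\<^sup>2)) ^ CARD('n)" (is "integral\<^sup>L _ ?w = _")
proof -
  define im where "im = (\<lambda>w::complex^'n. (\<chi> j. \<i> * w $ j))"
  have im: "norm (im w) = norm w" for w
    by (simp add: im_def norm_vec_def norm_mult)
  have c0: "c > 0" using c by linarith
  have "\<bar>lam\<bar>\<^sup>2 < c\<^sup>2" using c by (intro power_strict_mono) auto
  then have cl: "lam\<^sup>2 < c\<^sup>2" by simp
  have w: "?w (z, w) = exp (- (c / 2) * (norm w)\<^sup>2) * exp (- (c / 2 * (norm z)\<^sup>2) + z \<bullet> (lam *\<^sub>R im w))" for z w
  proof -
    \<comment> \<open>The twist is minus the real inner product of \<open>z\<close> with
      \<open>i w\<close>.\<close>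
    have "RE (z, w) \<bullet> sympl (IM (z, w)) = - (z \<bullet> im w)"
      by (simp add: RE_def IM_def Revec_def Imvec_def sympl_def im_def inner_vec_def inner_complex_def sum.distrib
          sum_negf sum_subtractf algebra_simps)
    then show ?thesis by (simp add: norm_Pair algebra_simps flip: exp_add)
  qed
  have intw: "integrable lborel ?w"
  proof (rule Bochner_Integration.integrable_bound[OF integrable_gaussian[of "(c - \<bar>lam\<bar>) / 2"]])
    show "?w \<in> borel_measurable lborel"
      by (simp, intro borel_measurable_continuous_onI continuous_intros) auto
    have "?w v \<le> exp (- ((c - \<bar>lam\<bar>) / 2 * (norm v)\<^sup>2))" for v :: "'n cpt"
    proof -
      have "\<bar>RE v \<bullet> sympl (IM v)\<bar> \<le> norm (RE v) * norm (IM v)"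
        using Cauchy_Schwarz_ineq2[of "RE v" "sympl (IM v)"] by (simp add: norm_sympl)
      also have "\<dots> \<le> (norm v)\<^sup>2 / 2" using sum_squares_bound[of "norm (RE v)" "norm (IM v)"] by (simp add: norm_cpt)
      finally have "\<bar>lam * (RE v \<bullet> sympl (IM v))\<bar> \<le> \<bar>lam\<bar> * ((norm v)\<^sup>2 / 2)"
        unfolding abs_mult by (intro mult_left_mono) auto
      then have "- lam * (RE v \<bullet> sympl (IM v)) \<le> \<bar>lam\<bar> / 2 * (norm v)\<^sup>2" by simp
      moreover have "(c - \<bar>lam\<bar>) / 2 * (norm v)\<^sup>2 = c / 2 * (norm v)\<^sup>2 - \<bar>lam\<bar> / 2 * (norm v)\<^sup>2"
        by (simp add: field_simps)
      ultimately show ?thesis by (subst exp_le_cancel_iff) linarith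
    qed
    then show "AE v in lborel. norm (?w v) \<le> norm (exp (- ((c - \<bar>lam\<bar>) / 2 * (norm v)\<^sup>2)))" by simp
  qed (use c in auto)
  have card: "DIM(complex^'n) = 2 * CARD('n)" by (simp add: mult.commute)
  have sq: "sqrt (pi / A) ^ DIM(complex^'n) = (pi / A) ^ CARD('n)" if "A > 0" for A
    unfolding card power_mult using that by simp
  have inner: "(\<integral>z. ?w (z, w) \<partial>lborel) = (2 * pi / c) ^ CARD('n) * exp (- ((c\<^sup>2 - lam\<^sup>2) / (2 * c) * (norm w)\<^sup>2))" for w
  proof -
    have "(\<integral>z. ?w (z, w) \<partial>lborel) = exp (- (c / 2) * (norm w)\<^sup>2) *
       (sqrt (pi / (c / 2)) ^ DIM(complex^'n) * exp ((lam *\<^sub>R im w \<bullet> lam *\<^sub>R im w) / (4 * (c / 2))))"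
      unfolding w using gaussian_real_integral[of "c / 2" "lam *\<^sub>R im w"] c0
      by (simp add: has_bochner_integral_iff)
    also have "\<dots> = (2 * pi / c) ^ CARD('n) * exp (- (c / 2) * (norm w)\<^sup>2 + lam\<^sup>2 * (norm w)\<^sup>2 / (2 * c))"
    proof -
      have e: "(lam *\<^sub>R im w \<bullet> lam *\<^sub>R im w) / (4 * (c / 2)) = lam\<^sup>2 * (norm w)\<^sup>2 / (2 * c)"
        by (simp add: power2_norm_eq_inner[symmetric] im power_mult_distrib)
      have "sqrt (pi / (c / 2)) ^ DIM(complex^'n) = (2 * pi / c) ^ CARD('n)"
        using sq[of "c / 2"] c0 by (simp add: mult.commute)
      then show ?thesis unfolding e exp_add by (simp only: mult_ac)
    qed
    also have "- (c / 2) * (norm w)\<^sup>2 + lam\<^sup>2 * (norm w)\<^sup>2 / (2 * c) = - ((c\<^sup>2 - lam\<^sup>2) / (2 * c) * (norm w)\<^sup>2)"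
      using c0 by (simp add: field_simps power2_eq_square)
    finally show ?thesis .
  qed
  have A: "(c\<^sup>2 - lam\<^sup>2) / (2 * c) > 0" using c0 cl by simp
  have "integral\<^sup>L lborel ?w = integral\<^sup>L (lborel \<Otimes>\<^sub>M lborel) (case_prod (\<lambda>z w. ?w (z, w)))"
    unfolding lborel_prod by (rule Bochner_Integration.integral_cong) auto
  also have "\<dots> = (\<integral>w. (\<integral>z. ?w (z, w) \<partial>lborel) \<partial>lborel)"
    by (rule lborel_pair.integral_snd[symmetric]) (use intw in \<open>simp add: lborel_prod case_prod_unfold\<close>)
  also have "\<dots> = (2 * pi / c) ^ CARD('n) * (pi / ((c\<^sup>2 - lam\<^sup>2) / (2 * c))) ^ CARD('n)"
    unfolding inner using gaussian_real_integral[OF A, of "0 :: complex^'n"] sq[OF A]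
    by (simp add: has_bochner_integral_iff)
  also have "\<dots> = (4 * pi\<^sup>2 / (c\<^sup>2 - lam\<^sup>2)) ^ CARD('n)"
    unfolding power_mult_distrib[symmetric] using c0 cl by (simp add: field_simps power2_eq_square)
  finally show ?thesis .
qed

lemma Btw_integrable:
  assumes t: "t > 0" "lam \<noteq> 0" and F: "F \<in> Btw lam t"
  shows "integrable lborel (\<lambda>p. (cmod (F p))\<^sup>2 * Wtw lam t p)"
proof (rule integrableI_bounded)
  have [measurable]: "F \<in> borel_measurable borel"
    using F entire2n_measurable by (auto simp: Btw_def)
  show "(\<lambda>p. (cmod (F p))\<^sup>2 * Wtw lam t p) \<in> borel_measurable lborel" by measurable
  show "(\<integral>\<^sup>+p. ennreal (norm ((cmod (F p))\<^sup>2 * Wtw lam t p)) \<partial>lborel) < \<infinity>"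
    using F by (simp add: Btw_def abs_mult abs_of_pos[OF Wtw_pos[OF t]])
qed

text \<open>Around \<open>p\<close> the reproducing kernel times the weight is a holomorphic function times a Gaussian that is
  invariant under multiplication by unimodular scalars, so the mean value property applies.\<close>

lemma reproducing_formula:
  fixes F :: "'n::finite cpt \<Rightarrow> complex"
  assumes t: "t > 0" "lam \<noteq> 0" and F: "F \<in> Btw lam t"
  shows "has_bochner_integral lborel (\<lambda>q. F q * hk lam (2 * t) p (cconj q) * of_real (Wtw lam t q)) (F p)"
proof -
  define g where "g = (\<lambda>q. F q * hk lam (2 * t) p (cconj q) * of_real (Wtw lam t q))"
  have ent: "entire2n F" using F by (simp add: Btw_def)
  note Fm[measurable] = entire2n_measurable[OF ent]
  have gm[measurable]: "g \<in> borel_measurable borel" unfolding g_def by measurable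
  define c where "c = cf lam (2 * t)"
  have c: "c > \<bar>lam\<bar>" unfolding c_def using t by (intro cf_gt) auto
  define A where "A = 4 ^ CARD('n) * (nf TYPE('n) lam (2 * t))\<^sup>2"
  define \<delta> where "\<delta> = (c - \<bar>lam\<bar>) / 4"
  have \<delta>: "\<delta> > 0" using c by (simp add: \<delta>_def)
  have Wp: "Wtw lam t q > 0" for q :: "'n cpt" by (rule Wtw_pos[OF t])
  have bound: "norm (g q) \<le> (cmod (F q))\<^sup>2 * Wtw lam t q + (A\<^sup>2 / Wtw lam t p) * exp (- (2 * \<delta> * (norm (q - p))\<^sup>2))" for q
  proof -
    define h where "h = cmod (hk lam (2 * t) p (cconj q)) * sqrt (Wtw lam t q)"
    have h0: "h \<ge> 0" using Wp[of q] by (simp add: h_def)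
    have "h * sqrt (Wtw lam t p) \<le> A * exp (- (\<delta> * (norm (q - p))\<^sup>2))"
      using hk_weighted_bound[OF t order_refl, of p q] by (simp add: h_def A_def \<delta>_def c_def norm_minus_commute mult_ac)
    then have "(h * sqrt (Wtw lam t p))\<^sup>2 \<le> (A * exp (- (\<delta> * (norm (q - p))\<^sup>2)))\<^sup>2"
      using h0 Wp[of p] by (intro power_mono) auto
    then have "h\<^sup>2 * Wtw lam t p \<le> A\<^sup>2 * exp (- (2 * \<delta> * (norm (q - p))\<^sup>2))"
      using Wp[of p] by (simp add: power_mult_distrib exp_double[symmetric] mult_ac)
    then have h2: "h\<^sup>2 \<le> (A\<^sup>2 / Wtw lam t p) * exp (- (2 * \<delta> * (norm (q - p))\<^sup>2))"
      using Wp[of p] by (simp add: field_simps)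
    have "norm (g q) = (cmod (F q) * sqrt (Wtw lam t q)) * h"
      using Wp[of q] by (simp add: g_def h_def norm_mult)
    also have "\<dots> \<le> (cmod (F q) * sqrt (Wtw lam t q))\<^sup>2 + h\<^sup>2"
      by (rule mult_le_sum_squares)
    also have "(cmod (F q) * sqrt (Wtw lam t q))\<^sup>2 = (cmod (F q))\<^sup>2 * Wtw lam t q"
      using Wp[of q] by (simp add: power_mult_distrib)
    finally show ?thesis using h2 by linarith
  qed
  have int_g: "integrable lborel g"
  proof (rule Bochner_Integration.integrable_bound)
    have "integrable lborel (\<lambda>q::'n cpt. exp (- (2 * \<delta> * (norm (q + - p))\<^sup>2)))"
      by (subst integral_lborel_translate(2)) (use \<delta> integrable_gaussian[of "2 * \<delta>", where 'a="'n cpt"] in auto)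
    then show "integrable lborel (\<lambda>q. (cmod (F q))\<^sup>2 * Wtw lam t q + (A\<^sup>2 / Wtw lam t p) * exp (- (2 * \<delta> * (norm (q - p))\<^sup>2)))"
      by (intro Bochner_Integration.integrable_add Btw_integrable[OF t F] integrable_mult_right) simp
    show "AE q in lborel. norm (g q) \<le> norm ((cmod (F q))\<^sup>2 * Wtw lam t q + (A\<^sup>2 / Wtw lam t p) * exp (- (2 * \<delta> * (norm (q - p))\<^sup>2)))"
      unfolding real_norm_def by (intro AE_I2 order_trans[OF bound abs_ge_self])
  qed simp
  \<comment> \<open>Put q = p + v and write q' for its conjugate. As -c |Im q|^2 = (c/4)(q - q').(q
    - q'), kernel and weight give a difference of two squares in which q'.q' cancels; it equals
    (c/4) v.v + (c/2) v.(p - q'). The twists merge into (i lam/2) q'.Jv with J =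
    \<open>sympl\<close>. \<open>l\<close> collects what is holomorphic in \<open>v\<close>, and the
    terms pairing \<open>v\<close> with its own conjugate form \<open>\<omega>\<close>.\<close>
  define l where "l = (\<lambda>v. of_real (c / 4) * bdot v v + of_real (c / 2) * bdot v (p - cconj p) + \<i> * of_real (lam / 2) * bdot (cconj p) (sympl v))"
  define G where "G = (\<lambda>v. F (p + v) * exp (l v))"
  define \<omega> where "\<omega> = (\<lambda>v::'n cpt. exp (- (c / 2) * (norm v)\<^sup>2 - lam * (RE v \<bullet> sympl (IM v))))"
  have gG: "g (v + p) = of_real A * (G v * of_real (\<omega> v))" for v
  proof -
    have "(- of_real (c / 4) * bdot (p - cconj (v + p)) (p - cconj (v + p)) - \<i> * of_real (lam / 2) * bdot (cconj (v + p)) (sympl p))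
       + of_real (- lam * (RE (v + p) \<bullet> sympl (IM (v + p))) - c * (norm (IM (v + p)))\<^sup>2)
       = l v + of_real (- (c / 2) * (norm v)\<^sup>2 - lam * (RE v \<bullet> sympl (IM v)))"
      unfolding l_def norm_cpt[of v]
      using inner_sympl_swap[of "IM v" "RE p"] inner_sympl_swap[of "IM p" "RE v"] inner_sympl_swap[of "IM v" "RE v"]
       inner_sympl_swap[of "IM p" "RE p"] inner_sympl_swap[of "RE v" "RE p"] inner_sympl_swap[of "IM v" "IM p"]
       inner_sympl_self[of "RE p"] inner_sympl_self[of "IM p"]
      by (simp add: complex_eq_iff Re_bdot Im_bdot power2_norm_eq_inner inner_add_left inner_add_right
        inner_diff_left inner_diff_right sympl_add inner_commute field_simps)
    then have "exp (- of_real (c / 4) * bdot (p - cconj (v + p)) (p - cconj (v + p)) - \<i> * of_real (lam / 2) * bdot (cconj (v + p)) (sympl p))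
       * of_real (exp (- lam * (RE (v + p) \<bullet> sympl (IM (v + p))) - c * (norm (IM (v + p)))\<^sup>2))
       = exp (l v) * of_real (\<omega> v)"
      unfolding \<omega>_def exp_of_real[symmetric] exp_add[symmetric] by simp
    then show ?thesis
      unfolding g_def hk_def Wtw_eq G_def A_def c_def[symmetric]
      by (simp add: power2_eq_square add.commute mult_ac)
  qed
  have "integrable lborel (\<lambda>v. g (v + p))" using int_g integral_lborel_translate(2)[OF gm] by simp
  then have "integrable lborel (\<lambda>v. of_real (1 / A) * (of_real A * (G v * of_real (\<omega> v))))"
    unfolding gG by (rule integrable_mult_right)
  moreover have A0: "A > 0" unfolding A_def using t by (intro mult_pos_pos zero_less_power nf_pos) auto
  ultimately have int: "integrable lborel (\<lambda>v. G v * of_real (\<omega> v))"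
    by simp
  have "integral\<^sup>L lborel g = integral\<^sup>L lborel (\<lambda>v. g (v + p))"
    by (rule integral_lborel_translate(1)[OF gm, symmetric])
  also have "\<dots> = of_real A * integral\<^sup>L lborel (\<lambda>v. G v * of_real (\<omega> v))" unfolding gG by simp
  also have "integral\<^sup>L lborel (\<lambda>v. G v * of_real (\<omega> v)) = G 0 * of_real (integral\<^sup>L lborel \<omega>)"
  proof (rule weighted_mean_value[OF _ _ _ _ int])
    show "continuous_on UNIV G" unfolding G_def l_def
      by (intro continuous_intros continuous_on_compose2[OF entire2n_continuous_on[OF ent]]) auto
    show "continuous_on UNIV \<omega>" unfolding \<omega>_def by (intro continuous_intros)
    show "(\<lambda>\<tau>. G (cscale \<tau> v)) holomorphic_on UNIV" for v
    proof -
      have "sympl (cscale \<tau> v) = cscale \<tau> (sympl v)" for \<tau>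
        by (simp add: sympl_def cscale_def vec_eq_iff)
      then have "(\<lambda>\<tau>. G (cscale \<tau> v)) = (\<lambda>\<tau>. F (p + cscale \<tau> v) * exp (of_real (c / 4) * (\<tau> * (\<tau> * bdot v v)) +
         of_real (c / 2) * (\<tau> * bdot v (p - cconj p)) + \<i> * of_real (lam / 2) * (\<tau> * bdot (cconj p) (sympl v))))"
        unfolding G_def l_def bdot_cscale_left by (simp only: bdot_cscale_right)
      then show ?thesis
        by (simp only:) (intro holomorphic_intros entire2n_holomorphic_on_line[OF ent])
    qed
    show "\<omega> (cscale u v) = \<omega> v" if u: "cmod u = 1" for u v
    proof -
      \<comment> \<open>This exhibits the twist in \<open>\<omega>\<close> as sesquilinear, so that
        a scalar \<open>u\<close> contributes only the factor |u|^2.\<close>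
      have *: "RE q \<bullet> sympl (IM q) = Im (bdot (cconj q) (sympl q)) / 2" for q :: "'n cpt"
        using inner_sympl_swap[of "IM q" "RE q"] by (simp add: Im_bdot)
      have "bdot (cconj (cscale u v)) (sympl (cscale u v)) = (cnj u * u) * bdot (cconj v) (sympl v)"
        by (simp add: bdot_def cdot_def cconj_def sympl_def cscale_def sum_distrib_left sum_negf algebra_simps)
      also have "cnj u * u = 1" using u by (metis complex_norm_square mult.commute of_real_1 one_power2)
      finally show ?thesis unfolding \<omega>_def * by (simp add: norm_cscale u)
    qed
  qed
  also have "G 0 = F p" by (simp add: G_def l_def bdot_def cdot_def sympl_def)
  also have "of_real A * (F p * of_real (integral\<^sup>L lborel \<omega>)) = F p * of_real (A * integral\<^sup>L lborel \<omega>)" by simp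
  also have "A * integral\<^sup>L lborel \<omega> = 1"
  proof -
    \<comment> \<open>By this identity the Gaussian volume from \<open>weight_norm\<close> cancels
      the normalising constants of kernel and weight exactly.\<close>
    have cs: "c\<^sup>2 - lam\<^sup>2 = (sf lam (2 * t))\<^sup>2" unfolding c_def using cf_square[of "2 * t" lam] t by simp
    have s: "sf lam (2 * t) > 0" using t by (intro sf_pos) auto
    have "A * integral\<^sup>L lborel \<omega> = (4 * (sf lam (2 * t) / (4 * pi))\<^sup>2 * (4 * pi\<^sup>2 / (c\<^sup>2 - lam\<^sup>2))) ^ CARD('n)"
      unfolding \<omega>_def weight_norm[OF c] A_def nf_def power_mult_distrib power_mult[symmetric] by (simp add: mult.commute)
    also have "4 * (sf lam (2 * t) / (4 * pi))\<^sup>2 * (4 * pi\<^sup>2 / (c\<^sup>2 - lam\<^sup>2)) = 1"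
      unfolding cs using s by (simp add: field_simps power2_eq_square)
    finally show ?thesis by simp
  qed
  finally show ?thesis using int_g by (simp add: has_bochner_integral_iff g_def)
qed

section \<open>Limits in the mean\<close>

text \<open>Fatou's lemma. An eventual bound is the form needed: distances to a fixed
  \<open>k\<close>-th function will be controlled only for indices beyond \<open>k\<close>.\<close>

lemma nn_integral_square_diff_le_lim:
  fixes g :: "nat \<Rightarrow> 'a \<Rightarrow> complex"
  assumes [measurable]: "\<And>k. g k \<in> borel_measurable M" "h \<in> borel_measurable M" "g' \<in> borel_measurable M"
    and lim: "AE x in M. (\<lambda>k. g k x) \<longlonglongrightarrow> g' x"
    and B: "eventually (\<lambda>k. (\<integral>\<^sup>+x. ennreal ((cmod (g k x - h x))\<^sup>2) \<partial>M) \<le> B) sequentially"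
  shows "(\<integral>\<^sup>+x. ennreal ((cmod (g' x - h x))\<^sup>2) \<partial>M) \<le> B"
proof -
  have "(\<integral>\<^sup>+x. ennreal ((cmod (g' x - h x))\<^sup>2) \<partial>M) = (\<integral>\<^sup>+x. liminf (\<lambda>k. ennreal ((cmod (g k x - h x))\<^sup>2)) \<partial>M)"
  proof (rule nn_integral_cong_AE)
    show "AE x in M. ennreal ((cmod (g' x - h x))\<^sup>2) = liminf (\<lambda>k. ennreal ((cmod (g k x - h x))\<^sup>2))"
      using lim
    proof eventually_elim
      fix x assume "(\<lambda>k. g k x) \<longlonglongrightarrow> g' x"
      then have "(\<lambda>k. ennreal ((cmod (g k x - h x))\<^sup>2)) \<longlonglongrightarrow> ennreal ((cmod (g' x - h x))\<^sup>2)"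
        by (intro tendsto_intros)
      then show "ennreal ((cmod (g' x - h x))\<^sup>2) = liminf (\<lambda>k. ennreal ((cmod (g k x - h x))\<^sup>2))"
        using lim_imp_Liminf[OF trivial_limit_sequentially] by metis
    qed
  qed
  also have "\<dots> \<le> liminf (\<lambda>k. \<integral>\<^sup>+x. ennreal ((cmod (g k x - h x))\<^sup>2) \<partial>M)"
    by (rule nn_integral_liminf) measurable
  also have "\<dots> \<le> liminf (\<lambda>k. B)"
    by (rule Liminf_mono[OF B])
  also have "\<dots> = B" by (simp add: Liminf_const)
  finally show ?thesis .
qed

text \<open>Splitting each term with weight 2^k by the arithmetic-geometric mean leaves a convergent
  geometric series.\<close>

lemma summable_of_weighted_squares:
  fixes \<Delta> :: "nat \<Rightarrow> complex"
  assumes "summable (\<lambda>k. 2 ^ k * (cmod (\<Delta> k))\<^sup>2)"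
  shows "summable \<Delta>"
proof (rule summable_comparison_test')
  show "summable (\<lambda>k. 2 ^ k * (cmod (\<Delta> k))\<^sup>2 + (1 / 2) ^ k)"
    by (intro summable_add assms summable_geometric) auto
  fix k :: nat
  have "norm (\<Delta> k) = (sqrt (2 ^ k) * cmod (\<Delta> k)) * (1 / sqrt (2 ^ k))" by simp
  also have "\<dots> \<le> (sqrt (2 ^ k) * cmod (\<Delta> k))\<^sup>2 + (1 / sqrt (2 ^ k))\<^sup>2" by (rule mult_le_sum_squares)
  also have "\<dots> = 2 ^ k * (cmod (\<Delta> k))\<^sup>2 + (1 / 2) ^ k" by (simp add: power_mult_distrib power_divide)
  finally show "norm (\<Delta> k) \<le> 2 ^ k * (cmod (\<Delta> k))\<^sup>2 + (1 / 2) ^ k" .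
qed

text \<open>Completeness of L^2 by almost everywhere convergence of a rapidly Cauchy subsequence and
  Fatou's lemma. The given modulus \<open>\<epsilon>\<close> is passed on to the limit, so that
  later estimates stay explicit in the cut-off index.\<close>

lemma L2_Cauchy_limit:
  fixes f :: "nat \<Rightarrow> 'a \<Rightarrow> complex" and \<epsilon> :: "nat \<Rightarrow> ennreal"
  assumes fm[measurable]: "\<And>k. f k \<in> borel_measurable M" and \<epsilon>: "\<epsilon> \<longlonglongrightarrow> 0"
    and C: "\<And>j k. k \<le> j \<Longrightarrow> (\<integral>\<^sup>+x. ennreal ((cmod (f j x - f k x))\<^sup>2) \<partial>M) \<le> \<epsilon> k"
  obtains g where "g \<in> borel_measurable M" "\<And>k. (\<integral>\<^sup>+x. ennreal ((cmod (g x - f k x))\<^sup>2) \<partial>M) \<le> \<epsilon> k"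
proof -
  have "\<exists>N. \<forall>m\<ge>N. \<epsilon> m < ennreal ((1/4)^k)" for k
    using order_tendstoD(2)[OF \<epsilon>, of "ennreal ((1/4)^k)"] by (auto simp: eventually_sequentially)
  then obtain N where N: "\<And>k m. N k \<le> m \<Longrightarrow> \<epsilon> m < ennreal ((1/4)^k)" by metis
  \<comment> \<open>\<open>\<epsilon>\<close> need not be monotone. Summing the thresholds and
    adding \<open>k\<close> makes \<open>\<sigma>\<close> monotone, at least \<open>N k\<close>, and
    at least \<open>k\<close>.\<close>
  define \<sigma> where "\<sigma> k = (\<Sum>i\<le>k. N i) + k" for k
  have \<sigma>N: "\<epsilon> (\<sigma> k) \<le> ennreal ((1/4)^k)" for k
    by (rule less_imp_le, rule N) (auto simp: \<sigma>_def intro: trans_le_add1 member_le_sum)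
  have \<sigma>k: "k \<le> \<sigma> k" and \<sigma>S: "\<sigma> k \<le> \<sigma> (Suc k)" for k by (simp_all add: \<sigma>_def)
  define \<Delta> where "\<Delta> k x = f (\<sigma> (Suc k)) x - f (\<sigma> k) x" for k x
  have [measurable]: "\<Delta> k \<in> borel_measurable M" for k unfolding \<Delta>_def by measurable
  have "(\<integral>\<^sup>+x. (\<Sum>k. ennreal (2 ^ k * (cmod (\<Delta> k x))\<^sup>2)) \<partial>M) = (\<Sum>k. \<integral>\<^sup>+x. ennreal (2 ^ k * (cmod (\<Delta> k x))\<^sup>2) \<partial>M)"
    by (rule nn_integral_suminf) measurable
  also have "\<dots> \<le> (\<Sum>k. ennreal ((1/2)^k))"
  proof (rule suminf_le)
    fix k
    have "(\<integral>\<^sup>+x. ennreal (2 ^ k * (cmod (\<Delta> k x))\<^sup>2) \<partial>M) = ennreal (2^k) * (\<integral>\<^sup>+x. ennreal ((cmod (\<Delta> k x))\<^sup>2) \<partial>M)"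
      by (simp add: ennreal_mult nn_integral_cmult)
    also have "\<dots> \<le> ennreal (2^k) * ennreal ((1/4)^k)"
      unfolding \<Delta>_def by (intro mult_left_mono order_trans[OF C[OF \<sigma>S] \<sigma>N]) auto
    also have "\<dots> = ennreal ((1/2)^k)"
      by (simp add: ennreal_mult[symmetric] power_mult_distrib[symmetric])
    finally show "(\<integral>\<^sup>+x. ennreal (2 ^ k * (cmod (\<Delta> k x))\<^sup>2) \<partial>M) \<le> ennreal ((1/2)^k)" .
  qed auto
  also have "\<dots> < \<infinity>"
  proof -
    have "(\<Sum>k. ennreal ((1/2)^k)) \<noteq> top"
      by (rule ennreal_suminf_neq_top) (auto intro: summable_geometric)
    then show ?thesis by (simp only: infinity_ennreal_def less_top)
  qed
  finally have "AE x in M. (\<Sum>k. ennreal (2 ^ k * (cmod (\<Delta> k x))\<^sup>2)) \<noteq> \<infinity>"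
    by (intro nn_integral_PInf_AE) auto
  then have conv: "AE x in M. (\<lambda>k. f (\<sigma> k) x) \<longlonglongrightarrow> lim (\<lambda>k. f (\<sigma> k) x)"
  proof eventually_elim
    fix x assume "(\<Sum>k. ennreal (2 ^ k * (cmod (\<Delta> k x))\<^sup>2)) \<noteq> \<infinity>"
    then have "summable (\<lambda>k. 2 ^ k * (cmod (\<Delta> k x))\<^sup>2)"
      by (intro summable_suminf_not_top) auto
    then have "summable (\<lambda>k. \<Delta> k x)" by (rule summable_of_weighted_squares)
    then have "convergent (\<lambda>n. (\<Sum>k<n. \<Delta> k x) + f (\<sigma> 0) x)"
      unfolding summable_iff_convergent convergent_add_const_right_iff .
    also have "(\<lambda>n. (\<Sum>k<n. \<Delta> k x) + f (\<sigma> 0) x) = (\<lambda>n. f (\<sigma> n) x)"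
      unfolding \<Delta>_def sum_lessThan_telescope[of "\<lambda>k. f (\<sigma> k) x"] by simp
    finally show "(\<lambda>k. f (\<sigma> k) x) \<longlonglongrightarrow> lim (\<lambda>k. f (\<sigma> k) x)" by (simp add: convergent_LIMSEQ_iff)
  qed
  have gm[measurable]: "(\<lambda>x. lim (\<lambda>k. f (\<sigma> k) x)) \<in> borel_measurable M" by measurable
  have "(\<integral>\<^sup>+x. ennreal ((cmod (lim (\<lambda>k. f (\<sigma> k) x) - f k x))\<^sup>2) \<partial>M) \<le> \<epsilon> k" for k
  proof (rule nn_integral_square_diff_le_lim[OF _ _ _ conv])
    show "eventually (\<lambda>j. (\<integral>\<^sup>+x. ennreal ((cmod (f (\<sigma> j) x - f k x))\<^sup>2) \<partial>M) \<le> \<epsilon> k) sequentially"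
      using eventually_ge_at_top[of k] by eventually_elim (intro C order_trans[OF _ \<sigma>k])
  qed measurable
  then show ?thesis by (rule that[OF gm])
qed

lemma integrable_L2_mult:
  fixes f h :: "'a \<Rightarrow> complex"
  assumes [measurable]: "f \<in> borel_measurable M" "h \<in> borel_measurable M"
    and f: "(\<integral>\<^sup>+x. ennreal ((cmod (f x))\<^sup>2) \<partial>M) < \<infinity>" and h: "(\<integral>\<^sup>+x. ennreal ((cmod (h x))\<^sup>2) \<partial>M) < \<infinity>"
  shows "integrable M (\<lambda>x. f x * h x)"
proof (rule Bochner_Integration.integrable_bound)
  show "integrable M (\<lambda>x. (cmod (f x))\<^sup>2 + (cmod (h x))\<^sup>2)"
    using f h by (intro Bochner_Integration.integrable_add integrableI_bounded) auto
  show "AE x in M. norm (f x * h x) \<le> norm ((cmod (f x))\<^sup>2 + (cmod (h x))\<^sup>2)"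
    using mult_le_sum_squares by (auto simp: norm_mult)
qed measurable

text \<open>Continuity of the pairing with \<open>h\<close> by Cauchy-Schwarz; finiteness of the
  norm of \<open>h\<close> keeps the product with \<open>\<epsilon>\<close> convergent to 0 in
  \<open>ennreal\<close>.\<close>

lemma L2_pairing_tendsto:
  fixes f h :: "'a \<Rightarrow> complex"
  assumes [measurable]: "f \<in> borel_measurable M" "h \<in> borel_measurable M" "\<And>k. g k \<in> borel_measurable M"
    and h: "(\<integral>\<^sup>+x. ennreal ((cmod (h x))\<^sup>2) \<partial>M) < \<infinity>"
    and int: "integrable M (\<lambda>x. f x * h x)" "\<And>k. integrable M (\<lambda>x. g k x * h x)"
    and \<epsilon>: "\<epsilon> \<longlonglongrightarrow> 0" and le: "\<And>k. (\<integral>\<^sup>+x. ennreal ((cmod (f x - g k x))\<^sup>2) \<partial>M) \<le> \<epsilon> k"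
  shows "(\<lambda>k. integral\<^sup>L M (\<lambda>x. g k x * h x)) \<longlonglongrightarrow> integral\<^sup>L M (\<lambda>x. f x * h x)"
proof -
  define H where "H = (\<integral>\<^sup>+x. ennreal ((cmod (h x))\<^sup>2) \<partial>M)"
  define e where "e k = cmod (integral\<^sup>L M (\<lambda>x. f x * h x) - integral\<^sup>L M (\<lambda>x. g k x * h x))" for k
  have "ennreal ((e k)\<^sup>2) \<le> \<epsilon> k * H" for k
  proof -
    have "ennreal (e k) = ennreal (norm (integral\<^sup>L M (\<lambda>x. f x * h x - g k x * h x)))"
      by (simp add: e_def int)
    also have "\<dots> \<le> (\<integral>\<^sup>+x. norm (f x * h x - g k x * h x) \<partial>M)"
      by (intro integral_norm_bound_ennreal Bochner_Integration.integrable_diff int)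
    also have "\<dots> = (\<integral>\<^sup>+x. ennreal (cmod (f x - g k x)) * ennreal (cmod (h x)) \<partial>M)"
      by (simp add: left_diff_distrib[symmetric] norm_mult ennreal_mult)
    finally have "ennreal (e k) \<le> (\<integral>\<^sup>+x. ennreal (cmod (f x - g k x)) * ennreal (cmod (h x)) \<partial>M)" .
    then have "(ennreal (e k))\<^sup>2 \<le> (\<integral>\<^sup>+x. ennreal (cmod (f x - g k x)) * ennreal (cmod (h x)) \<partial>M)\<^sup>2"
      by (intro power_mono) auto
    also have "\<dots> \<le> (\<integral>\<^sup>+x. (ennreal (cmod (f x - g k x)))\<^sup>2 \<partial>M) * (\<integral>\<^sup>+x. (ennreal (cmod (h x)))\<^sup>2 \<partial>M)"
      by (rule Cauchy_Schwarz_nn_integral) measurable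
    also have "\<dots> \<le> \<epsilon> k * H"
      using le[of k] by (auto simp: ennreal_power H_def intro: mult_right_mono)
    finally show ?thesis by (simp add: ennreal_power e_def)
  qed
  note le_H = this
  have "(\<lambda>k. H * \<epsilon> k) \<longlonglongrightarrow> H * 0"
    using h by (intro ennreal_tendsto_cmult \<epsilon>) (simp add: H_def)
  then have up: "(\<lambda>k. \<epsilon> k * H) \<longlonglongrightarrow> ennreal 0" by (simp add: mult.commute)
  have "(\<lambda>k. ennreal ((e k)\<^sup>2)) \<longlonglongrightarrow> ennreal 0"
    by (rule tendsto_sandwich[OF always_eventually always_eventually tendsto_const up]) (simp, simp add: le_H)
  then have "(\<lambda>k. (e k)\<^sup>2) \<longlonglongrightarrow> 0" by (subst (asm) tendsto_ennreal_iff) auto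
  then have "(\<lambda>k. sqrt ((e k)\<^sup>2)) \<longlonglongrightarrow> sqrt 0" by (rule tendsto_real_sqrt)
  then have "(\<lambda>k. norm (integral\<^sup>L M (\<lambda>x. g k x * h x) - integral\<^sup>L M (\<lambda>x. f x * h x))) \<longlonglongrightarrow> 0"
    by (simp add: e_def norm_minus_commute)
  then show ?thesis using LIM_zero_cancel tendsto_norm_zero_iff by blast
qed

section \<open>The adjoint transform\<close>

text \<open>Two times occur: \<open>t\<close> in the weight and \<open>r\<close> in the kernel. For
  \<open>r = t\<close> this is formally the adjoint of the transform, and for
  \<open>r = t + s\<close> it is \<open>F\<^sub>s\<close>.\<close>

definition adj :: "real \<Rightarrow> real \<Rightarrow> real \<Rightarrow> ('n::finite cpt \<Rightarrow> complex) \<Rightarrow> 'n rpt \<Rightarrow> complex" where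
  "adj lam t r G x = integral\<^sup>L lborel (\<lambda>p. G p * cnj (hk lam r p (emb x)) * of_real (Wtw lam t p))"

text \<open>Bounded functions of bounded support, on which the adjoint integral converges also at
  the borderline \<open>r = t\<close>.\<close>

definition bsupp :: "('n::finite cpt \<Rightarrow> complex) \<Rightarrow> bool" where
  "bsupp G \<longleftrightarrow> G \<in> borel_measurable borel \<and> (\<exists>R M. \<forall>p. cmod (G p) \<le> M * indicator (cball 0 R) p)"

lemma measurable_cnj [measurable]: "cnj \<in> borel_measurable borel"
  by (intro borel_measurable_continuous_onI continuous_intros)

text \<open>The majorant is the same for all \<open>r\<close> between \<open>t\<close> and
  \<open>r1\<close>, as dominated convergence for \<open>r\<close> tending to \<open>t\<close>
  requires. \<open>a\<close> and \<open>b\<close> are the smallest and the largest rate on this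
  interval.\<close>

lemma hk_local_bound:
  fixes R :: real
  assumes t: "t > 0" "lam \<noteq> 0" and r1: "t \<le> r1" and R: "R \<ge> 0"
  obtains C \<delta> where "C \<ge> 0" "\<delta> > 0"
    "\<And>r (p::'n::finite cpt) x. t \<le> r \<Longrightarrow> r \<le> r1 \<Longrightarrow> norm p \<le> R \<Longrightarrow> cmod (hk lam r p (emb x)) \<le> C * exp (- (\<delta> * (norm x)\<^sup>2))"
proof -
  define a where "a = cf lam r1" define b where "b = cf lam t"
  have a: "a > 0" unfolding a_def using t r1 by (intro cf_pos) auto
  have N: "nf TYPE('n) lam t > 0" by (rule nf_pos[OF t])
  \<comment> \<open>Of the decay a/8 in |x|^2 that survives moving from X to the origin, the twist
    consumes a/16. \<open>K\<close> bounds the remaining terms, which involve only |p| and hence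
    \<open>R\<close>.\<close>
  define K where "K = b * R\<^sup>2 / 2 + lam\<^sup>2 * R\<^sup>2 / a"
  have main: "cmod (hk lam r p (emb x)) \<le> (nf TYPE('n) lam t * exp K) * exp (- (a / 16 * (norm x)\<^sup>2))"
    if r: "t \<le> r" "r \<le> r1" and p: "norm p \<le> R" for r x and p :: "'n cpt"
  proof -
    define c where "c = cf lam r"
    define X where "X = RE p" define Y where "Y = IM p"
    have r0: "r > 0" using t r by simp
    have ca: "a \<le> c" unfolding a_def c_def using r r0 t by (intro cf_antimono) auto
    have cb: "c \<le> b" unfolding b_def c_def using r t by (intro cf_antimono) auto
    have c0: "c > 0" using a ca by simp
    have np: "(norm X)\<^sup>2 + (norm Y)\<^sup>2 \<le> R\<^sup>2"
      unfolding X_def Y_def norm_cpt[symmetric] using p by (intro power_mono) auto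
    have Xx: "(norm (X - x))\<^sup>2 \<ge> (norm x)\<^sup>2 / 2 - (norm X)\<^sup>2"
    proof -
      have "(norm x)\<^sup>2 \<le> (norm (X - x) + norm X)\<^sup>2"
        using norm_triangle_ineq4[of X "X - x"] by (intro power_mono) (auto simp: add.commute)
      also have "\<dots> \<le> 2 * (norm (X - x))\<^sup>2 + 2 * (norm X)\<^sup>2"
        using sum_squares_bound[of "norm (X - x)" "norm X"] by (simp add: power2_sum)
      finally show ?thesis by simp
    qed
    have "\<bar>x \<bullet> sympl Y\<bar> \<le> norm x * norm Y" using Cauchy_Schwarz_ineq2[of x "sympl Y"] by (simp add: norm_sympl)
    then have "\<bar>lam * (x \<bullet> sympl Y)\<bar> \<le> \<bar>lam\<bar> * (norm x * norm Y)"
      unfolding abs_mult by (intro mult_left_mono) auto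
    also have "\<dots> \<le> a / 8 * (norm x)\<^sup>2 + 2 * (lam\<^sup>2 * (norm Y)\<^sup>2 / a)"
    proof -
      have "0 \<le> (a * norm x - 4 * \<bar>lam\<bar> * norm Y)\<^sup>2" by simp
      also have "\<dots> = 8 * a * (a / 8 * (norm x)\<^sup>2 + 2 * (lam\<^sup>2 * (norm Y)\<^sup>2 / a) - \<bar>lam\<bar> * (norm x * norm Y))"
        using a by (simp add: power2_eq_square field_simps abs_mult_self_eq)
      finally show ?thesis using a by (simp add: zero_le_mult_iff)
    qed
    also have "\<dots> \<le> a / 8 * (norm x)\<^sup>2 + 2 * (lam\<^sup>2 * R\<^sup>2 / a)"
    proof -
      have "(norm Y)\<^sup>2 \<le> R\<^sup>2" using np zero_le_power2[of "norm X"] by linarith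
      then show ?thesis using a by (auto intro!: divide_right_mono mult_left_mono)
    qed
    finally have L: "lam / 2 * (x \<bullet> sympl Y) \<le> a / 16 * (norm x)\<^sup>2 + lam\<^sup>2 * R\<^sup>2 / a" by simp
    have "- (c / 4) * ((norm (X - x))\<^sup>2 - (norm Y)\<^sup>2) \<le> - (c / 4) * ((norm x)\<^sup>2 / 2 - (norm X)\<^sup>2 - (norm Y)\<^sup>2)"
      using Xx c0 by (intro mult_left_mono_neg) auto
    also have "\<dots> = - (c / 8) * (norm x)\<^sup>2 + c / 4 * ((norm X)\<^sup>2 + (norm Y)\<^sup>2)" by (simp add: algebra_simps)
    also have "\<dots> \<le> - (a / 8) * (norm x)\<^sup>2 + b / 2 * R\<^sup>2"
    proof (rule add_mono)
      show "- (c / 8) * (norm x)\<^sup>2 \<le> - (a / 8) * (norm x)\<^sup>2" using ca by (intro mult_right_mono) auto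
      show "c / 4 * ((norm X)\<^sup>2 + (norm Y)\<^sup>2) \<le> b / 2 * R\<^sup>2"
        using np cb c0 by (intro mult_mono) auto
    qed
    finally have Q: "- (c / 4) * ((norm (X - x))\<^sup>2 - (norm Y)\<^sup>2) \<le> - (a / 8) * (norm x)\<^sup>2 + b / 2 * R\<^sup>2" .
    have "cmod (hk lam r p (emb x)) = nf TYPE('n) lam r *
       exp (- (c / 4) * ((norm (X - x))\<^sup>2 - (norm Y)\<^sup>2) + lam / 2 * (x \<bullet> sympl Y))"
      unfolding cmod_hk[OF r0 t(2)] by (simp add: X_def Y_def c_def)
    also have "\<dots> \<le> nf TYPE('n) lam t * exp (K + - (a / 16 * (norm x)\<^sup>2))"
    proof (intro mult_mono)
      show "nf TYPE('n) lam r \<le> nf TYPE('n) lam t" using r t by (intro nf_antimono) auto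
      show "exp (- (c / 4) * ((norm (X - x))\<^sup>2 - (norm Y)\<^sup>2) + lam / 2 * (x \<bullet> sympl Y)) \<le> exp (K + - (a / 16 * (norm x)\<^sup>2))"
        unfolding K_def using L Q by (subst exp_le_cancel_iff) linarith
    qed (use N in auto)
    finally show ?thesis unfolding exp_add mult.assoc .
  qed
  show ?thesis by (rule that[of "nf TYPE('n) lam t * exp K" "a / 16"]) (use main a N in auto)
qed

text \<open>The Gaussian factor in \<open>p\<close> is artificial: on the support of
  \<open>G\<close> it is bounded below, at the price of a constant exp(R'^2). It makes the majorant
  a product of Gaussians, so that Fubini's theorem and dominated convergence apply directly.\<close>

lemma adj_integrand_bound:
  fixes G :: "'n::finite cpt \<Rightarrow> complex"
  assumes t: "t > 0" "lam \<noteq> 0" and r1: "t \<le> r1" and G: "bsupp G"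
  obtains C \<delta> where "C \<ge> 0" "\<delta> > 0"
    "\<And>r p x. t \<le> r \<Longrightarrow> r \<le> r1 \<Longrightarrow> cmod (G p * cnj (hk lam r p (emb x)) * of_real (Wtw lam t p))
        \<le> C * exp (- (norm p)\<^sup>2) * exp (- (\<delta> * (norm x)\<^sup>2))"
proof -
  obtain R M where RM: "\<And>p. cmod (G p) \<le> M * indicator (cball 0 R) p" using G by (auto simp: bsupp_def)
  \<comment> \<open>The bounds supplied by \<open>bsupp\<close> may be negative.\<close>
  define R' where "R' = max R 0" define M' where "M' = max M 0"
  have RM': "cmod (G p) \<le> M' * indicator (cball 0 R') p" for p
    by (rule order_trans[OF RM]) (auto simp: R'_def M'_def indicator_def)
  obtain C1 \<delta> where C1: "C1 \<ge> 0" "\<delta> > 0" and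
    hb: "\<And>r (p::'n cpt) x. t \<le> r \<Longrightarrow> r \<le> r1 \<Longrightarrow> norm p \<le> R' \<Longrightarrow> cmod (hk lam r p (emb x)) \<le> C1 * exp (- (\<delta> * (norm x)\<^sup>2))"
    using hk_local_bound[OF t r1, of R'] by (auto simp: R'_def)
  have "compact (Wtw lam t ` cball (0::'n cpt) R')"
    by (intro compact_continuous_image continuous_intros) auto
  then obtain V where V: "\<And>p::'n cpt. norm p \<le> R' \<Longrightarrow> Wtw lam t p \<le> V"
    by (meson bounded_imp_bdd_above compact_imp_bounded bdd_above_def image_eqI mem_cball_0)
  define V' where "V' = max V 0"
  have main: "cmod (G p * cnj (hk lam r p (emb x)) * of_real (Wtw lam t p))
        \<le> (M' * C1 * V' * exp (R'\<^sup>2)) * exp (- (norm p)\<^sup>2) * exp (- (\<delta> * (norm x)\<^sup>2))"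
    if r: "t \<le> r" "r \<le> r1" for r p x
  proof (cases "norm p \<le> R'")
    case False
    then have "G p = 0" using RM'[of p] by simp
    then show ?thesis using C1 by (simp add: M'_def V'_def)
  next
    case True
    have "cmod (G p) \<le> M'" using RM'[of p] True by (simp add: indicator_def)
    moreover have "Wtw lam t p \<le> V'" using V[OF True] by (simp add: V'_def)
    ultimately have "cmod (G p) * cmod (hk lam r p (emb x)) * Wtw lam t p \<le> M' * (C1 * exp (- (\<delta> * (norm x)\<^sup>2))) * V'"
      using hb[OF r True, of x] C1 Wtw_pos[OF t, of p] by (intro mult_mono) (auto simp: M'_def)
    moreover have "(1::real) \<le> exp (R'\<^sup>2) * exp (- (norm p)\<^sup>2)"
      unfolding exp_add[symmetric] using True by (simp add: power_mono)
    then have "M' * (C1 * exp (- (\<delta> * (norm x)\<^sup>2))) * V' * 1 \<le> M' * (C1 * exp (- (\<delta> * (norm x)\<^sup>2))) * V' * (exp (R'\<^sup>2) * exp (- (norm p)\<^sup>2))"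
      using C1 by (intro mult_left_mono) (auto simp: M'_def V'_def)
    ultimately show ?thesis using Wtw_pos[OF t, of p] by (simp add: norm_mult mult_ac)
  qed
  show ?thesis by (rule that[OF _ C1(2) main]) (use C1 in \<open>auto simp: M'_def V'_def\<close>)
qed

lemma adj_integrable:
  assumes t: "t > 0" "lam \<noteq> 0" and r: "t \<le> r" and G: "bsupp G"
  shows "integrable lborel (\<lambda>p. G p * cnj (hk lam r p (emb x)) * of_real (Wtw lam t p))"
proof -
  have [measurable]: "G \<in> borel_measurable borel" using G by (simp add: bsupp_def)
  obtain C \<delta> where C: "\<And>p x. cmod (G p * cnj (hk lam r p (emb x)) * of_real (Wtw lam t p))
        \<le> C * exp (- (norm p)\<^sup>2) * exp (- (\<delta> * (norm x)\<^sup>2))"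
    using adj_integrand_bound[OF t r G] r by (metis order_refl)
  have "integrable lborel (\<lambda>p::'a cpt. C * exp (- (1 * (norm p)\<^sup>2)) * exp (- (\<delta> * (norm x)\<^sup>2)))"
    by (intro integrable_mult_left integrable_mult_right integrable_gaussian) auto
  then show ?thesis
    by (rule Bochner_Integration.integrable_bound) (use C[of _ x] in \<open>auto intro!: AE_I2 order_trans[OF C abs_ge_self]\<close>)
qed

lemma adj_measurable [measurable]:
  assumes [measurable]: "G \<in> borel_measurable borel"
  shows "adj lam t r G \<in> borel_measurable borel"
  unfolding adj_def[abs_def] by (intro lborel.borel_measurable_lebesgue_integral) measurable

text \<open>Integrating the product majorant over \<open>p\<close> leaves a Gaussian in
  \<open>x\<close>, again uniform in \<open>r\<close>; it dominates the L^2 integrals when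
  \<open>r\<close> tends to \<open>t\<close>.\<close>

lemma adj_gaussian_bound:
  fixes G :: "'n::finite cpt \<Rightarrow> complex"
  assumes t: "t > 0" "lam \<noteq> 0" and r1: "t \<le> r1" and G: "bsupp G"
  obtains C \<delta> where "C \<ge> 0" "\<delta> > 0" "\<And>r x. t \<le> r \<Longrightarrow> r \<le> r1 \<Longrightarrow> cmod (adj lam t r G x) \<le> C * exp (- (\<delta> * (norm x)\<^sup>2))"
proof -
  obtain C \<delta> where C: "C \<ge> 0" "\<delta> > 0" and
    b: "\<And>r p x. t \<le> r \<Longrightarrow> r \<le> r1 \<Longrightarrow> cmod (G p * cnj (hk lam r p (emb x)) * of_real (Wtw lam t p))
        \<le> C * exp (- (norm p)\<^sup>2) * exp (- (\<delta> * (norm x)\<^sup>2))"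
    using adj_integrand_bound[OF t r1 G] by blast
  have g: "integrable lborel (\<lambda>p::'n cpt. exp (- (norm p)\<^sup>2))"
    using integrable_gaussian[of 1, where 'a="'n cpt"] by simp
  define \<Gamma> where "\<Gamma> = integral\<^sup>L lborel (\<lambda>p::'n cpt. exp (- (norm p)\<^sup>2))"
  have \<Gamma>: "\<Gamma> \<ge> 0" by (simp add: \<Gamma>_def)
  have "cmod (adj lam t r G x) \<le> (C * \<Gamma>) * exp (- (\<delta> * (norm x)\<^sup>2))" if r: "t \<le> r" "r \<le> r1" for r x
  proof -
    have "cmod (adj lam t r G x) \<le> integral\<^sup>L lborel (\<lambda>p::'n cpt. C * exp (- (norm p)\<^sup>2) * exp (- (\<delta> * (norm x)\<^sup>2)))"
      unfolding adj_def
      by (intro Bochner_Integration.integral_norm_bound_integral adj_integrable[OF t r(1) G] integrable_mult_left integrable_mult_right g b r)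
    also have "\<dots> = (C * \<Gamma>) * exp (- (\<delta> * (norm x)\<^sup>2))" by (simp add: \<Gamma>_def)
    finally show ?thesis .
  qed
  then show ?thesis using C \<Gamma> by (intro that[of "C * \<Gamma>" \<delta>]) auto
qed

text \<open>By the semigroup law the squared norm of \<open>adj\<close> is the quadratic form of the reproducing kernel, which is
  bounded by Schur's test.\<close>

lemma adj_L2_bound:
  assumes t: "t > 0" "lam \<noteq> 0" and r1: "t \<le> r1"
  obtains B where "B < \<infinity>"
    "\<And>(G :: 'n::finite cpt \<Rightarrow> complex) r. bsupp G \<Longrightarrow> t \<le> r \<Longrightarrow> r \<le> r1 \<Longrightarrow>
      (\<integral>\<^sup>+x. ennreal ((cmod (adj lam t r G x))\<^sup>2) \<partial>lborel) \<le> B * (\<integral>\<^sup>+p. ennreal ((cmod (G p))\<^sup>2 * Wtw lam t p) \<partial>lborel)"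
proof -
  define A where "A = 4 ^ CARD('n) * (nf TYPE('n) lam (2 * t))\<^sup>2"
  \<comment> \<open>\<open>cf\<close> decreases in time, so the rate at \<open>2 * r1\<close> is the
    smallest one and a single convolution kernel \<open>k\<close> serves every \<open>r\<close> up
    to \<open>r1\<close>.\<close>
  define d where "d = (cf lam (2 * r1) - \<bar>lam\<bar>) / 4"
  have d: "d > 0" unfolding d_def using cf_gt[of "2 * r1" lam] t r1 by simp
  have A: "A > 0" unfolding A_def using t by (intro mult_pos_pos zero_less_power nf_pos) auto
  define k where "k = (\<lambda>v::'n cpt. ennreal (A * exp (- (d * (norm v)\<^sup>2))))"
  have km[measurable]: "k \<in> borel_measurable borel" unfolding k_def by measurable
  define B where "B = (\<integral>\<^sup>+v. k v \<partial>lborel)"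
  have B: "B < \<infinity>"
    unfolding B_def k_def using gaussian_nn_integral_finite[OF d, where 'a="'n cpt"] A
    by (simp add: ennreal_mult nn_integral_cmult ennreal_mult_less_top)
  have main: "(\<integral>\<^sup>+x. ennreal ((cmod (adj lam t r G x))\<^sup>2) \<partial>lborel) \<le> (B + B) * (\<integral>\<^sup>+p. ennreal ((cmod (G p))\<^sup>2 * Wtw lam t p) \<partial>lborel)"
    if G: "bsupp G" and r: "t \<le> r" "r \<le> r1" for G :: "'n cpt \<Rightarrow> complex" and r
  proof -
    have Gm[measurable]: "G \<in> borel_measurable borel" using G by (simp add: bsupp_def)
    have r0: "r > 0" using t r by simp
    define a where "a = (\<lambda>x p. G p * cnj (hk lam r p (emb x)) * of_real (Wtw lam t p))"
    have am[measurable]: "case_prod a \<in> borel_measurable (borel \<Otimes>\<^sub>M borel)" unfolding a_def by measurable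
    \<comment> \<open>Squaring the integral doubles the variable \<open>p\<close>. With absolute
      integrability in all three variables the integral over \<open>x\<close> can be carried out
      first.\<close>
    define \<Psi> where "\<Psi> = (\<lambda>x pq. a x (fst pq) * cnj (a x (snd pq)))"
    have \<Psi>m[measurable]: "case_prod \<Psi> \<in> borel_measurable (borel \<Otimes>\<^sub>M (borel \<Otimes>\<^sub>M borel))"
      unfolding \<Psi>_def a_def case_prod_unfold by measurable
    obtain C \<delta> where C: "C \<ge> 0" "\<delta> > 0" and b: "\<And>p x. cmod (a x p) \<le> C * exp (- (norm p)\<^sup>2) * exp (- (\<delta> * (norm x)\<^sup>2))"
      using adj_integrand_bound[OF t r1 G] r unfolding a_def by metis
    \<comment> \<open>The common rate \<open>m\<close> bounds everything by one Gaussian of the norm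
      on the product space.\<close>
    define m where "m = min 1 \<delta>"
    have m: "m > 0" "m \<le> 1" "m \<le> \<delta>" using C by (auto simp: m_def)
    have b\<Psi>: "cmod (\<Psi> x (p, q)) \<le> C\<^sup>2 * exp (- (m * ((norm x)\<^sup>2 + (norm p)\<^sup>2 + (norm q)\<^sup>2)))" for x p q
    proof -
      have "cmod (\<Psi> x (p, q)) \<le> (C * exp (- (norm p)\<^sup>2) * exp (- (\<delta> * (norm x)\<^sup>2))) * (C * exp (- (norm q)\<^sup>2) * exp (- (\<delta> * (norm x)\<^sup>2)))"
        unfolding \<Psi>_def norm_mult using b[of x p] b[of x q] C by (auto intro!: mult_mono)
      also have "\<dots> = C\<^sup>2 * exp (- ((norm p)\<^sup>2 + (norm q)\<^sup>2 + 2 * (\<delta> * (norm x)\<^sup>2)))"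
        unfolding minus_add_distrib exp_add mult_2 by (simp add: power2_eq_square mult_ac)
      also have "\<dots> \<le> C\<^sup>2 * exp (- (m * ((norm x)\<^sup>2 + (norm p)\<^sup>2 + (norm q)\<^sup>2)))"
      proof -
        have "m * (norm x)\<^sup>2 \<le> \<delta> * (norm x)\<^sup>2" "m * (norm p)\<^sup>2 \<le> (norm p)\<^sup>2" "m * (norm q)\<^sup>2 \<le> (norm q)\<^sup>2" "0 \<le> \<delta> * (norm x)\<^sup>2"
          using m by (auto intro!: mult_right_mono mult_left_le_one_le)
        then have "m * ((norm x)\<^sup>2 + (norm p)\<^sup>2 + (norm q)\<^sup>2) \<le> (norm p)\<^sup>2 + (norm q)\<^sup>2 + 2 * (\<delta> * (norm x)\<^sup>2)"
          by (simp add: distrib_left)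
        then show ?thesis by (intro mult_left_mono) auto
      qed
      finally show ?thesis .
    qed
    have int\<Psi>: "integrable (lborel \<Otimes>\<^sub>M lborel) (case_prod \<Psi>)"
    proof -
      have i1: "integrable lborel (\<lambda>z :: 'n rpt \<times> 'n cpt \<times> 'n cpt. C\<^sup>2 * exp (- (m * (norm z)\<^sup>2)))"
        by (intro integrable_mult_right integrable_gaussian m)
      have i2: "case_prod \<Psi> \<in> borel_measurable lborel" using \<Psi>m unfolding borel_prod by simp
      have i3: "norm (case_prod \<Psi> z) \<le> norm (C\<^sup>2 * exp (- (m * (norm z)\<^sup>2)))" for z
      proof -
        obtain x p q where z: "z = (x, p, q)" by (cases z)
        have "(norm z)\<^sup>2 = (norm x)\<^sup>2 + (norm p)\<^sup>2 + (norm q)\<^sup>2" by (simp add: z norm_Pair)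
        then show ?thesis using b\<Psi>[of x p q] by (simp add: z)
      qed
      have "integrable lborel (case_prod \<Psi>)"
        by (rule Bochner_Integration.integrable_bound[OF i1 i2]) (rule AE_I2, rule i3)
      then show ?thesis by (simp add: lborel_prod)
    qed
    have int\<Psi>x: "integrable (lborel \<Otimes>\<^sub>M lborel) (\<Psi> x)" for x
    proof -
      have [measurable]: "\<Psi> x \<in> borel_measurable (borel \<Otimes>\<^sub>M borel)" using measurable_compose[OF measurable_Pair1' \<Psi>m, of x] by simp
      have "integrable lborel (\<lambda>z :: 'n cpt \<times> 'n cpt. (C\<^sup>2 * exp (- (m * (norm x)\<^sup>2))) * exp (- (m * (norm z)\<^sup>2)))"
        by (intro integrable_mult_right integrable_gaussian m)
      then have "integrable lborel (\<Psi> x)"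
      proof (rule Bochner_Integration.integrable_bound)
        have "\<Psi> x \<in> borel_measurable (borel \<Otimes>\<^sub>M borel)" by measurable
        then show "\<Psi> x \<in> borel_measurable lborel" unfolding borel_prod by simp
        show "AE z in lborel. norm (\<Psi> x z) \<le> norm ((C\<^sup>2 * exp (- (m * (norm x)\<^sup>2))) * exp (- (m * (norm z)\<^sup>2)))"
        proof (rule AE_I2)
          fix z :: "'n cpt \<times> 'n cpt"
          have "exp (- (m * (norm x)\<^sup>2)) * exp (- (m * (norm z)\<^sup>2)) = exp (- (m * ((norm x)\<^sup>2 + (norm (fst z))\<^sup>2 + (norm (snd z))\<^sup>2)))"
            by (cases z) (simp add: norm_Pair distrib_left exp_add[symmetric])
          then show "norm (\<Psi> x z) \<le> norm ((C\<^sup>2 * exp (- (m * (norm x)\<^sup>2))) * exp (- (m * (norm z)\<^sup>2)))"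
            using b\<Psi>[of x "fst z" "snd z"] by (simp add: mult.assoc)
        qed
      qed
      then show ?thesis by (simp add: lborel_prod)
    qed
    have adj: "adj lam t r G x * cnj (adj lam t r G x) = (\<integral>pq. \<Psi> x pq \<partial>(lborel \<Otimes>\<^sub>M lborel))" for x
    proof -
      have "(\<integral>pq. \<Psi> x pq \<partial>(lborel \<Otimes>\<^sub>M lborel)) = (\<integral>p. (\<integral>q. \<Psi> x (p, q) \<partial>lborel) \<partial>lborel)"
        by (rule lborel_pair.integral_fst'[OF int\<Psi>x, symmetric])
      also have "\<dots> = adj lam t r G x * cnj (adj lam t r G x)"
        by (simp add: \<Psi>_def adj_def a_def del: complex_cnj_mult)
      finally show ?thesis by simp
    qed
    have inner: "(\<integral>x. \<Psi> x pq \<partial>lborel) = (G (fst pq) * Wtw lam t (fst pq)) * cnj (G (snd pq) * Wtw lam t (snd pq))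
       * hk lam (2 * r) (snd pq) (cconj (fst pq))" for pq
    proof -
      have "\<Psi> x pq = (G (fst pq) * Wtw lam t (fst pq)) * cnj (G (snd pq) * Wtw lam t (snd pq))
        * (hk lam r (snd pq) (emb x) * cnj (hk lam r (fst pq) (emb x)))" for x
        by (simp add: \<Psi>_def a_def mult_ac)
      then show ?thesis
        using hk_semigroup[OF r0 t(2), of "snd pq" "fst pq"] by (simp add: has_bochner_integral_iff)
    qed
    define U where "U = (\<lambda>p. ennreal ((cmod (G p))\<^sup>2 * Wtw lam t p))"
    have Um[measurable]: "U \<in> borel_measurable borel" unfolding U_def by measurable
    \<comment> \<open>The pointwise form of Schur's test: with a symmetric convolution kernel, u v
      is bounded by u^2 + v^2 and each square is integrated against \<open>k\<close> alone. The two
      squares account for the constant \<open>B + B\<close>.\<close>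
    have inner_le: "ennreal (norm (\<integral>x. \<Psi> x pq \<partial>lborel)) \<le> k (fst pq - snd pq) * U (fst pq) + k (fst pq - snd pq) * U (snd pq)" for pq
    proof -
      obtain p q where pq: "pq = (p, q)" by (cases pq)
      have W: "Wtw lam t p > 0" "Wtw lam t q > 0" by (rule Wtw_pos[OF t])+
      define u where "u = cmod (G p) * sqrt (Wtw lam t p)" define v where "v = cmod (G q) * sqrt (Wtw lam t q)"
      have uv: "u \<ge> 0" "v \<ge> 0" using W by (auto simp: u_def v_def)
      define h where "h = cmod (hk lam (2 * r) q (cconj p)) * sqrt (Wtw lam t q) * sqrt (Wtw lam t p)"
      have "h \<le> A * exp (- ((cf lam (2 * r) - \<bar>lam\<bar>) / 4 * (norm (q - p))\<^sup>2))"
        unfolding h_def A_def using r by (intro hk_weighted_bound[OF t]) auto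
      also have "\<dots> \<le> A * exp (- (d * (norm (p - q))\<^sup>2))"
      proof -
        have "d \<le> (cf lam (2 * r) - \<bar>lam\<bar>) / 4" unfolding d_def using cf_antimono[of "2 * r" "2 * r1" lam] r0 r t by simp
        then have "d * (norm (p - q))\<^sup>2 \<le> (cf lam (2 * r) - \<bar>lam\<bar>) / 4 * (norm (p - q))\<^sup>2" by (rule mult_right_mono) simp
        then show ?thesis using A by (simp add: norm_minus_commute[of q p])
      qed
      finally have h: "h \<le> A * exp (- (d * (norm (p - q))\<^sup>2))" .
      have "norm (\<integral>x. \<Psi> x pq \<partial>lborel) = (cmod (G p) * Wtw lam t p) * (cmod (G q) * Wtw lam t q) * cmod (hk lam (2 * r) q (cconj p))"
        unfolding inner pq using W by (simp add: norm_mult)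
      also have "\<dots> = (u * v) * h"
      proof -
        have "Wtw lam t p = sqrt (Wtw lam t p) * sqrt (Wtw lam t p)" "Wtw lam t q = sqrt (Wtw lam t q) * sqrt (Wtw lam t q)" using W by auto
        then have "(cmod (G p) * Wtw lam t p) * (cmod (G q) * Wtw lam t q) * cmod (hk lam (2 * r) q (cconj p)) =
          (cmod (G p) * (sqrt (Wtw lam t p) * sqrt (Wtw lam t p))) * (cmod (G q) * (sqrt (Wtw lam t q) * sqrt (Wtw lam t q))) * cmod (hk lam (2 * r) q (cconj p))"
          by presburger
        then show ?thesis unfolding u_def v_def h_def by (simp only: mult_ac)
      qed
      also have "\<dots> \<le> (u\<^sup>2 + v\<^sup>2) * (A * exp (- (d * (norm (p - q))\<^sup>2)))"
        using uv h mult_le_sum_squares[of u v] W by (intro mult_mono) (auto simp: h_def)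
      also have "\<dots> = A * exp (- (d * (norm (p - q))\<^sup>2)) * ((cmod (G p))\<^sup>2 * Wtw lam t p) + A * exp (- (d * (norm (p - q))\<^sup>2)) * ((cmod (G q))\<^sup>2 * Wtw lam t q)"
        using W by (simp add: u_def v_def power_mult_distrib algebra_simps)
      finally show ?thesis
        unfolding pq k_def U_def fst_conv snd_conv using A W
        by (subst ennreal_mult[symmetric], simp, simp)+ (simp add: ennreal_leI flip: ennreal_plus)
    qed
    have adj_int: "integrable lborel (\<lambda>x. (cmod (adj lam t r G x))\<^sup>2)"
    proof -
      obtain C' \<delta>' where C': "C' \<ge> 0" "\<delta>' > 0" "\<And>x. cmod (adj lam t r G x) \<le> C' * exp (- (\<delta>' * (norm x)\<^sup>2))"
        using adj_gaussian_bound[OF t r1 G] r by metis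
      have "integrable lborel (\<lambda>x::'n rpt. C'\<^sup>2 * exp (- ((2 * \<delta>') * (norm x)\<^sup>2)))"
        by (intro integrable_mult_right integrable_gaussian) (use C' in auto)
      then show ?thesis
      proof (rule Bochner_Integration.integrable_bound)
        show "AE x in lborel. norm ((cmod (adj lam t r G x))\<^sup>2) \<le> norm (C'\<^sup>2 * exp (- ((2 * \<delta>') * (norm x)\<^sup>2)))"
        proof (rule AE_I2)
          fix x
          have "(cmod (adj lam t r G x))\<^sup>2 \<le> (C' * exp (- (\<delta>' * (norm x)\<^sup>2)))\<^sup>2" using C'(3) by (intro power_mono) auto
          also have "\<dots> = C'\<^sup>2 * exp (- ((2 * \<delta>') * (norm x)\<^sup>2))" by (simp add: power_mult_distrib exp_double[symmetric] mult.assoc)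
          finally show "norm ((cmod (adj lam t r G x))\<^sup>2) \<le> norm (C'\<^sup>2 * exp (- ((2 * \<delta>') * (norm x)\<^sup>2)))" by simp
        qed
      qed measurable
    qed
    have "(\<integral>\<^sup>+x. ennreal ((cmod (adj lam t r G x))\<^sup>2) \<partial>lborel) = ennreal (\<integral>x. (cmod (adj lam t r G x))\<^sup>2 \<partial>lborel)"
      by (rule nn_integral_eq_integral[OF adj_int]) auto
    also have "\<dots> = ennreal (norm (\<integral>x. complex_of_real ((cmod (adj lam t r G x))\<^sup>2) \<partial>lborel))"
      unfolding integral_complex_of_real norm_of_real by simp
    also have "\<dots> = ennreal (norm (\<integral>x. (\<integral>pq. \<Psi> x pq \<partial>(lborel \<Otimes>\<^sub>M lborel)) \<partial>lborel))"
      by (simp only: complex_norm_square adj)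
    also have "(\<integral>x. (\<integral>pq. \<Psi> x pq \<partial>(lborel \<Otimes>\<^sub>M lborel)) \<partial>lborel) = (\<integral>pq. (\<integral>x. \<Psi> x pq \<partial>lborel) \<partial>(lborel \<Otimes>\<^sub>M lborel))"
      unfolding lborel_prod by (rule lborel_pair.Fubini_integral[OF int\<Psi>, symmetric])
    also have "ennreal (norm \<dots>) \<le> (\<integral>\<^sup>+pq. ennreal (norm (\<integral>x. \<Psi> x pq \<partial>lborel)) \<partial>(lborel \<Otimes>\<^sub>M lborel))"
    proof (rule integral_norm_bound_ennreal)
      show "integrable (lborel \<Otimes>\<^sub>M lborel) (\<lambda>pq. \<integral>x. \<Psi> x pq \<partial>lborel)"
        unfolding lborel_prod by (rule lborel_pair.integrable_snd[OF int\<Psi>])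
    qed
    also have "\<dots> \<le> (\<integral>\<^sup>+pq. k (fst pq - snd pq) * U (fst pq) + k (fst pq - snd pq) * U (snd pq) \<partial>(lborel \<Otimes>\<^sub>M lborel))"
      by (intro nn_integral_mono inner_le)
    also have "\<dots> = (\<integral>\<^sup>+pq. k (fst pq - snd pq) * U (fst pq) \<partial>(lborel \<Otimes>\<^sub>M lborel)) + (\<integral>\<^sup>+pq. k (fst pq - snd pq) * U (snd pq) \<partial>(lborel \<Otimes>\<^sub>M lborel))"
      by (rule nn_integral_add) measurable
    also have "(\<integral>\<^sup>+pq. k (fst pq - snd pq) * U (fst pq) \<partial>(lborel \<Otimes>\<^sub>M lborel)) = (\<integral>\<^sup>+p. (\<integral>\<^sup>+q. k (p - q) * U p \<partial>lborel) \<partial>lborel)"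
      by (subst lborel.nn_integral_fst[symmetric]) auto
    also have "\<dots> = B * (\<integral>\<^sup>+p. U p \<partial>lborel)"
      by (simp add: nn_integral_multc nn_integral_lborel_reflect B_def nn_integral_cmult)
    also have "(\<integral>\<^sup>+pq. k (fst pq - snd pq) * U (snd pq) \<partial>(lborel \<Otimes>\<^sub>M lborel)) = (\<integral>\<^sup>+q. (\<integral>\<^sup>+p. k (p - q) * U q \<partial>lborel) \<partial>lborel)"
      by (subst lborel_pair.nn_integral_snd[symmetric]) auto
    also have "\<dots> = B * (\<integral>\<^sup>+p. U p \<partial>lborel)"
      using nn_integral_lborel_translate[OF km] by (simp add: nn_integral_multc B_def nn_integral_cmult flip: add_uminus_conv_diff)
    finally show ?thesis by (simp add: U_def distrib_right)
  qed
  show ?thesis by (rule that[of "B + B", OF _ main]) (use B in auto)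
qed

section \<open>Cut-off functions and an exchange of limits\<close>

lemma bsupp_diff: assumes "bsupp G" "bsupp H" shows "bsupp (\<lambda>p. G p - H p)"
proof -
  obtain R M where 1: "\<And>p. cmod (G p) \<le> M * indicator (cball 0 R) p" using assms(1) by (auto simp: bsupp_def)
  obtain R' M' where 2: "\<And>p. cmod (H p) \<le> M' * indicator (cball 0 R') p" using assms(2) by (auto simp: bsupp_def)
  have "cmod (G p - H p) \<le> (\<bar>M\<bar> + \<bar>M'\<bar>) * indicator (cball 0 (max R R')) p" for p
  proof -
    have "cmod (G p - H p) \<le> cmod (G p) + cmod (H p)" by (rule norm_triangle_ineq4)
    also have "\<dots> \<le> M * indicator (cball 0 R) p + M' * indicator (cball 0 R') p" using 1 2 by (rule add_mono)
    also have "\<dots> \<le> (\<bar>M\<bar> + \<bar>M'\<bar>) * indicator (cball 0 (max R R')) p"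
      by (auto simp: indicator_def)
    finally show ?thesis .
  qed
  moreover have "(\<lambda>p. G p - H p) \<in> borel_measurable borel" using assms by (auto simp: bsupp_def)
  ultimately show ?thesis unfolding bsupp_def by blast
qed

lemma bsupp_cutoff:
  assumes "continuous_on UNIV F"
  shows "bsupp (\<lambda>p. indicator (cball 0 R) p * F p)"
proof -
  have "compact (F ` cball 0 R)"
    by (intro compact_continuous_image continuous_on_subset[OF assms]) auto
  then obtain M where "\<And>p. p \<in> cball 0 R \<Longrightarrow> cmod (F p) \<le> M"
    by (meson bounded_iff compact_imp_bounded image_eqI)
  then have "cmod (indicator (cball 0 R) p * F p) \<le> M * indicator (cball 0 R) p" for p
    by (auto simp: indicator_def)
  moreover have "(\<lambda>p. indicator (cball 0 R) p * F p) \<in> borel_measurable borel"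
    by (intro borel_measurable_times borel_measurable_indicator borel_measurable_continuous_onI[OF assms]) simp
  ultimately show ?thesis unfolding bsupp_def by blast
qed

lemma adj_diff:
  assumes t: "t > 0" "lam \<noteq> 0" and r: "t \<le> r" and G: "bsupp G" "bsupp H"
  shows "adj lam t r (\<lambda>p. G p - H p) x = adj lam t r G x - adj lam t r H x"
  unfolding adj_def left_diff_distrib
  by (rule Bochner_Integration.integral_diff[OF adj_integrable[OF t r G(1)] adj_integrable[OF t r G(2)]])

lemma norm_add_square_le: "(norm (x + y))\<^sup>2 \<le> 2 * (norm x)\<^sup>2 + 2 * (norm y)\<^sup>2" for x y :: "'a::real_normed_vector"
proof -
  have "(norm (x + y))\<^sup>2 \<le> (norm x + norm y)\<^sup>2" by (intro power_mono norm_triangle_ineq) auto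
  also have "\<dots> \<le> 2 * (norm x)\<^sup>2 + 2 * (norm y)\<^sup>2"
    using sum_squares_bound[of "norm x" "norm y"] by (simp add: power2_sum)
  finally show ?thesis .
qed

lemma nn_integral_square_add_le:
  fixes f g :: "'a \<Rightarrow> complex"
  assumes [measurable]: "f \<in> borel_measurable M" "g \<in> borel_measurable M"
  shows "(\<integral>\<^sup>+x. ennreal ((cmod (f x + g x))\<^sup>2) \<partial>M) \<le>
     2 * (\<integral>\<^sup>+x. ennreal ((cmod (f x))\<^sup>2) \<partial>M) + 2 * (\<integral>\<^sup>+x. ennreal ((cmod (g x))\<^sup>2) \<partial>M)"
proof -
  have "ennreal ((cmod (f x + g x))\<^sup>2) \<le> 2 * ennreal ((cmod (f x))\<^sup>2) + 2 * ennreal ((cmod (g x))\<^sup>2)" for x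
    using ennreal_leI[OF norm_add_square_le[of "f x" "g x"]] by (simp add: ennreal_mult)
  then have "(\<integral>\<^sup>+x. ennreal ((cmod (f x + g x))\<^sup>2) \<partial>M) \<le> (\<integral>\<^sup>+x. 2 * ennreal ((cmod (f x))\<^sup>2) + 2 * ennreal ((cmod (g x))\<^sup>2) \<partial>M)"
    by (intro nn_integral_mono)
  also have "\<dots> = 2 * (\<integral>\<^sup>+x. ennreal ((cmod (f x))\<^sup>2) \<partial>M) + 2 * (\<integral>\<^sup>+x. ennreal ((cmod (g x))\<^sup>2) \<partial>M)"
    by (simp add: nn_integral_add nn_integral_cmult)
  finally show ?thesis .
qed

text \<open>The error \<open>b k\<close> is uniform in \<open>i\<close>, so \<open>k\<close> is
  chosen first and then \<open>i\<close> large for that \<open>k\<close>.\<close>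

lemma ennreal_tendsto_0_if_le_add:
  fixes a b :: "nat \<Rightarrow> ennreal" and e :: "nat \<Rightarrow> nat \<Rightarrow> ennreal"
  assumes le: "\<And>i k. a i \<le> b k + e k i" and b: "b \<longlonglongrightarrow> 0" and e: "\<And>k. e k \<longlonglongrightarrow> 0"
  shows "a \<longlonglongrightarrow> 0"
proof (rule order_tendstoI)
  fix u :: ennreal assume "0 < u"
  then obtain v where v: "0 < v" "ennreal v \<le> u"
  proof (cases u rule: ennreal_cases)
    case (real r)
    then show ?thesis using \<open>0 < u\<close> that[of r] by simp
  next
    case top
    then show ?thesis using that[of 1] by simp
  qed
  have h: "0 < ennreal (v / 2)" using v by simp
  obtain k where k: "b k < ennreal (v / 2)" using order_tendstoD(2)[OF b h] by (auto simp: eventually_sequentially)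
  show "eventually (\<lambda>i. a i < u) sequentially"
    using order_tendstoD(2)[OF e[of k] h]
  proof eventually_elim
    fix i assume "e k i < ennreal (v / 2)"
    then have "b k + e k i < ennreal (v / 2 + v / 2)" using k by (intro add_mono_ennreal)
    then show "a i < u" using le[of i k] v(2) by simp
  qed
qed simp

section \<open>Inversion of the heat transform\<close>

locale twisted_bargmann =
  fixes lam t :: real and F :: "'n::finite cpt \<Rightarrow> complex"
  assumes t0: "t > 0" and lam0: "lam \<noteq> 0" and F: "F \<in> Btw lam t"
begin

lemmas tl = t0 lam0

abbreviation W where "W \<equiv> Wtw lam t"

definition cut :: "nat \<Rightarrow> 'n cpt \<Rightarrow> complex" where
  "cut k p = indicator (cball 0 (real k)) p * F p"

text \<open>The squared weighted norm of \<open>F - cut k\<close>, in which all cut-off errors are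
  measured.\<close>

definition tail :: "nat \<Rightarrow> ennreal" where
  "tail k = (\<integral>\<^sup>+p. ennreal ((cmod (F p))\<^sup>2 * W p) * indicator (- cball 0 (real k)) p \<partial>lborel)"

lemma F_cont: "continuous_on UNIV F"
  using F by (auto simp: Btw_def intro: entire2n_continuous_on)

lemma F_meas [measurable]: "F \<in> borel_measurable borel"
  using F_cont by (rule borel_measurable_continuous_onI)

lemma bsupp_cut: "bsupp (cut k)"
  using bsupp_cutoff[OF F_cont] by (simp add: cut_def[abs_def])

lemma cut_meas [measurable]: "cut k \<in> borel_measurable borel"
  using bsupp_cut by (simp add: bsupp_def)

lemma tail_tendsto: "tail \<longlonglongrightarrow> 0"
proof -
  have "(\<lambda>k. tail k) \<longlonglongrightarrow> (\<integral>\<^sup>+p. 0 \<partial>(lborel :: 'n cpt measure))"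
    unfolding tail_def
  proof (rule nn_integral_dominated_convergence[where w="\<lambda>p. ennreal ((cmod (F p))\<^sup>2 * W p)"])
    show "(\<integral>\<^sup>+p. ennreal ((cmod (F p))\<^sup>2 * W p) \<partial>lborel) < \<infinity>" using F by (simp add: Btw_def)
    show "AE p in lborel. (\<lambda>k. ennreal ((cmod (F p))\<^sup>2 * W p) * indicator (- cball 0 (real k)) p) \<longlonglongrightarrow> 0"
    proof (rule AE_I2, rule tendsto_eventually)
      fix p :: "'n cpt"
      obtain N :: nat where N: "norm p \<le> real N" using real_arch_simple by blast
      show "eventually (\<lambda>k. ennreal ((cmod (F p))\<^sup>2 * W p) * indicator (- cball 0 (real k)) p = 0) sequentially"
        using eventually_ge_at_top[of N]
      proof eventually_elim
        fix k assume "N \<le> k"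
        then have "norm p \<le> real k" using N by (meson of_nat_le_iff order_trans)
        then show "ennreal ((cmod (F p))\<^sup>2 * W p) * indicator (- cball 0 (real k)) p = 0" by simp
      qed
    qed
  qed (auto split: split_indicator)
  then show ?thesis by simp
qed

lemma cut_diff_le_tail:
  assumes "k \<le> j"
  shows "(\<integral>\<^sup>+p. ennreal ((cmod (cut j p - cut k p))\<^sup>2 * W p) \<partial>lborel) \<le> tail k"
  unfolding tail_def
proof (rule nn_integral_mono)
  fix p :: "'n cpt"
  have "norm p \<le> real k \<Longrightarrow> norm p \<le> real j" using assms by (meson of_nat_le_iff order_trans)
  then show "ennreal ((cmod (cut j p - cut k p))\<^sup>2 * W p) \<le> ennreal ((cmod (F p))\<^sup>2 * W p) * indicator (- cball 0 (real k)) p"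
    by (auto simp: cut_def indicator_def)
qed

text \<open>Linearity reduces this to the Schur bound for \<open>cut j - cut k\<close>. The constant
  is fixed before \<open>r\<close>, \<open>j\<close> and \<open>k\<close>, so the same tail controls
  all times up to \<open>r1\<close>.\<close>

lemma adj_cut_diff_le:
  assumes r1: "t \<le> r1"
  obtains B where "B < \<infinity>" "\<And>r j k. t \<le> r \<Longrightarrow> r \<le> r1 \<Longrightarrow> k \<le> j \<Longrightarrow>
     (\<integral>\<^sup>+x. ennreal ((cmod (adj lam t r (cut j) x - adj lam t r (cut k) x))\<^sup>2) \<partial>lborel) \<le> B * tail k"
proof -
  obtain B where B: "B < \<infinity>" "\<And>(G :: 'n cpt \<Rightarrow> complex) r. bsupp G \<Longrightarrow> t \<le> r \<Longrightarrow> r \<le> r1 \<Longrightarrow>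
      (\<integral>\<^sup>+x. ennreal ((cmod (adj lam t r G x))\<^sup>2) \<partial>lborel) \<le> B * (\<integral>\<^sup>+p. ennreal ((cmod (G p))\<^sup>2 * Wtw lam t p) \<partial>lborel)"
    using adj_L2_bound[OF tl r1, where 'n='n] by blast
  show ?thesis
  proof (rule that[OF B(1)])
    fix r j k assume r: "t \<le> r" "r \<le> r1" and kj: "k \<le> (j::nat)"
    have "(\<integral>\<^sup>+x. ennreal ((cmod (adj lam t r (cut j) x - adj lam t r (cut k) x))\<^sup>2) \<partial>lborel)
      \<le> B * (\<integral>\<^sup>+p. ennreal ((cmod (cut j p - cut k p))\<^sup>2 * W p) \<partial>lborel)"
      using B(2)[OF bsupp_diff[OF bsupp_cut[of j] bsupp_cut[of k]] r]
      by (simp add: adj_diff[OF tl r(1) bsupp_cut bsupp_cut])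
    also have "\<dots> \<le> B * tail k" by (intro mult_left_mono cut_diff_le_tail kj) auto
    finally show "(\<integral>\<^sup>+x. ennreal ((cmod (adj lam t r (cut j) x - adj lam t r (cut k) x))\<^sup>2) \<partial>lborel) \<le> B * tail k" .
  qed
qed

lemma adj_L2:
  assumes r: "t \<le> r"
  shows "(\<integral>\<^sup>+x. ennreal ((cmod (adj lam t r (cut k) x))\<^sup>2) \<partial>lborel) < \<infinity>"
proof -
  obtain B where B: "B < \<infinity>" "\<And>(G :: 'n cpt \<Rightarrow> complex) r'. bsupp G \<Longrightarrow> t \<le> r' \<Longrightarrow> r' \<le> r \<Longrightarrow>
      (\<integral>\<^sup>+x. ennreal ((cmod (adj lam t r' G x))\<^sup>2) \<partial>lborel) \<le> B * (\<integral>\<^sup>+p. ennreal ((cmod (G p))\<^sup>2 * Wtw lam t p) \<partial>lborel)"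
    using adj_L2_bound[OF tl r, where 'n='n] by blast
  have "(\<integral>\<^sup>+p. ennreal ((cmod (cut k p))\<^sup>2 * W p) \<partial>lborel) \<le> (\<integral>\<^sup>+p. ennreal ((cmod (F p))\<^sup>2 * W p) \<partial>lborel)"
  proof (intro nn_integral_mono ennreal_leI)
    fix p :: "'n cpt"
    show "(cmod (cut k p))\<^sup>2 * W p \<le> (cmod (F p))\<^sup>2 * W p"
      using Wtw_pos[OF tl, of p] by (simp add: cut_def indicator_def)
  qed
  also have "\<dots> < \<infinity>" using F by (simp add: Btw_def)
  finally have "B * (\<integral>\<^sup>+p. ennreal ((cmod (cut k p))\<^sup>2 * W p) \<partial>lborel) < \<infinity>"
    using B(1) by (simp add: ennreal_mult_less_top)
  with B(2)[OF bsupp_cut r order_refl, of k] show ?thesis by (rule le_less_trans)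
qed

text \<open>Both \<open>F\<close> and the kernel are square integrable against \<open>W\<close>; for
  the kernel this is where \<open>s > 0\<close> is used.\<close>

lemma adj_F_integrable:
  assumes s: "s > 0"
  shows "integrable lborel (\<lambda>p. F p * cnj (hk lam (t + s) p (emb x)) * of_real (W p))"
proof -
  obtain \<delta> C where \<delta>: "\<delta> > 0" and b: "\<And>p. (cmod (hk lam (t + s) p (emb x)))\<^sup>2 * W p \<le> C * exp (- (\<delta> * (norm (p - emb x))\<^sup>2))"
    using hk_sq_weight_bound[OF tl s, of x] by blast
  have "integrable lborel (\<lambda>p::'n cpt. exp (- (\<delta> * (norm (p + - emb x))\<^sup>2)))"
    by (subst integral_lborel_translate(2)) (use integrable_gaussian[OF \<delta>, where 'a="'n cpt"] in auto)
  then have "integrable lborel (\<lambda>p. (cmod (F p))\<^sup>2 * W p + C * exp (- (\<delta> * (norm (p - emb x))\<^sup>2)))"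
    by (intro Bochner_Integration.integrable_add Btw_integrable[OF tl F] integrable_mult_right) simp
  then show ?thesis
  proof (rule Bochner_Integration.integrable_bound)
    have *: "norm (F p * cnj (hk lam (t + s) p (emb x)) * of_real (W p)) \<le> (cmod (F p))\<^sup>2 * W p + C * exp (- (\<delta> * (norm (p - emb x))\<^sup>2))" for p
    proof -
      have W: "W p > 0" by (rule Wtw_pos[OF tl])
      have "norm (F p * cnj (hk lam (t + s) p (emb x)) * of_real (W p)) = (cmod (F p) * sqrt (W p)) * (cmod (hk lam (t + s) p (emb x)) * sqrt (W p))"
        using W by (simp add: norm_mult)
      also have "\<dots> \<le> (cmod (F p) * sqrt (W p))\<^sup>2 + (cmod (hk lam (t + s) p (emb x)) * sqrt (W p))\<^sup>2"
        by (rule mult_le_sum_squares)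
      also have "\<dots> = (cmod (F p))\<^sup>2 * W p + (cmod (hk lam (t + s) p (emb x)))\<^sup>2 * W p"
        using W by (simp add: power_mult_distrib)
      finally show ?thesis using b[of p] by linarith
    qed
    show "AE p in lborel. norm (F p * cnj (hk lam (t + s) p (emb x)) * of_real (W p)) \<le> norm ((cmod (F p))\<^sup>2 * W p + C * exp (- (\<delta> * (norm (p - emb x))\<^sup>2)))"
      unfolding real_norm_def by (intro AE_I2 order_trans[OF * abs_ge_self])
  qed measurable
qed

section \<open>The integrals F_s and their approximation by cut-offs\<close>

lemma Fs_integrand_integrable:
  assumes s: "s > 0"
  shows "integrable lborel (Fs_integrand lam t F s a b)"
  unfolding Fs_integrand_eq[abs_def]
  by (subst integral_lborel_translate(2)[where f="\<lambda>p. F p * cnj (hk lam (t + s) p (emb (a, b))) * of_real (W p)"])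
     (use adj_F_integrable[OF s] in auto)

lemma Fs_eq_adj: "Fs lam t F s = adj lam t (t + s) F"
proof
  fix x :: "'n rpt"
  obtain a b where x: "x = (a, b)" by (cases x)
  have "Fs lam t F s x = integral\<^sup>L lborel (\<lambda>p. F (p + emb x) * cnj (hk lam (t + s) (p + emb x) (emb x)) * of_real (W (p + emb x)))"
    unfolding x Fs_def by (simp add: Fs_integrand_eq[abs_def])
  also have "\<dots> = adj lam t (t + s) F x"
    unfolding adj_def
    by (rule integral_lborel_translate(1)[where f="\<lambda>p. F p * cnj (hk lam (t + s) p (emb x)) * of_real (W p)"]) measurable
  finally show "Fs lam t F s x = adj lam t (t + s) F x" .
qed

lemma cut_tendsto: "(\<lambda>k. cut k p) \<longlonglongrightarrow> F p"
proof (rule tendsto_eventually)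
  obtain N :: nat where N: "norm p \<le> real N" using real_arch_simple by blast
  show "eventually (\<lambda>k. cut k p = F p) sequentially"
    using eventually_ge_at_top[of N]
  proof eventually_elim
    fix k assume "N \<le> k"
    then have "norm p \<le> real k" using N by (meson of_nat_le_iff order_trans)
    then show "cut k p = F p" by (simp add: cut_def)
  qed
qed

lemma cut_integral_tendsto:
  assumes h[measurable]: "h \<in> borel_measurable borel" and int: "integrable lborel (\<lambda>p. F p * h p)"
  shows "(\<lambda>k. integral\<^sup>L lborel (\<lambda>p. cut k p * h p)) \<longlonglongrightarrow> integral\<^sup>L lborel (\<lambda>p. F p * h p)"
proof (rule integral_dominated_convergence[where w="\<lambda>p. norm (F p * h p)"])
  show "AE p in lborel. (\<lambda>k. cut k p * h p) \<longlonglongrightarrow> F p * h p"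
    by (intro AE_I2 tendsto_mult cut_tendsto tendsto_const)
  show "AE p in lborel. norm (cut k p * h p) \<le> norm (F p * h p)" for k
    by (intro AE_I2) (simp add: cut_def indicator_def norm_mult)
qed (use int in auto)

lemma adj_cut_tendsto:
  assumes s: "s > 0"
  shows "(\<lambda>k. adj lam t (t + s) (cut k) x) \<longlonglongrightarrow> adj lam t (t + s) F x"
  unfolding adj_def mult.assoc
  by (rule cut_integral_tendsto) (use adj_F_integrable[OF s, of x] in \<open>auto simp: mult.assoc\<close>)

text \<open>Pointwise the cut-off integrals converge to the full one for \<open>s > 0\<close>, so
  Fatou's lemma carries the bound to \<open>F\<close> itself, still with one constant for all
  \<open>s\<close> in the range.\<close>

lemma adj_F_diff_le:
  assumes r1: "t \<le> r1"
  obtains B where "B < \<infinity>" "\<And>s k. 0 < s \<Longrightarrow> t + s \<le> r1 \<Longrightarrow>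
     (\<integral>\<^sup>+x. ennreal ((cmod (adj lam t (t + s) F x - adj lam t (t + s) (cut k) x))\<^sup>2) \<partial>lborel) \<le> B * tail k"
proof -
  obtain B where B: "B < \<infinity>" "\<And>r j k. t \<le> r \<Longrightarrow> r \<le> r1 \<Longrightarrow> k \<le> j \<Longrightarrow>
     (\<integral>\<^sup>+x. ennreal ((cmod (adj lam t r (cut j) x - adj lam t r (cut k) x))\<^sup>2) \<partial>lborel) \<le> B * tail k"
    using adj_cut_diff_le[OF r1] by blast
  show ?thesis
  proof (rule that[OF B(1)])
    fix s k assume s: "(0::real) < s" "t + s \<le> r1"
    show "(\<integral>\<^sup>+x. ennreal ((cmod (adj lam t (t + s) F x - adj lam t (t + s) (cut k) x))\<^sup>2) \<partial>lborel) \<le> B * tail k"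
    proof (rule nn_integral_square_diff_le_lim)
      show "AE x in lborel. (\<lambda>j. adj lam t (t + s) (cut j) x) \<longlonglongrightarrow> adj lam t (t + s) F x"
        using adj_cut_tendsto[OF s(1)] by simp
      show "eventually (\<lambda>j. (\<integral>\<^sup>+x. ennreal ((cmod (adj lam t (t + s) (cut j) x - adj lam t (t + s) (cut k) x))\<^sup>2) \<partial>lborel) \<le> B * tail k) sequentially"
        using eventually_ge_at_top[of k] by eventually_elim (use B(2) s in auto)
    qed measurable
  qed
qed

lemma Fs_L2:
  assumes s: "s > 0"
  shows "L2 (Fs lam t F s)"
proof -
  obtain B where B: "B < \<infinity>" "\<And>s' k. 0 < s' \<Longrightarrow> t + s' \<le> t + s \<Longrightarrow>
     (\<integral>\<^sup>+x. ennreal ((cmod (adj lam t (t + s') F x - adj lam t (t + s') (cut k) x))\<^sup>2) \<partial>lborel) \<le> B * tail k"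
    using adj_F_diff_le[of "t + s"] s by auto
  \<comment> \<open>Index 0 is an arbitrary comparison point: a finite tail suffices here.\<close>
  let ?a = "adj lam t (t + s) F" and ?b = "adj lam t (t + s) (cut 0)"
  have "tail 0 \<le> (\<integral>\<^sup>+p. ennreal ((cmod (F p))\<^sup>2 * W p) \<partial>lborel)"
    unfolding tail_def by (intro nn_integral_mono) (auto split: split_indicator)
  also have "\<dots> < \<infinity>" using F by (simp add: Btw_def)
  finally have "B * tail 0 < \<infinity>" using B(1) by (simp add: ennreal_mult_less_top)
  then have 1: "(\<integral>\<^sup>+x. ennreal ((cmod (?a x - ?b x))\<^sup>2) \<partial>lborel) < \<infinity>"
    using B(2)[OF s order_refl, of 0] by (rule le_less_trans[rotated])
  have 2: "(\<integral>\<^sup>+x. ennreal ((cmod (?b x))\<^sup>2) \<partial>lborel) < \<infinity>" using s by (intro adj_L2) auto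
  have "(\<integral>\<^sup>+x. ennreal ((cmod (?a x))\<^sup>2) \<partial>lborel) \<le> 2 * (\<integral>\<^sup>+x. ennreal ((cmod (?a x - ?b x))\<^sup>2) \<partial>lborel) + 2 * (\<integral>\<^sup>+x. ennreal ((cmod (?b x))\<^sup>2) \<partial>lborel)"
    using nn_integral_square_add_le[of "\<lambda>x. ?a x - ?b x" lborel ?b] by simp
  also have "\<dots> < \<infinity>" using 1 2 by (simp add: ennreal_mult_less_top)
  finally show ?thesis by (simp add: L2_def Fs_eq_adj)
qed

text \<open>Transform after adjoint is integration against the reproducing kernel, by Fubini and the
  semigroup law. The cut-off supplies the absolute convergence at time \<open>t\<close>.\<close>

lemma Htw_adj_cut:
  "integrable lborel (\<lambda>x. adj lam t t (cut k) x * hk lam t p (emb x))"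
  "integral\<^sup>L lborel (\<lambda>x. adj lam t t (cut k) x * hk lam t p (emb x)) =
     integral\<^sup>L lborel (\<lambda>q. cut k q * (hk lam (2 * t) p (cconj q) * of_real (W q)))"
proof -
  define a where "a = (\<lambda>x q. cut k q * cnj (hk lam t q (emb x)) * of_real (W q) * hk lam t p (emb x))"
  have am: "case_prod a \<in> borel_measurable (borel \<Otimes>\<^sub>M borel)" unfolding a_def case_prod_unfold by measurable
  obtain C \<delta> where C: "C \<ge> 0" "\<delta> > 0" and b: "\<And>q x. cmod (cut k q * cnj (hk lam t q (emb x)) * of_real (W q)) \<le> C * exp (- (norm q)\<^sup>2) * exp (- (\<delta> * (norm x)\<^sup>2))"
    using adj_integrand_bound[OF tl order_refl bsupp_cut, of k] by (metis order_refl)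
  obtain D \<epsilon> where D: "D \<ge> 0" "\<epsilon> > 0" and d: "\<And>x. cmod (hk lam t p (emb x)) \<le> D * exp (- (\<epsilon> * (norm x)\<^sup>2))"
    using hk_local_bound[OF tl order_refl norm_ge_zero[of p], where 'n='n] by (metis order_refl)
  define m where "m = min 1 \<delta>"
  have m: "m > 0" "m \<le> 1" "m \<le> \<delta>" using C by (auto simp: m_def)
  have i1: "integrable lborel (\<lambda>z :: 'n rpt \<times> 'n cpt. (C * D) * exp (- (m * (norm z)\<^sup>2)))"
    by (intro integrable_mult_right integrable_gaussian m)
  have i2: "case_prod a \<in> borel_measurable lborel" using am unfolding borel_prod by simp
  have i3: "norm (case_prod a z) \<le> norm ((C * D) * exp (- (m * (norm z)\<^sup>2)))" for z
  proof -
    obtain x q where z: "z = (x, q)" by (cases z)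
    have nz: "(norm z)\<^sup>2 = (norm x)\<^sup>2 + (norm q)\<^sup>2" by (simp add: z norm_Pair)
    have "cmod (hk lam t p (emb x)) \<le> D * 1"
      using D by (intro order_trans[OF d mult_left_mono]) auto
    then have "cmod (a x q) \<le> (C * exp (- (norm q)\<^sup>2) * exp (- (\<delta> * (norm x)\<^sup>2))) * D"
      unfolding a_def norm_mult[of _ "hk lam t p (emb x)"] using b[of q x] C by (intro mult_mono) auto
    also have "\<dots> = (C * D) * exp (- ((norm q)\<^sup>2 + \<delta> * (norm x)\<^sup>2))"
      unfolding minus_add_distrib exp_add by (simp add: mult_ac)
    also have "\<dots> \<le> (C * D) * exp (- (m * (norm z)\<^sup>2))"
    proof -
      have "m * (norm x)\<^sup>2 \<le> \<delta> * (norm x)\<^sup>2" "m * (norm q)\<^sup>2 \<le> (norm q)\<^sup>2"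
        using m by (auto intro!: mult_right_mono mult_left_le_one_le)
      then have "m * (norm z)\<^sup>2 \<le> (norm q)\<^sup>2 + \<delta> * (norm x)\<^sup>2" by (simp add: nz distrib_left)
      then show ?thesis using C D by (intro mult_left_mono) auto
    qed
    finally show ?thesis using C D by (simp add: z)
  qed
  have "integrable lborel (case_prod a)"
    by (rule Bochner_Integration.integrable_bound[OF i1 i2]) (rule AE_I2, rule i3)
  then have int: "integrable (lborel \<Otimes>\<^sub>M lborel) (case_prod a)" by (simp add: lborel_prod)
  have e1: "(\<integral>q. a x q \<partial>lborel) = adj lam t t (cut k) x * hk lam t p (emb x)" for x
    by (simp add: a_def adj_def)
  have e2: "(\<integral>x. a x q \<partial>lborel) = cut k q * (hk lam (2 * t) p (cconj q) * of_real (W q))" for q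
  proof -
    have "a x q = (cut k q * of_real (W q)) * (hk lam t p (emb x) * cnj (hk lam t q (emb x)))" for x
      by (simp add: a_def mult_ac)
    then show ?thesis using hk_semigroup[OF tl, of p q] by (simp add: has_bochner_integral_iff mult_ac)
  qed
  show "integrable lborel (\<lambda>x. adj lam t t (cut k) x * hk lam t p (emb x))"
    using lborel_pair.integrable_fst[OF int] by (simp only: e1)
  show "integral\<^sup>L lborel (\<lambda>x. adj lam t t (cut k) x * hk lam t p (emb x)) =
     integral\<^sup>L lborel (\<lambda>q. cut k q * (hk lam (2 * t) p (cconj q) * of_real (W q)))"
    using lborel_pair.Fubini_integral[OF int] by (simp only: e1 e2)
qed

lemma hk_L2: "(\<integral>\<^sup>+x. ennreal ((cmod (hk lam t p (emb x)))\<^sup>2) \<partial>lborel) < \<infinity>" for p :: "'n cpt"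
proof -
  obtain D \<epsilon> where D: "D \<ge> 0" "\<epsilon> > 0" and d: "\<And>x. cmod (hk lam t p (emb x)) \<le> D * exp (- (\<epsilon> * (norm x)\<^sup>2))"
    using hk_local_bound[OF tl order_refl norm_ge_zero[of p], where 'n='n] by (metis order_refl)
  have "(cmod (hk lam t p (emb x)))\<^sup>2 \<le> D\<^sup>2 * exp (- ((2 * \<epsilon>) * (norm x)\<^sup>2))" for x
  proof -
    have "(cmod (hk lam t p (emb x)))\<^sup>2 \<le> (D * exp (- (\<epsilon> * (norm x)\<^sup>2)))\<^sup>2" using d by (intro power_mono) auto
    then show ?thesis by (simp add: power_mult_distrib exp_double[symmetric] mult.assoc)
  qed
  then have "(\<integral>\<^sup>+x. ennreal ((cmod (hk lam t p (emb x)))\<^sup>2) \<partial>lborel) \<le> (\<integral>\<^sup>+x. ennreal (D\<^sup>2 * exp (- ((2 * \<epsilon>) * (norm x)\<^sup>2))) \<partial>(lborel :: 'n rpt measure))"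
    by (intro nn_integral_mono ennreal_leI)
  also have "\<dots> < \<infinity>"
    using gaussian_nn_integral_finite[of "2 * \<epsilon>", where 'a="'n rpt"] D
    by (simp add: ennreal_mult nn_integral_cmult ennreal_mult_less_top)
  finally show ?thesis .
qed

lemma bound_tail_tendsto: "B < \<infinity> \<Longrightarrow> (\<lambda>k. B * tail k) \<longlonglongrightarrow> 0"
  using ennreal_tendsto_cmult[OF _ tail_tendsto, of B] by simp

text \<open>The functions \<open>adj lam t t (cut k)\<close> are Cauchy in L^2 with modulus
  \<open>B * tail k\<close>, and \<open>f\<close> is their limit. The rate of approximation is
  returned as well, since \<open>f\<close> is later compared with F_s through the same
  cut-offs.\<close>

lemma Htw_preimage:
  obtains f B where "L2 f" "Htw lam t f = F" "B < \<infinity>"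
    "\<And>k. (\<integral>\<^sup>+x. ennreal ((cmod (f x - adj lam t t (cut k) x))\<^sup>2) \<partial>lborel) \<le> B * tail k"
proof -
  obtain B where B: "B < \<infinity>" "\<And>r j k. t \<le> r \<Longrightarrow> r \<le> t \<Longrightarrow> k \<le> j \<Longrightarrow>
     (\<integral>\<^sup>+x. ennreal ((cmod (adj lam t r (cut j) x - adj lam t r (cut k) x))\<^sup>2) \<partial>lborel) \<le> B * tail k"
    using adj_cut_diff_le[OF order_refl] by blast
  note Bt = bound_tail_tendsto[OF B(1)]
  obtain f where fm: "f \<in> borel_measurable lborel"
    and f: "\<And>k. (\<integral>\<^sup>+x. ennreal ((cmod (f x - adj lam t t (cut k) x))\<^sup>2) \<partial>lborel) \<le> B * tail k"
    using L2_Cauchy_limit[of "\<lambda>k. adj lam t t (cut k)" lborel "\<lambda>k. B * tail k"] Bt B(2) by auto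
  note [measurable] = fm
  have L2f: "(\<integral>\<^sup>+x. ennreal ((cmod (f x))\<^sup>2) \<partial>lborel) < \<infinity>"
  proof -
    obtain k where "B * tail k < 1" using order_tendstoD(2)[OF Bt, of 1] by (auto simp: eventually_sequentially)
    then have "(\<integral>\<^sup>+x. ennreal ((cmod (f x - adj lam t t (cut k) x))\<^sup>2) \<partial>lborel) < 1"
      using f[of k] by (rule le_less_trans[rotated])
    then have 1: "(\<integral>\<^sup>+x. ennreal ((cmod (f x - adj lam t t (cut k) x))\<^sup>2) \<partial>lborel) < \<infinity>"
      by (rule less_trans) simp
    have "(\<integral>\<^sup>+x. ennreal ((cmod (f x))\<^sup>2) \<partial>lborel) \<le> 2 * (\<integral>\<^sup>+x. ennreal ((cmod (f x - adj lam t t (cut k) x))\<^sup>2) \<partial>lborel)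
       + 2 * (\<integral>\<^sup>+x. ennreal ((cmod (adj lam t t (cut k) x))\<^sup>2) \<partial>lborel)"
      using nn_integral_square_add_le[of "\<lambda>x. f x - adj lam t t (cut k) x" lborel "adj lam t t (cut k)"] by simp
    also have "\<dots> < \<infinity>" using 1 adj_L2[OF order_refl, of k] by (simp add: ennreal_mult_less_top)
    finally show ?thesis .
  qed
  have "Htw lam t f p = F p" for p
  proof -
    \<comment> \<open>The transform at \<open>p\<close> is the pairing with an L^2 function, hence
      continuous along the cut-offs. The same integrals tend to \<open>F p\<close> by the
      reproducing formula, and the limits agree.\<close>
    have "(\<lambda>k. integral\<^sup>L lborel (\<lambda>x. adj lam t t (cut k) x * hk lam t p (emb x))) \<longlonglongrightarrow> integral\<^sup>L lborel (\<lambda>x. f x * hk lam t p (emb x))"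
      by (rule L2_pairing_tendsto[OF _ _ _ hk_L2 _ Htw_adj_cut(1) Bt f])
         (auto intro!: integrable_L2_mult L2f hk_L2)
    moreover have "(\<lambda>k. integral\<^sup>L lborel (\<lambda>x. adj lam t t (cut k) x * hk lam t p (emb x))) \<longlonglongrightarrow> F p"
    proof -
      have rf: "has_bochner_integral lborel (\<lambda>q. F q * (hk lam (2 * t) p (cconj q) * of_real (W q))) (F p)"
        using reproducing_formula[OF tl F, of p] by (simp add: mult.assoc)
      then show ?thesis
        unfolding Htw_adj_cut(2)
        using cut_integral_tendsto[of "\<lambda>q. hk lam (2 * t) p (cconj q) * of_real (W q)"] by (simp add: has_bochner_integral_iff)
    qed
    ultimately show ?thesis unfolding Htw_hk using LIMSEQ_unique by blast
  qed
  then have "Htw lam t f = F" by (rule ext)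
  moreover have "L2 f" using L2f by (simp add: L2_def)
  ultimately show ?thesis using that[of f B] B(1) f by blast
qed

section \<open>The limit as s tends to 0\<close>

lemma hk_tendsto:
  assumes X: "X \<longlonglongrightarrow> (0::real)" "\<And>i. 0 < X i"
  shows "(\<lambda>i. hk lam (t + X i) p q) \<longlonglongrightarrow> hk lam t p (q :: 'n cpt)"
proof -
  have tX: "(\<lambda>i. t + X i) \<longlonglongrightarrow> t" using tendsto_add[OF tendsto_const X(1), of t] by simp
  have pos: "t + X i \<in> {0<..}" for i using X(2)[of i] t0 by simp
  have t: "t \<in> {0<..}" using t0 by simp
  have "(\<lambda>i. cf lam (t + X i)) \<longlonglongrightarrow> cf lam t"
    by (rule continuous_on_tendsto_compose[OF continuous_on_cf[OF lam0] tX t]) (use pos in simp)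
  moreover have "(\<lambda>i. nf TYPE('n) lam (t + X i)) \<longlonglongrightarrow> nf TYPE('n) lam t"
    by (rule continuous_on_tendsto_compose[OF continuous_on_nf[OF lam0] tX t]) (use pos in simp)
  ultimately show ?thesis unfolding hk_def
    by (intro tendsto_mult tendsto_exp tendsto_diff tendsto_minus tendsto_of_real tendsto_divide tendsto_const) auto
qed

text \<open>Dominated convergence twice for a fixed cut-off: over \<open>p\<close> for each
  \<open>x\<close>, then over \<open>x\<close>. The condition \<open>X i \<le> 1\<close> keeps all
  times in the interval from \<open>t\<close> to \<open>t + 1\<close>, where common majorants
  exist.\<close>

lemma adj_cut_L2_tendsto:
  assumes X: "X \<longlonglongrightarrow> (0::real)" "\<And>i. 0 < X i" "\<And>i. X i \<le> 1"
  shows "(\<lambda>i. \<integral>\<^sup>+x. ennreal ((cmod (adj lam t (t + X i) (cut k) x - adj lam t t (cut k) x))\<^sup>2) \<partial>lborel) \<longlonglongrightarrow> 0"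
proof -
  have t1: "t \<le> t + 1" by simp
  have rX: "t \<le> t + X i" "t + X i \<le> t + 1" for i using X(2,3)[of i] by auto
  have pt: "(\<lambda>i. adj lam t (t + X i) (cut k) x) \<longlonglongrightarrow> adj lam t t (cut k) x" for x
  proof -
    obtain C \<delta> where "C \<ge> 0" "\<delta> > 0" and b: "\<And>r p x. t \<le> r \<Longrightarrow> r \<le> t + 1 \<Longrightarrow> cmod (cut k p * cnj (hk lam r p (emb x)) * of_real (W p))
        \<le> C * exp (- (norm p)\<^sup>2) * exp (- (\<delta> * (norm x)\<^sup>2))"
      by (rule adj_integrand_bound[OF tl t1 bsupp_cut[of k]]) blast
    show ?thesis unfolding adj_def
    proof (rule integral_dominated_convergence[where w="\<lambda>p. C * exp (- (1 * (norm p)\<^sup>2)) * exp (- (\<delta> * (norm x)\<^sup>2))"])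
      show "integrable lborel (\<lambda>p::'n cpt. C * exp (- (1 * (norm p)\<^sup>2)) * exp (- (\<delta> * (norm x)\<^sup>2)))"
        by (intro integrable_mult_left integrable_mult_right integrable_gaussian) auto
      show "AE p in lborel. (\<lambda>i. cut k p * cnj (hk lam (t + X i) p (emb x)) * of_real (W p)) \<longlonglongrightarrow> cut k p * cnj (hk lam t p (emb x)) * of_real (W p)"
        by (intro AE_I2 tendsto_intros hk_tendsto X)
      show "AE p in lborel. norm (cut k p * cnj (hk lam (t + X i) p (emb x)) * of_real (W p)) \<le> C * exp (- (1 * (norm p)\<^sup>2)) * exp (- (\<delta> * (norm x)\<^sup>2))" for i
        using b[OF rX] by (intro AE_I2) simp
    qed measurable
  qed
  obtain C \<delta> where C: "C \<ge> 0" "\<delta> > 0" and b: "\<And>r x. t \<le> r \<Longrightarrow> r \<le> t + 1 \<Longrightarrow> cmod (adj lam t r (cut k) x) \<le> C * exp (- (\<delta> * (norm x)\<^sup>2))"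
    by (rule adj_gaussian_bound[OF tl t1 bsupp_cut[of k]]) blast
  have "(\<lambda>i. \<integral>\<^sup>+x. ennreal ((cmod (adj lam t (t + X i) (cut k) x - adj lam t t (cut k) x))\<^sup>2) \<partial>lborel) \<longlonglongrightarrow> (\<integral>\<^sup>+x. 0 \<partial>(lborel :: 'n rpt measure))"
  proof (rule nn_integral_dominated_convergence[where w="\<lambda>x. ennreal ((4 * C\<^sup>2) * exp (- ((2 * \<delta>) * (norm x)\<^sup>2)))"])
    show "(\<integral>\<^sup>+x. ennreal ((4 * C\<^sup>2) * exp (- ((2 * \<delta>) * (norm x)\<^sup>2))) \<partial>(lborel :: 'n rpt measure)) < \<infinity>"
      using gaussian_nn_integral_finite[of "2 * \<delta>", where 'a="'n rpt"] C
      by (simp add: ennreal_mult nn_integral_cmult ennreal_mult_less_top)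
    show "AE x in lborel. ennreal ((cmod (adj lam t (t + X i) (cut k) x - adj lam t t (cut k) x))\<^sup>2) \<le> ennreal ((4 * C\<^sup>2) * exp (- ((2 * \<delta>) * (norm x)\<^sup>2)))" for i
    proof (intro AE_I2 ennreal_leI)
      fix x
      have "cmod (adj lam t (t + X i) (cut k) x - adj lam t t (cut k) x) \<le> 2 * C * exp (- (\<delta> * (norm x)\<^sup>2))"
        using norm_triangle_ineq4[of "adj lam t (t + X i) (cut k) x" "adj lam t t (cut k) x"] b[OF rX, of i x] b[OF order_refl t1, of x] by linarith
      then have "(cmod (adj lam t (t + X i) (cut k) x - adj lam t t (cut k) x))\<^sup>2 \<le> (2 * C * exp (- (\<delta> * (norm x)\<^sup>2)))\<^sup>2"
        by (intro power_mono) auto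
      then show "(cmod (adj lam t (t + X i) (cut k) x - adj lam t t (cut k) x))\<^sup>2 \<le> (4 * C\<^sup>2) * exp (- ((2 * \<delta>) * (norm x)\<^sup>2))"
        by (simp add: power_mult_distrib exp_double[symmetric] mult.assoc)
    qed
    show "AE x in lborel. (\<lambda>i. ennreal ((cmod (adj lam t (t + X i) (cut k) x - adj lam t t (cut k) x))\<^sup>2)) \<longlonglongrightarrow> 0"
    proof (rule AE_I2)
      fix x
      have "(\<lambda>i. ennreal ((cmod (adj lam t (t + X i) (cut k) x - adj lam t t (cut k) x))\<^sup>2)) \<longlonglongrightarrow> ennreal ((cmod (adj lam t t (cut k) x - adj lam t t (cut k) x))\<^sup>2)"
        by (intro tendsto_intros pt)
      then show "(\<lambda>i. ennreal ((cmod (adj lam t (t + X i) (cut k) x - adj lam t t (cut k) x))\<^sup>2)) \<longlonglongrightarrow> 0" by simp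
    qed
  qed measurable
  then show ?thesis by simp
qed

text \<open>F_s is compared with its cut-off at time \<open>t + s\<close>, that with the cut-off at
  time \<open>t\<close>, and the latter with \<open>f\<close>. The outer errors are bounded by the
  tail uniformly in \<open>s\<close>; only the middle one depends on \<open>s\<close>, for fixed
  \<open>k\<close>.\<close>

lemma Fs_tendsto:
  assumes f: "f \<in> borel_measurable lborel" and B: "B < \<infinity>"
    "\<And>k. (\<integral>\<^sup>+x. ennreal ((cmod (f x - adj lam t t (cut k) x))\<^sup>2) \<partial>lborel) \<le> B * tail k"
  shows "((\<lambda>s. L2dist2 (Fs lam t F s) f) \<longlongrightarrow> 0) (at_right 0)"
proof -
  note [measurable] = f
  obtain B' where B': "B' < \<infinity>" "\<And>s k. 0 < s \<Longrightarrow> t + s \<le> t + 1 \<Longrightarrow>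
     (\<integral>\<^sup>+x. ennreal ((cmod (adj lam t (t + s) F x - adj lam t (t + s) (cut k) x))\<^sup>2) \<partial>lborel) \<le> B' * tail k"
    using adj_F_diff_le[of "t + 1"] by auto
  have "(\<lambda>i. L2dist2 (Fs lam t F (X i)) f) \<longlonglongrightarrow> 0" if X: "X \<longlonglongrightarrow> (0::real)" "\<And>i. 0 < X i" "\<And>i. X i \<le> 1" for X
  proof (rule ennreal_tendsto_0_if_le_add)
    define e where "e k i = (\<integral>\<^sup>+x. ennreal ((cmod (adj lam t (t + X i) (cut k) x - adj lam t t (cut k) x))\<^sup>2) \<partial>lborel)" for k i
    show "(\<lambda>k. 2 * (B' * tail k) + 4 * (B * tail k)) \<longlonglongrightarrow> 0"
      using tendsto_add[OF ennreal_tendsto_cmult[OF _ bound_tail_tendsto[OF B'(1)], of 2] ennreal_tendsto_cmult[OF _ bound_tail_tendsto[OF B(1)], of 4]]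
      by simp
    show "(\<lambda>i. 4 * e k i) \<longlonglongrightarrow> 0" for k
      using ennreal_tendsto_cmult[OF _ adj_cut_L2_tendsto[OF X, of k], of 4] by (simp add: e_def)
    fix i k
    let ?a = "adj lam t (t + X i) F" and ?b = "adj lam t (t + X i) (cut k)" and ?c = "adj lam t t (cut k)"
    have 1: "(\<integral>\<^sup>+x. ennreal ((cmod (?a x - ?b x))\<^sup>2) \<partial>lborel) \<le> B' * tail k"
      using X(2,3)[of i] by (intro B'(2)) auto
    have 2: "(\<integral>\<^sup>+x. ennreal ((cmod (?c x - f x))\<^sup>2) \<partial>lborel) \<le> B * tail k"
      using B(2)[of k] by (simp add: norm_minus_commute)
    have "L2dist2 (Fs lam t F (X i)) f \<le> 2 * (\<integral>\<^sup>+x. ennreal ((cmod (?a x - ?b x))\<^sup>2) \<partial>lborel)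
        + 2 * (\<integral>\<^sup>+x. ennreal ((cmod (?b x - f x))\<^sup>2) \<partial>lborel)"
      using nn_integral_square_add_le[of "\<lambda>x. ?a x - ?b x" lborel "\<lambda>x. ?b x - f x"] by (simp add: L2dist2_def Fs_eq_adj)
    also have "\<dots> \<le> 2 * (B' * tail k) + 2 * (2 * e k i + 2 * (B * tail k))"
    proof (intro add_mono mult_left_mono 1)
      have "(\<integral>\<^sup>+x. ennreal ((cmod (?b x - f x))\<^sup>2) \<partial>lborel) \<le> 2 * e k i + 2 * (\<integral>\<^sup>+x. ennreal ((cmod (?c x - f x))\<^sup>2) \<partial>lborel)"
        using nn_integral_square_add_le[of "\<lambda>x. ?b x - ?c x" lborel "\<lambda>x. ?c x - f x"] by (simp add: e_def)
      also have "\<dots> \<le> 2 * e k i + 2 * (B * tail k)" by (intro add_mono mult_left_mono 2) auto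
      finally show "(\<integral>\<^sup>+x. ennreal ((cmod (?b x - f x))\<^sup>2) \<partial>lborel) \<le> 2 * e k i + 2 * (B * tail k)" .
    qed auto
    also have "\<dots> = (2 * (B' * tail k) + 4 * (B * tail k)) + 4 * e k i" by (simp add: algebra_simps)
    finally show "L2dist2 (Fs lam t F (X i)) f \<le> (2 * (B' * tail k) + 4 * (B * tail k)) + 4 * e k i" .
  qed
  \<comment> \<open>Sequences with values in (0,1] test the limit at 0 within the closed unit
    interval, which is the limit from the right.\<close>
  then have "((\<lambda>s. L2dist2 (Fs lam t F s) f) \<longlongrightarrow> 0) (at 0 within {0..1})"
    unfolding tendsto_at_iff_sequentially by (auto simp: o_def less_le)
  then show ?thesis by (simp add: at_within_Icc_at_right)
qed

end

theorem theorem4p8: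
  fixes F :: "(complex^'n) \<times> (complex^'n) \<Rightarrow> complex"
    and t lam :: real
  assumes "t > 0" and "lam \<noteq> 0" and "F \<in> Btw lam t"
  shows "(\<forall>s>0. \<forall>a b. integrable lborel (Fs_integrand lam t F s a b))
       \<and> (\<forall>s>0. L2 (Fs lam t F s))
       \<and> (\<exists>f. L2 f \<and> Htw lam t f = F
              \<and> ((\<lambda>s. L2dist2 (Fs lam t F s) f) \<longlongrightarrow> 0) (at_right 0))"
proof -
  interpret twisted_bargmann lam t F by standard (use assms in auto)
  obtain f B where f: "L2 f" "Htw lam t f = F" and B: "B < \<infinity>"
    "\<And>k. (\<integral>\<^sup>+x. ennreal ((cmod (f x - adj lam t t (cut k) x))\<^sup>2) \<partial>lborel) \<le> B * tail k"
    using Htw_preimage by blast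
  have "((\<lambda>s. L2dist2 (Fs lam t F s) f) \<longlongrightarrow> 0) (at_right 0)"
    using f(1) B by (intro Fs_tendsto) (auto simp: L2_def)
  with f show ?thesis using Fs_integrand_integrable Fs_L2 by blast
qed

end
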